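(* Let $V\in L^1_{\mathrm{loc}}([0,\infty))$ be real-valued and such that $-\frac{d^2}{dx^2}+V$ is limit-point at $+\infty$, and let $H_+=-\frac{d^2}{dx^2}+V$ on $L^2([0,\infty))$ with Dirichlet boundary condition at $0$. Assume that at the point $\xi\in\mathbb R$ the normal limit $\lim_{y\downarrow0}m_+(\xi+iy)=\eta$ exists and is in $\mathbb C_+$. Then for any sequences $0\le a_l<b_l$ with $b_l\to\infty$ and $$\limsup_{l\to\infty}\frac{c_{[0,a_l]}}{c_{[0,b_l]}}<1$$ we have, for all $j\in\mathbb Z$, $$\lim_{l\to\infty}c_{[a_l,b_l]}\left(\xi_{j+1}^{[a_l,b_l]}-\xi_j^{[a_l,b_l]}\right)=1 .$$
   Context: $\mathbb C_+=\{z\in\mathbb C:\Im z>0\}$. $H_+$ has domain $\{\psi\in L^2([0,\infty)):\psi,\psi'\in AC_{\mathrm{loc}}([0,\infty)),\ -\psi''+V\psi\in L^2([0,\infty)),\ \psi(0)=0\}$. Its Weyl function is $m_+(z)=u_z'(0)/u_z(0)$ for $z\in\mathbb C_+$, where $u_z$ is a nontrivial solution of $-u''+Vu=zu$ that is square-integrable near $+\infty$. For $0\le a<b$, $H_{[a,b]}=-\frac{d^2}{dx^2}+V$ on $L^2([a,b])$ with domain $\{\psi\in L^2([a,b]):\psi,\psi'\in AC([a,b]),\ -\psi''+V\psi\in L^2([a,b]),\ \psi(a)=\psi(b)=0\}$. Its eigenvalues are labelled around $\xi$ by $$\dots<\xi_{-1}^{[a,b]}<\xi_0^{[a,b]}<\xi\le\xi_1^{[a,b]}<\xi_2^{[a,b]}<\dots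 .$$ A limit statement for fixed $j$ includes the assertion that the labelled eigenvalues exist for all sufficiently large $l$. Scaling: let $\psi$ be a nontrivial solution of $-\psi''+V\psi=\xi\psi$ with $\psi'(0)/\psi(0)=\eta$, and let $W(\overline\psi,\psi)=\overline\psi\,\psi'-\overline{\psi'}\,\psi$, which is constant in $x$ and equals $2i\,|\psi(0)|^2\Im\eta$. For $a\le b$, $$c_{[a,b]}=\frac{i}{\pi W(\overline\psi,\psi)}\int_a^b|\psi(x)|^2\,dx ,$$ which is independent of the normalization of $\psi$. *)

theory Defs
  imports "HOL-Analysis.Analysis"
begin

text \<open>Functions on a closed interval \<open>S\<close>, either \<open>{a..b}\<close> or \<open>{0..}\<close>, are total functions on the reals
  of which only the values on \<open>S\<close> matter; derivatives are taken within \<open>S\<close>.\<close>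

definition abs_cont :: "real \<Rightarrow> real \<Rightarrow> (real \<Rightarrow> complex) \<Rightarrow> bool" where
  "abs_cont a b f \<longleftrightarrow>
     (\<forall>\<epsilon>>0. \<exists>\<delta>>0. \<forall>(n::nat) s t.
        (\<forall>i<n. a \<le> s i \<and> s i \<le> t i \<and> t i \<le> b) \<and>
        disjoint_family_on (\<lambda>i. {s i<..<t i}) {..<n} \<and>
        (\<Sum>i<n. t i - s i) < \<delta> \<longrightarrow>
        (\<Sum>i<n. cmod (f (t i) - f (s i))) < \<epsilon>)"

text \<open>For \<open>S = {a..b}\<close> local absolute continuity is absolute continuity on \<open>{a..b}\<close>.\<close>

definition abs_cont_loc :: "real set \<Rightarrow> (real \<Rightarrow> complex) \<Rightarrow> bool" where
  "abs_cont_loc S f \<longleftrightarrow> (\<forall>a b. {a..b} \<subseteq> S \<longrightarrow> abs_cont a b f)"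

definition square_integrable :: "real set \<Rightarrow> (real \<Rightarrow> complex) \<Rightarrow> bool" where
  "square_integrable S f \<longleftrightarrow>
     set_borel_measurable lebesgue S f \<and> set_integrable lebesgue S (\<lambda>x. (cmod (f x))\<^sup>2)"

definition square_integrable_near_infinity :: "(real \<Rightarrow> complex) \<Rightarrow> bool" where
  "square_integrable_near_infinity f \<longleftrightarrow> (\<exists>R\<ge>0. square_integrable {R..} f)"

text \<open>\<open>schroedinger_expr V S f g\<close>: \<open>f\<close> and \<open>f'\<close> are locally absolutely continuous on \<open>S\<close>, and
  \<open>g = - f'' + V f\<close> almost everywhere on \<open>S\<close>.\<close>

definition schroedinger_expr ::
  "(real \<Rightarrow> real) \<Rightarrow> real set \<Rightarrow> (real \<Rightarrow> complex) \<Rightarrow> (real \<Rightarrow> complex) \<Rightarrow> bool" where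
  "schroedinger_expr V S f g \<longleftrightarrow>
     (\<exists>f' f''.
        (\<forall>x\<in>S. (f has_vector_derivative f' x) (at x within S)) \<and>
        abs_cont_loc S f \<and> abs_cont_loc S f' \<and>
        (AE x in lebesgue. x \<in> S \<longrightarrow>
           (f' has_vector_derivative f'' x) (at x within S) \<and>
           g x = - f'' x + of_real (V x) * f x))"

definition schroedinger_solution ::
  "(real \<Rightarrow> real) \<Rightarrow> complex \<Rightarrow> (real \<Rightarrow> complex) \<Rightarrow> bool" where
  "schroedinger_solution V z u \<longleftrightarrow> schroedinger_expr V {0..} u (\<lambda>x. z * u x)"

definition nontrivial_on :: "real set \<Rightarrow> (real \<Rightarrow> complex) \<Rightarrow> bool" where
  "nontrivial_on S f \<longleftrightarrow> (\<exists>x\<in>S. f x \<noteq> 0)"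

text \<open>Limit circle at infinity: for one \<open>z\<close> (by Weyl's alternative, then for all \<open>z\<close>) every
  solution is square-integrable near infinity. Limit point is the opposite case.\<close>

definition limit_circle_at_infinity :: "(real \<Rightarrow> real) \<Rightarrow> bool" where
  "limit_circle_at_infinity V \<longleftrightarrow>
     (\<exists>z. \<forall>u. schroedinger_solution V z u \<longrightarrow> square_integrable_near_infinity u)"

definition limit_point_at_infinity :: "(real \<Rightarrow> real) \<Rightarrow> bool" where
  "limit_point_at_infinity V \<longleftrightarrow> \<not> limit_circle_at_infinity V"

text \<open>Operators are given by their graphs.\<close>

definition H_plus :: "(real \<Rightarrow> real) \<Rightarrow> ((real \<Rightarrow> complex) \<times> (real \<Rightarrow> complex)) set" where
  "H_plus V = {(\<psi>, \<phi>). square_integrable {0..} \<psi> \<and> schroedinger_expr V {0..} \<psi> \<phi> \<and>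
                 square_integrable {0..} \<phi> \<and> \<psi> 0 = 0}"

definition H_interval ::
  "(real \<Rightarrow> real) \<Rightarrow> real \<Rightarrow> real \<Rightarrow> ((real \<Rightarrow> complex) \<times> (real \<Rightarrow> complex)) set" where
  "H_interval V a b = {(\<psi>, \<phi>). square_integrable {a..b} \<psi> \<and> schroedinger_expr V {a..b} \<psi> \<phi> \<and>
                         square_integrable {a..b} \<phi> \<and> \<psi> a = 0 \<and> \<psi> b = 0}"

text \<open>The elements of the domain are continuous on \<open>{a..b}\<close>, so for \<open>a < b\<close> an eigenfunction is
  nonzero in \<open>L\<^sup>2\<close> iff it is nonzero at some point. The operator is self-adjoint, so real
  eigenvalues are all of them.\<close>

definition eigenvalues :: "(real \<Rightarrow> real) \<Rightarrow> real \<Rightarrow> real \<Rightarrow> real set" where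
  "eigenvalues V a b =
     {\<mu>. \<exists>\<psi>. nontrivial_on {a..b} \<psi> \<and> (\<psi>, \<lambda>x. of_real \<mu> * \<psi> x) \<in> H_interval V a b}"

text \<open>\<open>is_labelled_eigenvalue V \<xi> a b j \<mu>\<close>: \<open>\<mu>\<close> carries the label \<open>j\<close> when the eigenvalues in
  \<open>{\<xi>..}\<close> are numbered upwards by \<open>1, 2, \<dots>\<close> and those in \<open>{..<\<xi>}\<close> downwards by \<open>0, -1, \<dots>\<close>.\<close>

definition is_labelled_eigenvalue ::
  "(real \<Rightarrow> real) \<Rightarrow> real \<Rightarrow> real \<Rightarrow> real \<Rightarrow> int \<Rightarrow> real \<Rightarrow> bool" where
  "is_labelled_eigenvalue V \<xi> a b j \<mu> \<longleftrightarrow>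
     \<mu> \<in> eigenvalues V a b \<and>
     (if j \<ge> 1
      then \<xi> \<le> \<mu> \<and> finite (eigenvalues V a b \<inter> {\<xi>..<\<mu>}) \<and>
           int (card (eigenvalues V a b \<inter> {\<xi>..<\<mu>})) = j - 1
      else \<mu> < \<xi> \<and> finite (eigenvalues V a b \<inter> {\<mu><..<\<xi>}) \<and>
           int (card (eigenvalues V a b \<inter> {\<mu><..<\<xi>})) = - j)"

definition labelled_eigenvalue ::
  "(real \<Rightarrow> real) \<Rightarrow> real \<Rightarrow> real \<Rightarrow> real \<Rightarrow> int \<Rightarrow> real" where
  "labelled_eigenvalue V \<xi> a b j = (THE \<mu>. is_labelled_eigenvalue V \<xi> a b j \<mu>)"

definition half_line_deriv :: "(real \<Rightarrow> complex) \<Rightarrow> real \<Rightarrow> complex" where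
  "half_line_deriv f x = vector_derivative f (at x within {0..})"

text \<open>The Weyl function of \<open>H_plus V\<close>, meaningful for \<open>Im z > 0\<close> in the limit point case, where
  \<open>u\<close> below exists, is unique up to a constant factor and satisfies \<open>u 0 \<noteq> 0\<close>.\<close>

definition weyl_m :: "(real \<Rightarrow> real) \<Rightarrow> complex \<Rightarrow> complex" where
  "weyl_m V z =
     (THE m. \<exists>u. schroedinger_solution V z u \<and> nontrivial_on {0..} u \<and>
                 square_integrable_near_infinity u \<and> m = half_line_deriv u 0 / u 0)"

definition wronskian :: "(real \<Rightarrow> complex) \<Rightarrow> (real \<Rightarrow> complex) \<Rightarrow> real \<Rightarrow> complex" where
  "wronskian f g x = f x * half_line_deriv g x - half_line_deriv f x * g x"

text \<open>The Wronskian below is constant in \<open>x\<close>, so it is evaluated at \<open>0\<close>. It equals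
  \<open>2 \<i> \<bar>\<psi> 0\<bar>\<^sup>2 Im (\<psi>' 0 / \<psi> 0)\<close>, so the number whose real part is taken is real.\<close>

definition c_weight :: "(real \<Rightarrow> complex) \<Rightarrow> real \<Rightarrow> real \<Rightarrow> real" where
  "c_weight \<psi> a b =
     Re (\<i> / (of_real pi * wronskian (\<lambda>x. cnj (\<psi> x)) \<psi> 0)
           * of_real (integral {a..b} (\<lambda>x. (cmod (\<psi> x))\<^sup>2)))"

end

theory Submission
  imports Defs "HOL-Complex_Analysis.Complex_Analysis"
begin

text \<open>Write \<open>W\<close> for the (constant) Wronskian of \<open>cnj \<psi>\<close> and \<open>\<psi>\<close>. Since \<open>Im \<eta> > 0\<close>, \<open>W\<close> does not
vanish, so \<open>\<psi>\<close> and \<open>cnj \<psi>\<close> are a fundamental system at energy \<open>\<xi>\<close>. Variation of constants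
writes a solution at energy \<open>\<xi> + w\<close> as \<open>al \<psi> + be (cnj \<psi>)\<close>, where \<open>(al, be)\<close> solves a first-order
linear system whose coefficients are \<open>w\<close> times continuous functions of size \<open>k |\<psi>|\<^sup>2\<close> (\<open>modes\<close>,
\<open>solution_has_modes\<close>). Its solution \<open>(E, F)\<close> starting from \<open>(1, 0)\<close> is therefore entire in \<open>w\<close>, with
\<open>|E|, |F| \<le> exp (2 phase(x) |w|)\<close> where \<open>phase x = \<pi> c\<^bsub>[0,x]\<^esub>\<close>. With \<open>f#(w) = cnj (f (cnj w))\<close>, the matrix of
the system is \<open>((E, F#), (F, E#))\<close>; its determinant is \<open>1\<close>, and \<open>|al|\<^sup>2 - |be|\<^sup>2\<close> decreases in \<open>x\<close> when
\<open>Im w > 0\<close> and increases when \<open>Im w < 0\<close>.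

The coordinate \<open>s = be(0) / al(0)\<close> of the Weyl solution is a Cayley transform of the Weyl function that
sends \<open>\<eta>\<close> to \<open>0\<close>; it is a holomorphic function \<open>S\<close> on the upper half-plane with values in the closed
unit disc (\<open>weyl_disc_section\<close>), and the hypothesis on the normal limit says that \<open>S(iy) \<rightarrow> 0\<close> as \<open>y \<down> 0\<close>
(\<open>weyl_section_tendsto_0\<close>).

The heart is a rigidity argument (\<open>F_uniformly_small\<close>). Scale the energy by \<open>w = \<zeta> / phase b\<close> with
\<open>b \<rightarrow> \<infinity>\<close>, and take any \<open>x \<le> b\<close>. The scaled functions \<open>E\<close>, \<open>F\<close> are locally bounded in \<open>\<zeta>\<close>, so they converge
along a subsequence to entire functions, while the scaled \<open>S\<close> tends to \<open>0\<close> on the upper half-plane. In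
the limit \<open>|F| \<le> |E|\<close> on the lower half-plane by monotonicity of \<open>|E|\<^sup>2 - |F|\<^sup>2\<close>, and on the upper
half-plane because the Weyl solution satisfies \<open>|be| \<le> |al|\<close> and \<open>S\<close> has disappeared. As the determinant
stays \<open>1\<close>, \<open>E\<close> has no zeros, \<open>F / E\<close> is a bounded entire function, and Liouville's theorem gives
\<open>F / E = F(0) / E(0) = 0\<close>. So \<open>F\<close> vanishes in the limit, the system decouples, and \<open>E\<close> is asymptotically
\<open>exp (i w phase(x))\<close>: the solution with the initial data of \<open>\<psi>\<close> is \<open>\<psi>(x) exp (i w phase(x))\<close> up to
a factor that tends to \<open>1\<close>, uniformly for \<open>x \<le> b\<close> and bounded \<open>\<zeta>\<close> (\<open>ratio_uniform_limit\<close>).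

For real \<open>w\<close> that solution \<open>u\<close> and its conjugate are again a fundamental system, so \<open>\<xi> + w\<close> is a Dirichlet
eigenvalue of \<open>[a, b]\<close> iff \<open>u(b) / u(a)\<close> is real (\<open>eigenvalue_iff_real_quotient\<close>). Its argument is a phase
that is nearly affine in \<open>\<zeta>\<close> with slope \<open>\<sigma> = (phase b - phase a) / phase b\<close>, in the sense of \<open>C\<^sup>1\<close> by
Cauchy's estimate; the assumption on the limes superior keeps \<open>\<sigma>\<close> away from \<open>0\<close>, so the phase is strictly
increasing. The labelled eigenvalues sit where the phase passes consecutive multiples of \<open>\<pi>\<close>, whence
the spacing \<open>\<pi> / \<sigma>\<close> in \<open>\<zeta>\<close>, that is, \<open>1 / c\<^bsub>[a,b]\<^esub>\<close> in energy (\<open>labelled_eigenvalues_spacing\<close>).\<close>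

section \<open>Absolute continuity\<close>

text \<open>Absolute continuity is phrased with enumerated disjoint open intervals, gauge integration with finite
sets of non-overlapping tagged intervals. This is the translation.\<close>

lemma abs_cont_small_variation_on_tags:
  assumes ac: "abs_cont a b f" and "e > 0"
  obtains d where "d > 0"
    "\<And>q. q tagged_partial_division_of {a..b} \<Longrightarrow> (\<Sum>(x,K)\<in>q. Sup K - Inf K) < d \<Longrightarrow>
          (\<Sum>(x,K)\<in>q. cmod (f (Sup K) - f (Inf K))) < e"
proof -
  obtain d where d: "d > 0" and small: "\<And>(n::nat) s t.
        \<lbrakk>\<And>i. i < n \<Longrightarrow> a \<le> s i \<and> s i \<le> t i \<and> t i \<le> b;
        disjoint_family_on (\<lambda>i. {s i<..<t i}) {..<n};
        (\<Sum>i<n. t i - s i) < d\<rbrakk> \<Longrightarrow>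
        (\<Sum>i<n. cmod (f (t i) - f (s i))) < e"
    using ac \<open>e > 0\<close> unfolding abs_cont_def by meson
  have "(\<Sum>(x,K)\<in>q. cmod (f (Sup K) - f (Inf K))) < e"
    if q: "q tagged_partial_division_of {a..b}" and len: "(\<Sum>(x,K)\<in>q. Sup K - Inf K) < d" for q
  proof -
    have fin: "finite q" using q by (rule tagged_partial_division_ofD)
    obtain h where h: "bij_betw h {0..<card q} q"
      using ex_bij_betw_nat_finite[OF fin] by blast
    have h': "bij_betw h {..<card q} q" using h by (simp add: atLeast0LessThan)
    define K where "K i = snd (h i)" for i
    have Kq: "(fst (h i), K i) \<in> q" if "i < card q" for i
      using h' that by (auto simp: bij_betw_def K_def)
    have Kint: "\<exists>u v. K i = {u..v} \<and> u \<le> v \<and> a \<le> u \<and> v \<le> b" if i: "i < card q" for i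
    proof -
      have "fst (h i) \<in> K i" "K i \<subseteq> {a..b}" "\<exists>u v. K i = cbox u v"
        using tagged_partial_division_ofD(2-4)[OF q Kq[OF i]] by auto
      then show ?thesis by (auto 4 4)
    qed
    have sum_eq: "(\<Sum>i<card q. g (K i)) = (\<Sum>(x,K)\<in>q. g K)" for g :: "real set \<Rightarrow> real"
      using sum.reindex_bij_betw[OF h', of "\<lambda>y. g (snd y)"] by (simp add: K_def split_def)
    have dis: "disjoint_family_on (\<lambda>i. {Inf (K i)<..<Sup (K i)}) {..<card q}"
      unfolding disjoint_family_on_def
    proof (intro ballI impI)
      fix i j assume ij: "i \<in> {..<card q}" "j \<in> {..<card q}" "i \<noteq> j"
      then have "h i \<noteq> h j" using h' by (auto simp: bij_betw_def inj_on_def)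
      then have "(fst (h i), K i) \<noteq> (fst (h j), K j)"
        by (simp add: K_def)
      then have "interior (K i) \<inter> interior (K j) = {}"
        using tagged_partial_division_ofD(5)[OF q Kq Kq] ij by blast
      moreover obtain u v u' v' where "K i = {u..v}" "u \<le> v" "K j = {u'..v'}" "u' \<le> v'"
        using Kint ij by (metis lessThan_iff)
      ultimately show "{Inf (K i)<..<Sup (K i)} \<inter> {Inf (K j)<..<Sup (K j)} = {}"
        by simp
    qed
    have "(\<Sum>i<card q. cmod (f (Sup (K i)) - f (Inf (K i)))) < e"
    proof (rule small[OF _ dis])
      show "a \<le> Inf (K i) \<and> Inf (K i) \<le> Sup (K i) \<and> Sup (K i) \<le> b" if "i < card q" for i
        using Kint[OF that] by auto
      show "(\<Sum>i<card q. Sup (K i) - Inf (K i)) < d"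
        using len sum_eq[of "\<lambda>K. Sup K - Inf K"] by simp
    qed
    then show ?thesis using sum_eq[of "\<lambda>K. cmod (f (Sup K) - f (Inf K))"] by simp
  qed
  with d show thesis using that by blast
qed

lemma tagged_partial_division_length_le_measure:
  assumes q: "q tagged_partial_division_of {a..b::real}" and G: "G \<in> lmeasurable"
    and sub: "\<And>x K. (x,K) \<in> q \<Longrightarrow> K \<subseteq> G"
  shows "(\<Sum>(x,K)\<in>q. Sup K - Inf K) \<le> measure lebesgue G"
proof -
  have fin: "finite q" using q by (rule tagged_partial_division_ofD)
  have Kint: "\<exists>u v. K = {u..v} \<and> u \<le> v" if "(x,K) \<in> q" for x K
    using tagged_partial_division_ofD(2-4)[OF q that] by (auto 4 4)
  have "(\<Sum>(x,K)\<in>q. Sup K - Inf K) = (\<Sum>y\<in>q. measure lebesgue (interior (snd y)))"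
  proof (rule sum.cong[OF refl])
    fix y assume "y \<in> q"
    then obtain u v where "snd y = {u..v}" "u \<le> v" using Kint[of "fst y" "snd y"] by auto
    then show "(case y of (x,K) \<Rightarrow> Sup K - Inf K) = measure lebesgue (interior (snd y))"
      by (simp add: split_def)
  qed
  also have "\<dots> = measure lebesgue (\<Union>y\<in>q. interior (snd y))"
  proof (rule measure_UNION'[symmetric, OF fin])
    fix y assume "y \<in> q"
    then obtain u v where "snd y = {u..v}" "u \<le> v" using Kint[of "fst y" "snd y"] by auto
    then show "interior (snd y) \<in> lmeasurable" by simp
  next
    show "pairwise (\<lambda>x y. disjnt (interior (snd x)) (interior (snd y))) q"
      using tagged_partial_division_ofD(5)[OF q] by (fastforce simp: pairwise_def disjnt_def)
  qed
  also have "\<dots> \<le> measure lebesgue G"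
  proof (rule measure_mono_fmeasurable[OF _ _ G])
    show "(\<Union>y\<in>q. interior (snd y)) \<subseteq> G"
      using sub interior_subset by fastforce
    show "(\<Union>y\<in>q. interior (snd y)) \<in> sets lebesgue"
      by (intro sets.finite_UN fin) (simp add: borel_open)
  qed
  finally show ?thesis .
qed

text \<open>The fundamental theorem of calculus for absolutely continuous functions, directly for the gauge
integral: off the null set \<open>N\<close> the gauge comes from differentiability; on \<open>N\<close> it is a single open set
of small measure containing \<open>N\<close>, so that the intervals tagged in \<open>N\<close> have small total length and, by
absolute continuity, contribute a small variation.\<close>

theorem abs_cont_has_integral:
  assumes "a \<le> b" and ac: "abs_cont a b f" and N: "negligible N"
    and der: "\<And>x. x \<in> {a..b} - N \<Longrightarrow> (f has_vector_derivative g x) (at x within {a..b})"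
  shows "(g has_integral (f b - f a)) {a..b}"
proof -
  define g0 where "g0 x = (if x \<in> N then 0 else g x)" for x
  have "(g0 has_integral (f b - f a)) {a..b}"
    unfolding box_real[symmetric] has_integral
  proof (intro allI impI)
    fix e :: real assume e: "e > 0"
    \<comment> \<open>The summand 1 makes the estimate strict and covers \<open>a = b\<close>.\<close>
    define e1 where "e1 = e / (2 * (b - a + 1))"
    have e1: "e1 > 0" "e1 * (b - a) < e / 2"
      using e \<open>a \<le> b\<close> by (auto simp: e1_def field_simps)
    obtain \<delta> where \<delta>: "\<delta> > 0" and var: 
      "\<And>q. q tagged_partial_division_of {a..b} \<Longrightarrow> (\<Sum>(x,K)\<in>q. Sup K - Inf K) < \<delta> \<Longrightarrow>
          (\<Sum>(x,K)\<in>q. cmod (f (Sup K) - f (Inf K))) < e / 2"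
      using abs_cont_small_variation_on_tags[OF ac, of "e/2"] e by auto
    have Nleb: "N \<in> sets lebesgue" "emeasure lebesgue N = 0"
      using N by (auto simp: negligible_iff_null_sets)
    obtain G where G: "open G" "N \<subseteq> G" "G - N \<in> lmeasurable" "emeasure lebesgue (G - N) < ennreal \<delta>"
      using sets_lebesgue_outer_open[OF Nleb(1) \<delta>] by blast
    have GN: "G = (G - N) \<union> N" using G(2) by blast
    have Nm: "N \<in> lmeasurable" using N by (simp add: negligible_imp_measurable)
    have Gm: "G \<in> lmeasurable" using fmeasurable.Un[OF G(3) Nm] GN by simp
    have Nnull: "N \<in> null_sets lebesgue" using N by (simp add: negligible_iff_null_sets)
    have eqG: "emeasure lebesgue G = emeasure lebesgue (G - N)"
      using emeasure_Un_null_set[OF _ Nnull, of "G - N"] G(3) GN by (metis fmeasurableD)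
    have Gmeas: "measure lebesgue G < \<delta>"
      using G(4) eqG emeasure_eq_measure2[OF Gm] by (metis ennreal_less_iff measure_nonneg)
    have "\<exists>d>0. x \<in> {a..b} - N \<longrightarrow>
         (\<forall>y\<in>{a..b}. norm (y-x) < d \<longrightarrow> norm (f y - f x - (y-x) *\<^sub>R g x) \<le> e1 * norm (y-x))" for x
    proof (cases "x \<in> {a..b} - N")
      case True
      then show ?thesis
        using der[OF True, unfolded has_vector_derivative_def has_derivative_within_alt] e1(1) by blast
    qed (auto intro: exI[of _ 1])
    then obtain d where d: "\<And>x. 0 < d x"
         "\<And>x y. \<lbrakk>x \<in> {a..b}; x \<notin> N; y \<in> {a..b}; norm (y-x) < d x\<rbrakk>
                        \<Longrightarrow> norm (f y - f x - (y-x) *\<^sub>R g x) \<le> e1 * norm (y-x)"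
      by (metis DiffI)
    \<comment> \<open>The differentiability gauge off \<open>N\<close>, the open set of small measure on \<open>N\<close>.\<close>
    define \<gamma> where "\<gamma> x = (if x \<in> N then G else ball x (d x))" for x
    have gauge: "gauge \<gamma>"
      using G(1,2) d(1) by (auto simp: gauge_def \<gamma>_def)
    have close: "norm ((\<Sum>(x,K)\<in>p. measure lborel K *\<^sub>R g0 x) - (f b - f a)) < e"
      if ptag: "p tagged_division_of cbox a b" and fine: "\<gamma> fine p" for p
    proof -
      have fin: "finite p" using ptag by blast
      have Kint: "\<exists>u v. K = {u..v} \<and> u \<le> v \<and> a \<le> u \<and> v \<le> b \<and> u \<le> x \<and> x \<le> v" if "(x,K) \<in> p" for x K
      proof -
        have "x \<in> K" "K \<subseteq> {a..b}" "\<exists>u v. K = cbox u v"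
          using tagged_division_ofD(2-4)[OF ptag that] by auto
        then show ?thesis by (auto 4 4)
      qed
      define q where "q = {y \<in> p. fst y \<in> N}"
      have qp: "q \<subseteq> p" by (auto simp: q_def)
      have ppart: "p tagged_partial_division_of {a..b}"
        using ptag by (simp add: tagged_division_of_def)
      have qpart: "q tagged_partial_division_of {a..b}"
        by (rule tagged_partial_division_subset[OF ppart qp])
      have "(\<Sum>(x,K)\<in>q. Sup K - Inf K) \<le> measure lebesgue G"
      proof (rule tagged_partial_division_length_le_measure[OF qpart Gm])
        show "K \<subseteq> G" if "(x,K) \<in> q" for x K
          using fineD[OF fine, of x K] that by (simp add: q_def \<gamma>_def)
      qed
      then have small: "(\<Sum>(x,K)\<in>q. cmod (f (Sup K) - f (Inf K))) < e / 2"
        using var[OF qpart] Gmeas by simp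
      have tel: "f b - f a = (\<Sum>(x,K)\<in>p. f (Sup K) - f (Inf K))" "b - a = (\<Sum>(x,K)\<in>p. Sup K - Inf K)"
        using additive_tagged_division_1[OF \<open>a \<le> b\<close>, of p f]
          additive_tagged_division_1[OF \<open>a \<le> b\<close>, of p "\<lambda>x. x"] ptag by auto
      define D where "D y = (case y of (x,K) \<Rightarrow> measure lborel K *\<^sub>R g0 x - (f (Sup K) - f (Inf K)))" for y :: "real \<times> real set"
      have "(\<Sum>(x,K)\<in>p. measure lborel K *\<^sub>R g0 x) - (f b - f a) = sum D p"
        unfolding tel(1) sum_subtractf[symmetric] by (rule sum.cong) (auto simp: D_def)
      also have "\<dots> = sum D (p - q) + sum D q"
        using sum.subset_diff[OF qp fin] .
      finally have "norm ((\<Sum>(x,K)\<in>p. measure lborel K *\<^sub>R g0 x) - (f b - f a)) \<le> norm (sum D (p - q)) + norm (sum D q)"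
        by (simp add: norm_triangle_ineq)
      moreover have "norm (sum D q) < e / 2"
      proof -
        have "norm (sum D q) \<le> (\<Sum>y\<in>q. norm (D y))" by (rule norm_sum)
        also have "\<dots> = (\<Sum>(x,K)\<in>q. cmod (f (Sup K) - f (Inf K)))"
          by (rule sum.cong) (auto simp: D_def q_def g0_def norm_minus_commute)
        finally show ?thesis using small by simp
      qed
      moreover have "norm (sum D (p - q)) \<le> e1 * (b - a)"
      proof -
        have "norm (sum D (p - q)) \<le> (\<Sum>(x,K)\<in>p-q. e1 * (Sup K - Inf K))"
        proof (rule sum_norm_le)
          fix y assume y: "y \<in> p - q"
          obtain x K where yxK: "y = (x,K)" by (cases y)
          have xK: "(x,K) \<in> p" "(x,K) \<notin> q" using y yxK by auto
          then have xN: "x \<notin> N" by (simp add: q_def)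
          obtain u v where K: "K = {u..v}" "u \<le> v" "a \<le> u" "v \<le> b" "u \<le> x" "x \<le> v"
            using Kint[OF xK(1)] by blast
          have "K \<subseteq> ball x (d x)" using fineD[OF fine xK(1)] xN by (simp add: \<gamma>_def)
          moreover have "u \<in> K" "v \<in> K" using K by auto
          ultimately have uv: "norm (u - x) < d x" "norm (v - x) < d x"
            by (auto simp: dist_real_def)
          have "norm ((v - u) *\<^sub>R g x - (f v - f u))
             = norm (f u - f x - (u - x) *\<^sub>R g x - (f v - f x - (v - x) *\<^sub>R g x))"
            by (auto simp: algebra_simps)
          also have "\<dots> \<le> norm (f u - f x - (u - x) *\<^sub>R g x) + norm (f v - f x - (v - x) *\<^sub>R g x)"
            by (rule norm_triangle_ineq4)
          also have "\<dots> \<le> e1 * norm (u - x) + e1 * norm (v - x)"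
            using K xN uv by (intro add_mono d) auto
          also have "\<dots> = e1 * (v - u)" using K by (simp add: algebra_simps)
          finally show "norm (D y) \<le> (case y of (x,K) \<Rightarrow> e1 * (Sup K - Inf K))"
            using K xN by (simp add: D_def g0_def yxK)
        qed
        also have "\<dots> \<le> (\<Sum>(x,K)\<in>p. e1 * (Sup K - Inf K))"
        proof (rule sum_mono2[OF fin])
          fix y assume y: "y \<in> p - (p - q)"
          obtain x K where yxK: "y = (x,K)" by (cases y)
          obtain u v where "K = {u..v}" "u \<le> v" using Kint[of x K] y yxK by auto
          then show "0 \<le> (case y of (x,K) \<Rightarrow> e1 * (Sup K - Inf K))"
            using e1(1) by (simp add: yxK)
        qed blast
        also have "\<dots> = e1 * (b - a)"
          unfolding tel(2) by (simp only: sum_distrib_left split_def)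
        finally show ?thesis .
      qed
      ultimately show ?thesis using e1(2) by simp
    qed
    show "\<exists>\<gamma>. gauge \<gamma> \<and> (\<forall>\<D>. \<D> tagged_division_of cbox a b \<and> \<gamma> fine \<D> \<longrightarrow>
                  norm ((\<Sum>(x,K)\<in>\<D>. measure lborel K *\<^sub>R g0 x) - (f b - f a)) < e)"
      by (intro exI[of _ \<gamma>] conjI allI impI gauge) (elim conjE, rule close)
  qed
  then show ?thesis
    by (rule has_integral_spike[OF N, rotated]) (auto simp: g0_def)
qed

lemma abs_cont_lipschitz:
  assumes "L \<ge> 0" and lip: "\<And>x y. x \<in> {a..b} \<Longrightarrow> y \<in> {a..b} \<Longrightarrow> cmod (f y - f x) \<le> L * \<bar>y - x\<bar>"
  shows "abs_cont a b f"
  unfolding abs_cont_def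
proof (intro allI impI)
  fix e :: real assume e: "e > 0"
  show "\<exists>\<delta>>0. \<forall>(n::nat) s t.
        (\<forall>i<n. a \<le> s i \<and> s i \<le> t i \<and> t i \<le> b) \<and>
        disjoint_family_on (\<lambda>i. {s i<..<t i}) {..<n} \<and> (\<Sum>i<n. t i - s i) < \<delta> \<longrightarrow>
        (\<Sum>i<n. cmod (f (t i) - f (s i))) < e"
  proof (intro exI[of _ "e / (L + 1)"] conjI allI impI)
    show "e / (L + 1) > 0" using e \<open>L \<ge> 0\<close> by simp
    fix n :: nat and s t :: "nat \<Rightarrow> real"
    assume A: "(\<forall>i<n. a \<le> s i \<and> s i \<le> t i \<and> t i \<le> b) \<and>
        disjoint_family_on (\<lambda>i. {s i<..<t i}) {..<n} \<and> (\<Sum>i<n. t i - s i) < e / (L + 1)"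
    have "(\<Sum>i<n. cmod (f (t i) - f (s i))) \<le> (\<Sum>i<n. (L+1) * (t i - s i))"
    proof (rule sum_mono)
      fix i assume "i \<in> {..<n}"
      then have i: "a \<le> s i" "s i \<le> t i" "t i \<le> b" using A by auto
      have "cmod (f (t i) - f (s i)) \<le> L * \<bar>t i - s i\<bar>" using i by (intro lip) auto
      also have "\<dots> \<le> (L+1) * (t i - s i)" using i \<open>L \<ge> 0\<close> by (intro mult_mono) auto
      finally show "cmod (f (t i) - f (s i)) \<le> (L+1) * (t i - s i)" .
    qed
    also have "\<dots> < e" using A \<open>L \<ge> 0\<close> e
      by (simp add: sum_distrib_left[symmetric] pos_less_divide_eq mult.commute)
    finally show "(\<Sum>i<n. cmod (f (t i) - f (s i))) < e" .
  qed
qed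

lemma abs_cont_C1:
  assumes der: "\<And>x. x \<in> {a..b} \<Longrightarrow> (f has_vector_derivative f' x) (at x within {a..b})"
    and cont: "continuous_on {a..b} f'"
  shows "abs_cont a b f"
proof -
  have "compact (f' ` {a..b})" by (intro compact_continuous_image cont) auto
  then obtain B where B: "\<And>x. x \<in> {a..b} \<Longrightarrow> norm (f' x) \<le> B" "B > 0"
    by (metis bounded_pos compact_imp_bounded imageI)
  show ?thesis
  proof (rule abs_cont_lipschitz)
    show "0 \<le> B" using B by simp
    fix x y assume "x \<in> {a..b}" "y \<in> {a..b}"
    then show "cmod (f y - f x) \<le> B * \<bar>y - x\<bar>"
      using differentiable_bound[of "{a..b}" f "\<lambda>x h. h *\<^sub>R f' x" B y x] der B
      by (auto simp: has_vector_derivative_def onorm_scaleR_left onorm_id)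
  qed
qed

lemma abs_cont_mono: "abs_cont a b f \<Longrightarrow> a \<le> c \<Longrightarrow> d \<le> b \<Longrightarrow> abs_cont c d f"
  unfolding abs_cont_def by (meson order_trans)

text \<open>The common estimate behind sums, differences and products.\<close>

lemma abs_cont_combination:
  assumes f: "abs_cont a b f" and g: "abs_cont a b g" and "C \<ge> 0"
    and le: "\<And>x y. x \<in> {a..b} \<Longrightarrow> y \<in> {a..b} \<Longrightarrow>
      cmod (h y - h x) \<le> C * (cmod (f y - f x) + cmod (g y - g x))"
  shows "abs_cont a b h"
  unfolding abs_cont_def
proof (intro allI impI)
  fix e :: real assume e: "e > 0"
  have e': "e / (2 * (C + 1)) > 0" using e \<open>C \<ge> 0\<close> by simp
  obtain d1 where d1: "d1 > 0" "\<And>(n::nat) s t.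
        (\<forall>i<n. a \<le> s i \<and> s i \<le> t i \<and> t i \<le> b) \<and>
        disjoint_family_on (\<lambda>i. {s i<..<t i}) {..<n} \<and>
        (\<Sum>i<n. t i - s i) < d1 \<longrightarrow> (\<Sum>i<n. cmod (f (t i) - f (s i))) < e / (2 * (C + 1))"
    using f e' unfolding abs_cont_def by meson
  obtain d2 where d2: "d2 > 0" "\<And>(n::nat) s t.
        (\<forall>i<n. a \<le> s i \<and> s i \<le> t i \<and> t i \<le> b) \<and>
        disjoint_family_on (\<lambda>i. {s i<..<t i}) {..<n} \<and>
        (\<Sum>i<n. t i - s i) < d2 \<longrightarrow> (\<Sum>i<n. cmod (g (t i) - g (s i))) < e / (2 * (C + 1))"
    using g e' unfolding abs_cont_def by meson
  show "\<exists>\<delta>>0. \<forall>(n::nat) s t.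
        (\<forall>i<n. a \<le> s i \<and> s i \<le> t i \<and> t i \<le> b) \<and>
        disjoint_family_on (\<lambda>i. {s i<..<t i}) {..<n} \<and> (\<Sum>i<n. t i - s i) < \<delta> \<longrightarrow>
        (\<Sum>i<n. cmod (h (t i) - h (s i))) < e"
  proof (intro exI[of _ "min d1 d2"] conjI allI impI)
    fix n :: nat and s t :: "nat \<Rightarrow> real"
    assume A: "(\<forall>i<n. a \<le> s i \<and> s i \<le> t i \<and> t i \<le> b) \<and>
        disjoint_family_on (\<lambda>i. {s i<..<t i}) {..<n} \<and> (\<Sum>i<n. t i - s i) < min d1 d2"
    have "(\<Sum>i<n. cmod (h (t i) - h (s i)))
        \<le> (\<Sum>i<n. C * (cmod (f (t i) - f (s i)) + cmod (g (t i) - g (s i))))"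
      using A by (intro sum_mono le) (auto intro: order_trans)
    also have "\<dots> = C * ((\<Sum>i<n. cmod (f (t i) - f (s i))) + (\<Sum>i<n. cmod (g (t i) - g (s i))))"
      by (simp add: sum_distrib_left[symmetric] sum.distrib)
    also have "\<dots> \<le> C * (e / (2 * (C + 1)) + e / (2 * (C + 1)))"
    proof (intro mult_left_mono[OF _ \<open>C \<ge> 0\<close>] add_mono less_imp_le)
      show "(\<Sum>i<n. cmod (f (t i) - f (s i))) < e / (2 * (C + 1))" using d1(2)[of n s t] A by simp
      show "(\<Sum>i<n. cmod (g (t i) - g (s i))) < e / (2 * (C + 1))" using d2(2)[of n s t] A by simp
    qed
    also have "\<dots> = C * e / (C + 1)" using \<open>C \<ge> 0\<close> by (simp add: divide_simps)
    also have "\<dots> < e" using e \<open>C \<ge> 0\<close> by (simp add: field_simps)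
    finally show "(\<Sum>i<n. cmod (h (t i) - h (s i))) < e" .
  next
    show "0 < min d1 d2" using d1 d2 by simp
  qed
qed

lemma abs_cont_diff:
  assumes "abs_cont a b f" "abs_cont a b g" shows "abs_cont a b (\<lambda>x. f x - g x)"
proof (rule abs_cont_combination[OF assms, of 1])
  fix x y
  have "f y - g y - (f x - g x) = (f y - f x) - (g y - g x)" by simp
  then show "cmod (f y - g y - (f x - g x)) \<le> 1 * (cmod (f y - f x) + cmod (g y - g x))"
    by (metis mult_1 norm_triangle_ineq4)
qed simp

lemma abs_cont_add:
  assumes "abs_cont a b f" "abs_cont a b g" shows "abs_cont a b (\<lambda>x. f x + g x)"
proof (rule abs_cont_combination[OF assms, of 1])
  fix x y
  have "f y + g y - (f x + g x) = (f y - f x) + (g y - g x)" by simp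
  then show "cmod (f y + g y - (f x + g x)) \<le> 1 * (cmod (f y - f x) + cmod (g y - g x))"
    by (metis mult_1 norm_triangle_ineq)
qed simp

lemma abs_cont_cnj:
  assumes "abs_cont a b f" shows "abs_cont a b (\<lambda>x. cnj (f x))"
  using assms unfolding abs_cont_def complex_cnj_diff[symmetric] complex_mod_cnj .

lemma abs_cont_imp_continuous_on:
  assumes ac: "abs_cont a b f" shows "continuous_on {a..b} f"
  unfolding continuous_on_iff
proof (intro ballI allI impI)
  fix x e :: real assume x: "x \<in> {a..b}" and e: "e > 0"
  obtain d where d: "d > 0" "\<And>(n::nat) s t.
        (\<forall>i<n. a \<le> s i \<and> s i \<le> t i \<and> t i \<le> b) \<and>
        disjoint_family_on (\<lambda>i. {s i<..<t i}) {..<n} \<and>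
        (\<Sum>i<n. t i - s i) < d \<longrightarrow> (\<Sum>i<n. cmod (f (t i) - f (s i))) < e"
    using ac e unfolding abs_cont_def by meson
  show "\<exists>d>0. \<forall>x'\<in>{a..b}. dist x' x < d \<longrightarrow> dist (f x') (f x) < e"
  proof (intro exI[of _ d] conjI ballI impI)
    fix y assume y: "y \<in> {a..b}" "dist y x < d"
    show "dist (f y) (f x) < e"
      using d(2)[of 1 "\<lambda>_. min x y" "\<lambda>_. max x y"] x y
      by (cases "x \<le> y") (auto simp: disjoint_family_on_def dist_norm norm_minus_commute)
  qed (use d in auto)
qed

lemma abs_cont_mult:
  assumes f: "abs_cont a b f" and g: "abs_cont a b g" shows "abs_cont a b (\<lambda>x. f x * g x)"
proof -
  have "bounded (f ` {a..b})" "bounded (g ` {a..b})"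
    using assms by (auto intro!: compact_imp_bounded compact_continuous_image abs_cont_imp_continuous_on)
  then obtain A B where A: "A > 0" "\<And>x. x \<in> {a..b} \<Longrightarrow> norm (f x) \<le> A" 
    and B: "B > 0" "\<And>x. x \<in> {a..b} \<Longrightarrow> norm (g x) \<le> B"
    by (auto simp: bounded_pos)
  show ?thesis
  proof (rule abs_cont_combination[OF f g, of "A + B"])
    fix x y assume x: "x \<in> {a..b}" and y: "y \<in> {a..b}"
    have "cmod (f y * g y - f x * g x) = cmod ((f y - f x) * g y + f x * (g y - g x))"
      by (simp add: algebra_simps)
    also have "\<dots> \<le> cmod (f y - f x) * cmod (g y) + cmod (f x) * cmod (g y - g x)"
      by (metis norm_mult norm_triangle_ineq)
    also have "\<dots> \<le> cmod (f y - f x) * (A + B) + (A + B) * cmod (g y - g x)"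
    proof (intro add_mono mult_left_mono mult_right_mono)
      show "cmod (g y) \<le> A + B" using A(1) B(2)[OF y] by linarith
      show "cmod (f x) \<le> A + B" using A(2)[OF x] B(1) by linarith
    qed auto
    also have "\<dots> = (A + B) * (cmod (f y - f x) + cmod (g y - g x))"
      by (simp only: distrib_left mult.commute)
    finally show "cmod (f y * g y - f x * g x) \<le> (A + B) * (cmod (f y - f x) + cmod (g y - g x))" .
  qed (use A B in simp)
qed

lemma has_vector_derivative_from_has_integral:
  fixes f g :: "real \<Rightarrow> complex"
  assumes cont: "continuous_on {p..q} g"
    and int: "\<And>s. s \<in> {p..q} \<Longrightarrow> (g has_integral (f s - f p)) {p..s}"
    and x: "x \<in> {p..q}"
  shows "(f has_vector_derivative g x) (at x within {p..q})"
proof -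
  have "((\<lambda>s. integral {p..s} g) has_vector_derivative g x) (at x within {p..q})"
    by (rule integral_has_vector_derivative[OF cont x])
  then have "((\<lambda>s. integral {p..s} g + f p) has_vector_derivative g x) (at x within {p..q})"
    by (simp only: has_vector_derivative_add_const)
  then show ?thesis
    by (rule has_vector_derivative_transform[OF x, rotated]) (use integral_unique[OF int] in simp)
qed


section \<open>Variation of constants around a complex solution at a real energy\<close>

lemma schroedinger_expr_subset:
  assumes "schroedinger_expr V S f g" "T \<subseteq> S"
  shows "schroedinger_expr V T f g"
proof -
  obtain f' f'' where f: "\<forall>x\<in>S. (f has_vector_derivative f' x) (at x within S)"
    "abs_cont_loc S f" "abs_cont_loc S f'"
    "AE x in lebesgue. x \<in> S \<longrightarrow> (f' has_vector_derivative f'' x) (at x within S) \<and>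
           g x = - f'' x + of_real (V x) * f x"
    using assms(1) unfolding schroedinger_expr_def by blast
  have "AE x in lebesgue. x \<in> T \<longrightarrow> (f' has_vector_derivative f'' x) (at x within T) \<and>
           g x = - f'' x + of_real (V x) * f x"
    using f(4) by eventually_elim (use \<open>T \<subseteq> S\<close> has_vector_derivative_within_subset in blast)
  moreover have "\<forall>x\<in>T. (f has_vector_derivative f' x) (at x within T)"
    using f(1) \<open>T \<subseteq> S\<close> has_vector_derivative_within_subset by blast
  moreover have "abs_cont_loc T f" "abs_cont_loc T f'"
    using f(2,3) \<open>T \<subseteq> S\<close> unfolding abs_cont_loc_def by blast+
  ultimately show ?thesis unfolding schroedinger_expr_def by blast
qed

text \<open>The Wronskian of two solutions is absolutely continuous, and its derivative agrees almost everywhere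
with a continuous function; hence it is differentiable everywhere. Variation of constants therefore leads
to a system that holds at every point, although the equation itself holds only almost everywhere.\<close>

lemma Lagrange_identity:
  fixes u y :: "real \<Rightarrow> complex" and V :: "real \<Rightarrow> real"
  assumes u: "\<And>x. x \<in> {p..q} \<Longrightarrow> (u has_vector_derivative du x) (at x within {p..q})"
    "abs_cont p q u" "abs_cont p q du"
    "AE x in lebesgue. x \<in> {p..q} \<longrightarrow> (du has_vector_derivative ddu x) (at x within {p..q}) \<and>
        z * u x = - ddu x + of_real (V x) * u x"
  assumes y: "\<And>x. x \<in> {p..q} \<Longrightarrow> (y has_vector_derivative dy x) (at x within {p..q})"
    "abs_cont p q y" "abs_cont p q dy"
    "AE x in lebesgue. x \<in> {p..q} \<longrightarrow> (dy has_vector_derivative ddy x) (at x within {p..q}) \<and>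
        z' * y x = - ddy x + of_real (V x) * y x"
  assumes x: "x \<in> {p..q}"
  shows "((\<lambda>x. u x * dy x - du x * y x) has_vector_derivative (z - z') * (u x * y x))
           (at x within {p..q})"
proof -
  define W where "W x = u x * dy x - du x * y x" for x
  have acW: "abs_cont p q W"
    unfolding W_def by (intro abs_cont_diff abs_cont_mult u y)
  have "AE x in lebesgue. x \<in> {p..q} \<longrightarrow> (W has_vector_derivative (z - z') * (u x * y x)) (at x within {p..q})"
    using u(4) y(4)
  proof eventually_elim
    case (elim x)
    show ?case
    proof
      assume x: "x \<in> {p..q}"
      have eq: "ddu x = (of_real (V x) - z) * u x" "ddy x = (of_real (V x) - z') * y x"
        using elim x by (simp_all add: algebra_simps)
      have "(W has_vector_derivative (u x * ddy x + du x * dy x) - (du x * dy x + ddu x * y x)) (at x within {p..q})"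
        unfolding W_def using elim x
        by (intro has_vector_derivative_diff has_vector_derivative_mult u(1)[OF x] y(1)[OF x]) auto
      then show "(W has_vector_derivative (z - z') * (u x * y x)) (at x within {p..q})"
        by (simp add: eq algebra_simps)
    qed
  qed
  then obtain N where N: "N \<in> null_sets lebesgue"
    "{x. \<not> (x \<in> {p..q} \<longrightarrow> (W has_vector_derivative (z - z') * (u x * y x)) (at x within {p..q}))} \<subseteq> N"
    unfolding eventually_ae_filter by auto
  have cont: "continuous_on {p..q} (\<lambda>x. (z - z') * (u x * y x))"
    by (intro continuous_intros abs_cont_imp_continuous_on u y)
  have "((\<lambda>x. (z - z') * (u x * y x)) has_integral (W s - W p)) {p..s}" if s: "s \<in> {p..q}" for s
  proof (rule abs_cont_has_integral)
    show "negligible N" using N by (simp add: negligible_iff_null_sets)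
    show "abs_cont p s W" using abs_cont_mono[OF acW] s by auto
    fix x assume "x \<in> {p..s} - N"
    then have "(W has_vector_derivative (z - z') * (u x * y x)) (at x within {p..q})"
      using N s by auto
    then show "(W has_vector_derivative (z - z') * (u x * y x)) (at x within {p..s})"
      by (rule has_vector_derivative_within_subset) (use s in auto)
  qed (use s in auto)
  from has_vector_derivative_from_has_integral[OF cont this x] show ?thesis
    by (simp add: W_def[abs_def])
qed

lemma has_vector_derivative_cnj:
  assumes "(f has_vector_derivative f') F"
  shows "((\<lambda>x. cnj (f x)) has_vector_derivative cnj f') F"
  using bounded_linear.has_vector_derivative[OF bounded_linear_cnj assms] .

lemma constant_on_interval_if_derivative_zero:
  fixes f :: "real \<Rightarrow> complex"
  assumes "\<And>x. x \<in> {p..q} \<Longrightarrow> (f has_vector_derivative 0) (at x within {p..q})" "x \<in> {p..q}"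
  shows "f x = f p"
proof -
  obtain c where "\<And>x. x \<in> {p..q} \<Longrightarrow> f x = c"
    using has_vector_derivative_zero_constant[of "{p..q}" f] assms(1) by auto
  then show ?thesis using assms(2) by auto
qed

text \<open>A solution \<open>\<psi>\<close> at the real energy \<open>\<xi>\<close> for which \<open>\<psi>'(0) / \<psi>(0)\<close> lies in the upper half-plane, with
its first and second derivatives.\<close>

locale complex_frame =
  fixes V :: "real \<Rightarrow> real" and \<xi> :: real and \<psi> d\<psi> dd\<psi> :: "real \<Rightarrow> complex"
  assumes psi_deriv: "\<And>x. x \<ge> 0 \<Longrightarrow> (\<psi> has_vector_derivative d\<psi> x) (at x within {0..})"
    and psi_ac: "abs_cont_loc {0..} \<psi>" and dpsi_ac: "abs_cont_loc {0..} d\<psi>"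
    and psi_eqn: "AE x in lebesgue. x \<in> {0..} \<longrightarrow>
           (d\<psi> has_vector_derivative dd\<psi> x) (at x within {0..}) \<and>
           of_real \<xi> * \<psi> x = - dd\<psi> x + of_real (V x) * \<psi> x"
    and wronskian_pos: "Im (cnj (\<psi> 0) * d\<psi> 0) > 0"
begin

text \<open>The Wronskian of \<open>cnj \<psi>\<close> and \<open>\<psi>\<close> is \<open>2 \<i> \<kappa>\<close>.\<close>

definition \<kappa> :: real where "\<kappa> = Im (cnj (\<psi> 0) * d\<psi> 0)"

text \<open>The normalization for which \<open>k |\<psi>|\<^sup>2\<close> is the derivative of \<open>\<pi> c\<^bsub>[0,x]\<^esub>\<close>.\<close>

definition k :: real where "k = 1 / (2 * \<kappa>)"

lemma kappa_pos: "\<kappa> > 0" and k_pos: "k > 0"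
  using wronskian_pos by (auto simp: \<kappa>_def k_def)

definition mix :: "(real \<Rightarrow> complex) \<Rightarrow> (real \<Rightarrow> complex) \<Rightarrow> real \<Rightarrow> complex" where
  "mix al be x = al x * \<psi> x + be x * cnj (\<psi> x)"

text \<open>Variation of constants: \<open>mix al be\<close> solves the equation at energy \<open>\<xi> + w\<close>, and its derivative is
\<open>al \<psi>' + be (cnj \<psi>')\<close>, exactly when the coefficients satisfy this system.\<close>

definition modes :: "complex \<Rightarrow> real set \<Rightarrow> (real \<Rightarrow> complex) \<Rightarrow> (real \<Rightarrow> complex) \<Rightarrow> bool" where
  "modes w S al be \<longleftrightarrow> (\<forall>x\<in>S.
     (al has_vector_derivative \<i> * w * of_real k * (cnj (\<psi> x) * mix al be x)) (at x within S) \<and>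
     (be has_vector_derivative - (\<i> * w * of_real k * (\<psi> x * mix al be x))) (at x within S))"

lemma psi_within:
  assumes "p \<ge> 0" "x \<in> {p..q}"
  shows "(\<psi> has_vector_derivative d\<psi> x) (at x within {p..q})"
  by (rule has_vector_derivative_within_subset[OF psi_deriv]) (use assms in auto)

lemma psi_abs_cont: "p \<ge> 0 \<Longrightarrow> abs_cont p q \<psi>" and dpsi_abs_cont: "p \<ge> 0 \<Longrightarrow> abs_cont p q d\<psi>"
  using psi_ac dpsi_ac unfolding abs_cont_loc_def by (force simp: subset_eq)+

lemma psi_eqn_within:
  assumes "p \<ge> 0"
  shows "AE x in lebesgue. x \<in> {p..q} \<longrightarrow>
           (d\<psi> has_vector_derivative dd\<psi> x) (at x within {p..q}) \<and>
           of_real \<xi> * \<psi> x = - dd\<psi> x + of_real (V x) * \<psi> x"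
  using psi_eqn
proof eventually_elim
  case (elim x)
  then show ?case using assms
    by (auto intro: has_vector_derivative_within_subset[of _ _ _ "{0..}"])
qed

lemma psi_cnj_eqn_within:
  assumes "p \<ge> 0"
  shows "AE x in lebesgue. x \<in> {p..q} \<longrightarrow>
           ((\<lambda>x. cnj (d\<psi> x)) has_vector_derivative cnj (dd\<psi> x)) (at x within {p..q}) \<and>
           of_real \<xi> * cnj (\<psi> x) = - cnj (dd\<psi> x) + of_real (V x) * cnj (\<psi> x)"
  using psi_eqn_within[OF assms, of q]
proof eventually_elim
  case (elim x)
  show ?case
  proof
    assume "x \<in> {p..q}"
    with elim have 1: "(d\<psi> has_vector_derivative dd\<psi> x) (at x within {p..q})"
      and 2: "of_real \<xi> * \<psi> x = - dd\<psi> x + of_real (V x) * \<psi> x" by auto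
    have "cnj (of_real \<xi> * \<psi> x) = cnj (- dd\<psi> x + of_real (V x) * \<psi> x)" by (simp only: 2)
    with has_vector_derivative_cnj[OF 1] show "((\<lambda>x. cnj (d\<psi> x)) has_vector_derivative cnj (dd\<psi> x)) (at x within {p..q}) \<and>
           of_real \<xi> * cnj (\<psi> x) = - cnj (dd\<psi> x) + of_real (V x) * cnj (\<psi> x)"
      by simp
  qed
qed

lemma wronskian_eq:
  assumes "x \<ge> 0"
  shows "cnj (\<psi> x) * d\<psi> x - cnj (d\<psi> x) * \<psi> x = 2 * \<i> * of_real \<kappa>"
proof -
  have "(\<lambda>x. cnj (\<psi> x) * d\<psi> x - cnj (d\<psi> x) * \<psi> x) x = (\<lambda>x. cnj (\<psi> x) * d\<psi> x - cnj (d\<psi> x) * \<psi> x) 0"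
  proof (rule constant_on_interval_if_derivative_zero)
    show "x \<in> {0..x}" using assms by simp
    fix t assume t: "t \<in> {0..x}"
    show "((\<lambda>x. cnj (\<psi> x) * d\<psi> x - cnj (d\<psi> x) * \<psi> x) has_vector_derivative 0) (at t within {0..x})"
      using Lagrange_identity[OF has_vector_derivative_cnj[OF psi_within]
          abs_cont_cnj[OF psi_abs_cont] abs_cont_cnj[OF dpsi_abs_cont] psi_cnj_eqn_within
          psi_within psi_abs_cont dpsi_abs_cont psi_eqn_within t] by simp
  qed
  also have "\<dots> = 2 * \<i> * of_real \<kappa>"
    by (auto simp: \<kappa>_def complex_eq_iff algebra_simps)
  finally show ?thesis .
qed

lemma psi_nonzero: "x \<ge> 0 \<Longrightarrow> \<psi> x \<noteq> 0"
  using wronskian_eq[of x] kappa_pos by auto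

lemma psi_continuous: "continuous_on {0..} \<psi>"
  using psi_deriv by (meson atLeast_iff continuous_on_eq_continuous_within has_vector_derivative_continuous)

lemma k_kappa: "\<i> * of_real k * (2 * \<i> * of_real \<kappa>) = - 1"
  using kappa_pos by (simp add: k_def)

lemma modes_subset: "modes w S al be \<Longrightarrow> T \<subseteq> S \<Longrightarrow> modes w T al be"
  unfolding modes_def by (meson has_vector_derivative_within_subset subsetD)

text \<open>The equation has real coefficients, so conjugation maps solutions at \<open>\<xi> + w\<close> to solutions at
\<open>\<xi> + cnj w\<close>; in coordinates it exchanges the two coefficients.\<close>

lemma modes_conjugate:
  assumes "modes w S al be"
  shows "modes (cnj w) S (\<lambda>x. cnj (be x)) (\<lambda>x. cnj (al x))"
  unfolding modes_def
proof (intro ballI conjI)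
  fix x assume "x \<in> S"
  with assms have d: "(al has_vector_derivative \<i> * w * of_real k * (cnj (\<psi> x) * mix al be x)) (at x within S)"
     "(be has_vector_derivative - (\<i> * w * of_real k * (\<psi> x * mix al be x))) (at x within S)"
    unfolding modes_def by auto
  have m: "mix (\<lambda>x. cnj (be x)) (\<lambda>x. cnj (al x)) x = cnj (mix al be x)"
    by (simp add: mix_def)
  show "((\<lambda>x. cnj (be x)) has_vector_derivative
          \<i> * cnj w * of_real k * (cnj (\<psi> x) * mix (\<lambda>x. cnj (be x)) (\<lambda>x. cnj (al x)) x)) (at x within S)"
    using has_vector_derivative_cnj[OF d(2)] by (simp add: m)
  show "((\<lambda>x. cnj (al x)) has_vector_derivative
          - (\<i> * cnj w * of_real k * (\<psi> x * mix (\<lambda>x. cnj (be x)) (\<lambda>x. cnj (al x)) x))) (at x within S)"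
    using has_vector_derivative_cnj[OF d(1)] by (simp add: m)
qed

lemma modes_linear:
  assumes "modes w S al be" "modes w S al' be'"
  shows "modes w S (\<lambda>x. A * al x + B * al' x) (\<lambda>x. A * be x + B * be' x)"
  unfolding modes_def
proof (intro ballI conjI)
  fix x assume "x \<in> S"
  with assms have d: "(al has_vector_derivative \<i> * w * of_real k * (cnj (\<psi> x) * mix al be x)) (at x within S)"
     "(be has_vector_derivative - (\<i> * w * of_real k * (\<psi> x * mix al be x))) (at x within S)"
     "(al' has_vector_derivative \<i> * w * of_real k * (cnj (\<psi> x) * mix al' be' x)) (at x within S)"
     "(be' has_vector_derivative - (\<i> * w * of_real k * (\<psi> x * mix al' be' x))) (at x within S)"
    unfolding modes_def by auto
  have m: "mix (\<lambda>x. A * al x + B * al' x) (\<lambda>x. A * be x + B * be' x) x = A * mix al be x + B * mix al' be' x"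
    by (simp add: mix_def algebra_simps)
  show "((\<lambda>x. A * al x + B * al' x) has_vector_derivative
          \<i> * w * of_real k * (cnj (\<psi> x) * mix (\<lambda>x. A * al x + B * al' x) (\<lambda>x. A * be x + B * be' x) x)) (at x within S)"
    by (rule has_vector_derivative_eq_rhs[OF has_vector_derivative_add[OF has_vector_derivative_mult_right[OF d(1), of A]
          has_vector_derivative_mult_right[OF d(3), of B]]]) (simp add: m algebra_simps)
  show "((\<lambda>x. A * be x + B * be' x) has_vector_derivative
          - (\<i> * w * of_real k * (\<psi> x * mix (\<lambda>x. A * al x + B * al' x) (\<lambda>x. A * be x + B * be' x) x))) (at x within S)"
    by (rule has_vector_derivative_eq_rhs[OF has_vector_derivative_add[OF has_vector_derivative_mult_right[OF d(2), of A]
          has_vector_derivative_mult_right[OF d(4), of B]]]) (simp add: m algebra_simps)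
qed

text \<open>The coefficient matrix of the system has trace \<open>0\<close>.\<close>

lemma modes_determinant:
  assumes "modes w {p..q} al be" "modes w {p..q} al' be'" "x \<in> {p..q}"
  shows "al x * be' x - al' x * be x = al p * be' p - al' p * be p"
proof (rule constant_on_interval_if_derivative_zero[where f = "\<lambda>x. al x * be' x - al' x * be x", OF _ assms(3)])
  fix x assume "x \<in> {p..q}"
  with assms have d: "(al has_vector_derivative \<i> * w * of_real k * (cnj (\<psi> x) * mix al be x)) (at x within {p..q})"
     "(be has_vector_derivative - (\<i> * w * of_real k * (\<psi> x * mix al be x))) (at x within {p..q})"
     "(al' has_vector_derivative \<i> * w * of_real k * (cnj (\<psi> x) * mix al' be' x)) (at x within {p..q})"
     "(be' has_vector_derivative - (\<i> * w * of_real k * (\<psi> x * mix al' be' x))) (at x within {p..q})"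
    unfolding modes_def by auto
  show "((\<lambda>x. al x * be' x - al' x * be x) has_vector_derivative 0) (at x within {p..q})"
    by (rule has_vector_derivative_eq_rhs[OF has_vector_derivative_diff[OF has_vector_derivative_mult[OF d(1) d(4)] 
         has_vector_derivative_mult[OF d(3) d(2)]]]) (simp add: mix_def algebra_simps)
qed

text \<open>\<open>\<kappa> (|al|\<^sup>2 - |be|\<^sup>2)\<close> is \<open>Im (cnj u * u')\<close> for \<open>u = mix al be\<close>, so this is Green's identity for \<open>u\<close> and
\<open>cnj u\<close>.\<close>

lemma modes_indefinite_norm_derivative:
  assumes "modes w S al be" "x \<in> S"
  shows "((\<lambda>x. (cmod (al x))\<^sup>2 - (cmod (be x))\<^sup>2) has_vector_derivative
            - (2 * k * Im w * (cmod (mix al be x))\<^sup>2)) (at x within S)"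
proof -
  have d: "(al has_vector_derivative \<i> * w * of_real k * (cnj (\<psi> x) * mix al be x)) (at x within S)"
     "(be has_vector_derivative - (\<i> * w * of_real k * (\<psi> x * mix al be x))) (at x within S)"
    using assms unfolding modes_def by auto
  define u where "u = mix al be x"
  have u: "cnj u = cnj (al x) * cnj (\<psi> x) + cnj (be x) * \<psi> x" by (simp add: u_def mix_def)
  have "((\<lambda>x. al x * cnj (al x) - be x * cnj (be x)) has_vector_derivative
     \<i> * w * of_real k * (u * cnj u) - \<i> * cnj w * of_real k * (u * cnj u)) (at x within S)"
    by (rule has_vector_derivative_eq_rhs[OF has_vector_derivative_diff[OF has_vector_derivative_mult[OF d(1) has_vector_derivative_cnj[OF d(1)]]
       has_vector_derivative_mult[OF d(2) has_vector_derivative_cnj[OF d(2)]]]])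
      (simp add: u u_def[symmetric], simp add: u_def mix_def algebra_simps)
  from bounded_linear.has_vector_derivative[OF bounded_linear_Re this]
  have "((\<lambda>x. Re (al x * cnj (al x) - be x * cnj (be x))) has_vector_derivative
     Re (\<i> * w * of_real k * (u * cnj u) - \<i> * cnj w * of_real k * (u * cnj u))) (at x within S)" .
  then show ?thesis
    by (simp add: complex_norm_square[symmetric] u_def[symmetric] complex_mult_cnj cmod_power2
        power2_eq_square algebra_simps)
qed

lemma modes_continuous_on:
  assumes "modes w S al be"
  shows "continuous_on S al" "continuous_on S be"
  using assms unfolding modes_def 
  by (meson continuous_on_eq_continuous_within has_vector_derivative_continuous)+

lemma mix_derivative:
  assumes m: "modes w S al be" and S: "S \<subseteq> {0..}" and x: "x \<in> S"
  shows "(mix al be has_vector_derivative (al x * d\<psi> x + be x * cnj (d\<psi> x))) (at x within S)"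
proof -
  have d: "(al has_vector_derivative \<i> * w * of_real k * (cnj (\<psi> x) * mix al be x)) (at x within S)"
     "(be has_vector_derivative - (\<i> * w * of_real k * (\<psi> x * mix al be x))) (at x within S)"
    using m x unfolding modes_def by auto
  have p: "(\<psi> has_vector_derivative d\<psi> x) (at x within S)"
    by (rule has_vector_derivative_within_subset[OF psi_deriv]) (use S x in auto)
  show ?thesis unfolding mix_def[abs_def]
    by (rule has_vector_derivative_eq_rhs[OF has_vector_derivative_add[OF has_vector_derivative_mult[OF d(1) p]
      has_vector_derivative_mult[OF d(2) has_vector_derivative_cnj[OF p]]]])
      (simp add: algebra_simps)
qed

lemma modes_abs_cont:
  assumes m: "modes w {p..q} al be" and p: "p \<ge> 0"
  shows "abs_cont p q al" "abs_cont p q be"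
proof -
  have "continuous_on {p..q} \<psi>" by (rule abs_cont_imp_continuous_on[OF psi_abs_cont[OF p]])
  then have c: "continuous_on {p..q} (\<lambda>x. \<i> * w * of_real k * (cnj (\<psi> x) * mix al be x))"
       "continuous_on {p..q} (\<lambda>x. - (\<i> * w * of_real k * (\<psi> x * mix al be x)))"
    unfolding mix_def by (intro continuous_intros modes_continuous_on[OF m]; simp)+
  show "abs_cont p q al" "abs_cont p q be"
    using m unfolding modes_def by (auto intro: abs_cont_C1[OF _ c(1)] abs_cont_C1[OF _ c(2)])
qed

lemma mix_schroedinger_expr:
  assumes m: "modes w S al be" and S: "S \<subseteq> {0..}"
  shows "schroedinger_expr V S (mix al be) (\<lambda>x. (of_real \<xi> + w) * mix al be x)"
  unfolding schroedinger_expr_def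
proof (intro exI conjI)
  let ?u' = "\<lambda>x. al x * d\<psi> x + be x * cnj (d\<psi> x)"
  let ?u'' = "\<lambda>x. al x * dd\<psi> x + be x * cnj (dd\<psi> x) - w * mix al be x"
  show "\<forall>x\<in>S. (mix al be has_vector_derivative ?u' x) (at x within S)"
    using mix_derivative[OF m S] by blast
  have p: "p \<ge> 0" if "{p..q} \<subseteq> S" "p \<le> q" for p q using that S by force
  have empty: "abs_cont p q f" if "q < p" for p q f
    unfolding abs_cont_def using that by (auto intro!: exI[of _ 1] sum.neutral) (metis (no_types, lifting) lessThan_iff not_le order_trans sum.neutral)
  have "abs_cont p q (mix al be) \<and> abs_cont p q ?u'" if pq: "{p..q} \<subseteq> S" for p q
  proof (cases "p \<le> q")
    case True
    note m' = modes_subset[OF m pq] and p' = p[OF pq True]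
    show ?thesis unfolding mix_def[abs_def]
      by (intro conjI abs_cont_add abs_cont_mult modes_abs_cont[OF m' p'] abs_cont_cnj
         psi_abs_cont[OF p'] dpsi_abs_cont[OF p'])
  qed (auto intro: empty)
  then show "abs_cont_loc S (mix al be)" "abs_cont_loc S ?u'"
    by (auto simp: abs_cont_loc_def)
  show "AE x in lebesgue. x \<in> S \<longrightarrow> (?u' has_vector_derivative ?u'' x) (at x within S) \<and>
        (of_real \<xi> + w) * mix al be x = - ?u'' x + of_real (V x) * mix al be x"
    using psi_eqn
  proof eventually_elim
    case (elim x)
    show ?case
    proof
      assume x: "x \<in> S"
      have x0: "x \<ge> 0" using x S by auto
      have d: "(al has_vector_derivative \<i> * w * of_real k * (cnj (\<psi> x) * mix al be x)) (at x within S)"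
         "(be has_vector_derivative - (\<i> * w * of_real k * (\<psi> x * mix al be x))) (at x within S)"
        using m x unfolding modes_def by auto
      have p: "(d\<psi> has_vector_derivative dd\<psi> x) (at x within S)"
        by (rule has_vector_derivative_within_subset[of _ _ _ "{0..}"]) (use elim S x in auto)
      have e: "dd\<psi> x = (of_real (V x) - of_real \<xi>) * \<psi> x"
        using elim x0 by (simp add: algebra_simps)
      have "\<i> * w * of_real k * (cnj (\<psi> x) * mix al be x) * d\<psi> x
          - \<i> * w * of_real k * (\<psi> x * mix al be x) * cnj (d\<psi> x)
          = w * mix al be x * (\<i> * of_real k * (cnj (\<psi> x) * d\<psi> x - cnj (d\<psi> x) * \<psi> x))"
        by (simp add: algebra_simps)
      also have "\<dots> = - w * mix al be x" unfolding wronskian_eq[OF x0] k_kappa by simp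
      finally have w: "\<i> * w * of_real k * (cnj (\<psi> x) * mix al be x) * d\<psi> x
          - \<i> * w * of_real k * (\<psi> x * mix al be x) * cnj (d\<psi> x) = - w * mix al be x" .
      have "(?u' has_vector_derivative ?u'' x) (at x within S)"
        by (rule has_vector_derivative_eq_rhs[OF has_vector_derivative_add[OF has_vector_derivative_mult[OF d(1) p]
            has_vector_derivative_mult[OF d(2) has_vector_derivative_cnj[OF p]]]])
          (use w in \<open>simp add: algebra_simps\<close>)
      moreover have "(of_real \<xi> + w) * mix al be x = - ?u'' x + of_real (V x) * mix al be x"
        unfolding e mix_def by (simp add: algebra_simps)
      ultimately show "(?u' has_vector_derivative ?u'' x) (at x within S) \<and>
        (of_real \<xi> + w) * mix al be x = - ?u'' x + of_real (V x) * mix al be x" by blast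
    qed
  qed
qed

text \<open>The coefficients are the Wronskians of \<open>u\<close> with \<open>cnj \<psi>\<close> and \<open>\<psi>\<close>, divided by \<open>W\<close> up to sign; the Lagrange identity
gives their derivatives.\<close>

lemma solution_has_modes:
  assumes p: "p \<ge> 0" and u: "schroedinger_expr V {p..q} u (\<lambda>x. (of_real \<xi> + w) * u x)"
  obtains al be where "modes w {p..q} al be" "\<And>x. x \<in> {p..q} \<Longrightarrow> u x = mix al be x"
proof -
  obtain du ddu where du: "\<forall>x\<in>{p..q}. (u has_vector_derivative du x) (at x within {p..q})"
     "abs_cont_loc {p..q} u" "abs_cont_loc {p..q} du"
    "AE x in lebesgue. x \<in> {p..q} \<longrightarrow> (du has_vector_derivative ddu x) (at x within {p..q}) \<and>
           (of_real \<xi> + w) * u x = - ddu x + of_real (V x) * u x"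
    using u unfolding schroedinger_expr_def by blast
  have ac: "abs_cont p q u" "abs_cont p q du" using du unfolding abs_cont_loc_def by auto
  define al where "al x = \<i> * of_real k * (u x * cnj (d\<psi> x) - du x * cnj (\<psi> x))" for x
  define be where "be x = - (\<i> * of_real k * (u x * d\<psi> x - du x * \<psi> x))" for x
  have mix: "u x = mix al be x" if x: "x \<in> {p..q}" for x
  proof -
    have x0: "x \<ge> 0" using x p by auto
    have "mix al be x = - u x * (\<i> * of_real k * (cnj (\<psi> x) * d\<psi> x - cnj (d\<psi> x) * \<psi> x))"
      unfolding mix_def al_def be_def by (simp add: algebra_simps)
    also have "\<dots> = u x" unfolding wronskian_eq[OF x0] k_kappa by simp
    finally show ?thesis by simp
  qed
  have "modes w {p..q} al be"
    unfolding modes_def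
  proof (intro ballI conjI)
    fix x assume x: "x \<in> {p..q}"
    have 1: "((\<lambda>x. u x * cnj (d\<psi> x) - du x * cnj (\<psi> x)) has_vector_derivative
        (of_real \<xi> + w - of_real \<xi>) * (u x * cnj (\<psi> x))) (at x within {p..q})"
      by (rule Lagrange_identity[OF bspec[OF du(1)] ac du(4) has_vector_derivative_cnj[OF psi_within]
          abs_cont_cnj[OF psi_abs_cont] abs_cont_cnj[OF dpsi_abs_cont] psi_cnj_eqn_within x]) (use p in auto)
    have 2: "((\<lambda>x. u x * d\<psi> x - du x * \<psi> x) has_vector_derivative
        (of_real \<xi> + w - of_real \<xi>) * (u x * \<psi> x)) (at x within {p..q})"
      by (rule Lagrange_identity[OF bspec[OF du(1)] ac du(4) psi_within
          psi_abs_cont dpsi_abs_cont psi_eqn_within x]) (use p in auto)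
    show "(al has_vector_derivative \<i> * w * of_real k * (cnj (\<psi> x) * mix al be x)) (at x within {p..q})"
      unfolding al_def[abs_def]
      by (rule has_vector_derivative_eq_rhs[OF has_vector_derivative_mult_right[OF 1]])
        (simp add: mix[OF x, symmetric, unfolded al_def[abs_def]])
    show "(be has_vector_derivative - (\<i> * w * of_real k * (\<psi> x * mix al be x))) (at x within {p..q})"
      unfolding be_def[abs_def]
      by (rule has_vector_derivative_eq_rhs[OF has_vector_derivative_minus[OF has_vector_derivative_mult_right[OF 2]]])
        (simp add: mix[OF x, symmetric, unfolded be_def[abs_def]])
  qed
  with mix that show thesis by blast
qed

end


section \<open>The solution matrix as an entire function of the energy\<close>

lemma has_vector_derivative_within_ray:
  fixes f :: "real \<Rightarrow> 'a::real_normed_vector"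
  assumes "x \<ge> p" "(f has_vector_derivative f') (at x within {p..x+1})"
  shows "(f has_vector_derivative f') (at x within {p..})"
proof -
  have "at x within {p..x+1} = at x within {p..}"
    by (rule at_within_nhd[of x "{..<x+1}"]) auto
  then show ?thesis using assms(2) by simp
qed

lemma has_integral_series:
  fixes g :: "nat \<Rightarrow> real \<Rightarrow> complex"
  assumes cont: "\<And>n. continuous_on {a..b} (g n)"
    and bound: "\<And>n s. s \<in> {a..b} \<Longrightarrow> norm (g n s) \<le> M n" and M: "summable M"
    and G: "\<And>s. s \<in> {a..b} \<Longrightarrow> (\<lambda>n. g n s) sums G s"
    and I: "\<And>n. (g n has_integral I n) {a..b}" and J: "I sums J"
  shows "(G has_integral J) {a..b}"
proof -
  have u: "uniform_limit {a..b} (\<lambda>N s. \<Sum>n<N. g n s) (\<lambda>s. \<Sum>n. g n s) sequentially"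
    by (rule Weierstrass_m_test[OF bound M])
  obtain I' J' where I': "\<And>N. ((\<lambda>s. \<Sum>n<N. g n s) has_integral I' N) {a..b}"
    "((\<lambda>s. \<Sum>n. g n s) has_integral J') {a..b}" "I' \<longlonglongrightarrow> J'"
    by (rule uniform_limit_integral[OF u]) (auto intro!: continuous_intros cont)
  have "I' N = (\<Sum>n<N. I n)" for N
    using has_integral_unique[OF I'(1) has_integral_sum[of "{..<N}", OF _ I]] by simp
  then have "J' = J" using I'(3) J unfolding sums_def by (metis LIMSEQ_unique ext)
  then show ?thesis
    using has_integral_eq[OF _ I'(2), of G] G by (metis sums_unique)
qed

context complex_frame
begin

text \<open>For \<open>0 \<le> x\<close> this is \<open>\<pi> c\<^bsub>[0,x]\<^esub>\<close>, see \<open>c_weight_eq_phase\<close>. It is the angle by which the solution matrix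
rotates per unit of energy in the scaling limit.\<close>

definition phase :: "real \<Rightarrow> real" where
  "phase x = k * integral {0..x} (\<lambda>s. (cmod (\<psi> s))\<^sup>2)"

lemma psi_continuous_on: "S \<subseteq> {0..} \<Longrightarrow> continuous_on S \<psi>"
  using psi_continuous continuous_on_subset by blast

lemma psi_square_integrable_on: "p \<ge> 0 \<Longrightarrow> (\<lambda>s. (cmod (\<psi> s))\<^sup>2) integrable_on {p..q}"
  by (intro integrable_continuous_interval continuous_intros psi_continuous_on) auto

lemma phase_zero [simp]: "phase 0 = 0"
  by (simp add: phase_def)

lemma phase_diff:
  assumes "0 \<le> p" "p \<le> q"
  shows "phase q - phase p = k * integral {p..q} (\<lambda>s. (cmod (\<psi> s))\<^sup>2)"
  using Henstock_Kurzweil_Integration.integral_combine[OF assms psi_square_integrable_on[of 0 q]]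
  by (simp add: phase_def right_diff_distrib[symmetric])

lemma phase_mono:
  assumes "0 \<le> p" "p \<le> q"
  shows "phase p \<le> phase q"
proof -
  have "0 \<le> k * integral {p..q} (\<lambda>s. (cmod (\<psi> s))\<^sup>2)"
    using k_pos by (intro mult_nonneg_nonneg Henstock_Kurzweil_Integration.integral_nonneg psi_square_integrable_on assms) auto
  then show ?thesis using phase_diff[OF assms] by simp
qed

lemma phase_nonneg: "0 \<le> x \<Longrightarrow> 0 \<le> phase x"
  using phase_mono[of 0 x] by simp

lemma phase_deriv:
  assumes "x \<in> {0..q}"
  shows "(phase has_real_derivative k * (cmod (\<psi> x))\<^sup>2) (at x within {0..q})"
  unfolding phase_def[abs_def]
  by (intro DERIV_cmult integral_has_real_derivative assms continuous_intros psi_continuous_on) auto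

text \<open>The system depends linearly on \<open>w\<close>, so Picard iteration from \<open>(1, 0)\<close> produces the coefficients of a
power series in \<open>w\<close>.\<close>

primrec modes_coeff :: "nat \<Rightarrow> real \<Rightarrow> complex \<times> complex" where
  "modes_coeff 0 = (\<lambda>x. (1, 0))"
| "modes_coeff (Suc n) = (\<lambda>x.
     (integral {0..x} (\<lambda>s. \<i> * of_real k * (cnj (\<psi> s) *
         mix (\<lambda>t. fst (modes_coeff n t)) (\<lambda>t. snd (modes_coeff n t)) s)),
      integral {0..x} (\<lambda>s. - (\<i> * of_real k * (\<psi> s *
         mix (\<lambda>t. fst (modes_coeff n t)) (\<lambda>t. snd (modes_coeff n t)) s)))))"

definition En :: "nat \<Rightarrow> real \<Rightarrow> complex" where "En n x = fst (modes_coeff n x)"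
definition Fn :: "nat \<Rightarrow> real \<Rightarrow> complex" where "Fn n x = snd (modes_coeff n x)"

lemma EFn_0 [simp]: "En 0 x = 1" "Fn 0 x = 0"
  by (simp_all add: En_def Fn_def)

lemma EFn_Suc:
  "En (Suc n) x = integral {0..x} (\<lambda>s. \<i> * of_real k * (cnj (\<psi> s) * mix (En n) (Fn n) s))"
  "Fn (Suc n) x = integral {0..x} (\<lambda>s. - (\<i> * of_real k * (\<psi> s * mix (En n) (Fn n) s)))"
  by (simp_all add: En_def Fn_def[abs_def] En_def[abs_def])

lemma EFn_continuous: "continuous_on {0..q} (En n)" "continuous_on {0..q} (Fn n)"
proof (induction n)
  case 0
  have "En 0 = (\<lambda>_. 1)" "Fn 0 = (\<lambda>_. 0)" by (auto simp: fun_eq_iff)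
  then show "continuous_on {0..q} (En 0)" "continuous_on {0..q} (Fn 0)" by auto
next
  case (Suc n)
  have c: "continuous_on {0..q} (\<lambda>s. \<i> * of_real k * (cnj (\<psi> s) * mix (En n) (Fn n) s))"
    "continuous_on {0..q} (\<lambda>s. - (\<i> * of_real k * (\<psi> s * mix (En n) (Fn n) s)))"
    unfolding mix_def by (intro continuous_intros psi_continuous_on Suc; auto)+
  show "continuous_on {0..q} (En (Suc n))" "continuous_on {0..q} (Fn (Suc n))"
    unfolding EFn_Suc[abs_def]
    by (rule indefinite_integral_continuous_1 integrable_continuous_interval c)+
qed

lemma EFn_integrand_continuous:
  "continuous_on {0..q} (\<lambda>s. \<i> * of_real k * (cnj (\<psi> s) * mix (En n) (Fn n) s))"
  "continuous_on {0..q} (\<lambda>s. - (\<i> * of_real k * (\<psi> s * mix (En n) (Fn n) s)))"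
  unfolding mix_def by (intro continuous_intros psi_continuous_on EFn_continuous; auto)+

text \<open>In the maximum norm the coefficient matrix is bounded by twice the derivative of \<open>phase\<close>, so the
iterated integrals are dominated by the terms of the exponential series.\<close>

lemma EFn_bound:
  assumes "x \<ge> 0"
  shows "cmod (En n x) \<le> (2 * phase x) ^ n / fact n \<and> cmod (Fn n x) \<le> (2 * phase x) ^ n / fact n"
  using assms
proof (induction n arbitrary: x)
  case 0
  then show ?case by simp
next
  case (Suc n)
  let ?g = "\<lambda>s. 2 * (k * (cmod (\<psi> s))\<^sup>2) * (2 * phase s) ^ n / fact n"
  have "((\<lambda>s. (2 * phase s) ^ Suc n / fact (Suc n)) has_vector_derivative ?g s) (at s within {0..x})"
    if s: "s \<in> {0..x}" for s
    unfolding has_real_derivative_iff_has_vector_derivative[symmetric]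
  proof (rule DERIV_cong[OF DERIV_cdivide[OF DERIV_power[OF DERIV_cmult[OF phase_deriv[OF s]]]]])
    have "fact (Suc n) = real (Suc n) * fact n" by (simp only: fact_Suc)
    then show "real (Suc n) * (2 * (k * (cmod (\<psi> s))\<^sup>2) * (2 * phase s) ^ (Suc n - Suc 0)) / fact (Suc n) = ?g s"
      by (simp del: of_nat_Suc fact_Suc)
  qed
  from fundamental_theorem_of_calculus[OF Suc.prems this]
  have g: "(?g has_integral (2 * phase x) ^ Suc n / fact (Suc n)) {0..x}" by simp
  have le: "k * (cmod (\<psi> s) * cmod (mix (En n) (Fn n) s)) \<le> ?g s" if s: "s \<in> {0..x}" for s
  proof -
    have "cmod (mix (En n) (Fn n) s) \<le> cmod (En n s) * cmod (\<psi> s) + cmod (Fn n s) * cmod (\<psi> s)"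
      unfolding mix_def by (metis complex_mod_cnj norm_mult norm_triangle_ineq)
    also have "\<dots> \<le> (2 * phase s) ^ n / fact n * cmod (\<psi> s) + (2 * phase s) ^ n / fact n * cmod (\<psi> s)"
      using Suc.IH[of s] s by (intro add_mono mult_right_mono) auto
    also have "\<dots> = 2 * ((2 * phase s) ^ n / fact n * cmod (\<psi> s))" by simp
    finally have "k * cmod (\<psi> s) * cmod (mix (En n) (Fn n) s)
        \<le> k * cmod (\<psi> s) * (2 * ((2 * phase s) ^ n / fact n * cmod (\<psi> s)))"
      by (rule mult_left_mono) (use k_pos in simp)
    also have "\<dots> = ?g s" by (simp add: power2_eq_square)
    finally show ?thesis by (simp only: mult.assoc)
  qed
  have "cmod (En (Suc n) x) \<le> integral {0..x} ?g"
    unfolding EFn_Suc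
  proof (rule integral_norm_bound_integral)
    show "cmod (\<i> * of_real k * (cnj (\<psi> s) * mix (En n) (Fn n) s)) \<le> ?g s" if "s \<in> {0..x}" for s
      using le[OF that] k_pos by (simp add: norm_mult algebra_simps)
  qed (use g EFn_integrand_continuous integrable_continuous_interval in blast)+
  moreover have "cmod (Fn (Suc n) x) \<le> integral {0..x} ?g"
    unfolding EFn_Suc
  proof (rule integral_norm_bound_integral)
    show "cmod (- (\<i> * of_real k * (\<psi> s * mix (En n) (Fn n) s))) \<le> ?g s" if "s \<in> {0..x}" for s
      using le[OF that] k_pos by (simp add: norm_mult algebra_simps)
  qed (use g EFn_integrand_continuous integrable_continuous_interval in blast)+
  ultimately show ?case using integral_unique[OF g] by simp
qed

definition E :: "real \<Rightarrow> complex \<Rightarrow> complex" where "E x w = (\<Sum>n. w ^ n * En n x)"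
definition F :: "real \<Rightarrow> complex \<Rightarrow> complex" where "F x w = (\<Sum>n. w ^ n * Fn n x)"

lemma EFn_term_bound:
  assumes "0 \<le> x" "x \<le> q"
  shows "cmod (w ^ n * En n x) \<le> (2 * phase q * cmod w) ^ n / fact n"
    and "cmod (w ^ n * Fn n x) \<le> (2 * phase q * cmod w) ^ n / fact n"
proof -
  have "(2 * phase x) ^ n / fact n \<le> (2 * phase q) ^ n / fact n"
    using phase_mono[OF assms] phase_nonneg[OF assms(1)]
    by (intro divide_right_mono power_mono) auto
  then have b: "cmod (En n x) \<le> (2 * phase q) ^ n / fact n" "cmod (Fn n x) \<le> (2 * phase q) ^ n / fact n"
    using EFn_bound[OF assms(1), of n] by auto
  show "cmod (w ^ n * En n x) \<le> (2 * phase q * cmod w) ^ n / fact n"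
    "cmod (w ^ n * Fn n x) \<le> (2 * phase q * cmod w) ^ n / fact n"
    using mult_left_mono[OF b(1), of "cmod w ^ n"] mult_left_mono[OF b(2), of "cmod w ^ n"]
    by (simp_all add: norm_mult norm_power power_mult_distrib mult_ac)
qed

lemma summable_exp_terms: "summable (\<lambda>n. (c::real) ^ n / fact n)"
  using summable_exp[of c] by (simp add: field_simps)

lemma EF_sums:
  assumes "x \<ge> 0"
  shows "(\<lambda>n. w ^ n * En n x) sums E x w" "(\<lambda>n. w ^ n * Fn n x) sums F x w"
  unfolding E_def F_def
  by (rule summable_sums summable_comparison_test'[OF summable_exp_terms EFn_term_bound(1)[OF assms order_refl]]
     summable_comparison_test'[OF summable_exp_terms EFn_term_bound(2)[OF assms order_refl]])+

lemma EF_bound: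
  assumes "x \<ge> 0"
  shows "cmod (E x w) \<le> exp (2 * phase x * cmod w)" "cmod (F x w) \<le> exp (2 * phase x * cmod w)"
proof -
  have e: "exp (2 * phase x * cmod w) = (\<Sum>n. (2 * phase x * cmod w) ^ n / fact n)"
    by (simp add: exp_def divide_inverse mult.commute)
  show "cmod (E x w) \<le> exp (2 * phase x * cmod w)" "cmod (F x w) \<le> exp (2 * phase x * cmod w)"
    unfolding e E_def F_def
    using norm_suminf_le[OF EFn_term_bound(1)[OF assms order_refl] summable_exp_terms]
      norm_suminf_le[OF EFn_term_bound(2)[OF assms order_refl] summable_exp_terms] by auto
qed

lemma EF_holomorphic:
  assumes "x \<ge> 0"
  shows "(\<lambda>w. E x w) holomorphic_on S" "(\<lambda>w. F x w) holomorphic_on S"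
proof -
  have "E x field_differentiable at w \<and> F x field_differentiable at w" for w
  proof -
    have "E x holomorphic_on ball 0 (cmod w + 1)" "F x holomorphic_on ball 0 (cmod w + 1)"
      by (rule power_series_holomorphic[where a = "\<lambda>n. En n x"], use EF_sums(1)[OF assms] in \<open>simp add: mult.commute\<close>)
        (rule power_series_holomorphic[where a = "\<lambda>n. Fn n x"], use EF_sums(2)[OF assms] in \<open>simp add: mult.commute\<close>)
    then show ?thesis by (auto simp: holomorphic_on_open field_differentiable_def)
  qed
  then show "(\<lambda>w. E x w) holomorphic_on S" "(\<lambda>w. F x w) holomorphic_on S"
    by (auto simp: holomorphic_on_def intro: field_differentiable_at_within)
qed

lemma EF_at_0 [simp]: "E 0 w = 1" "F 0 w = 0"
proof -
  have "En (Suc n) 0 = 0" "Fn (Suc n) 0 = 0" for n by (simp_all add: EFn_Suc)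
  then have z: "w ^ n * En n 0 = (if n = 0 then 1 else 0)" "w ^ n * Fn n 0 = 0" for n
    by (cases n; simp)+
  show "E 0 w = 1" "F 0 w = 0"
    unfolding E_def F_def z using sums_unique[OF sums_single[of 0 "\<lambda>_. 1::complex"]] by simp_all
qed

lemma EF_w_0 [simp]: "E x 0 = 1" "F x 0 = 0"
  unfolding E_def F_def using powser_zero[of "\<lambda>n. En n x"] powser_zero[of "\<lambda>n. Fn n x"]
  by (simp_all add: mult.commute)

text \<open>Termwise integration: the recursion defining the coefficients, summed, is the integrated system.\<close>

lemma EF_modes_interval:
  assumes q: "q \<ge> 0"
  shows "modes w {0..q} (\<lambda>x. E x w) (\<lambda>x. F x w)"
proof -
  let ?E = "\<lambda>x. E x w" and ?F = "\<lambda>x. F x w"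
  let ?gE = "\<lambda>n s. w ^ Suc n * (\<i> * of_real k * (cnj (\<psi> s) * mix (En n) (Fn n) s))"
  let ?gF = "\<lambda>n s. w ^ Suc n * - (\<i> * of_real k * (\<psi> s * mix (En n) (Fn n) s))"
  have "bounded (\<psi> ` {0..q})"
    by (intro compact_imp_bounded compact_continuous_image psi_continuous_on) auto
  then obtain B where B: "\<And>s. s \<in> {0..q} \<Longrightarrow> cmod (\<psi> s) \<le> B"
    unfolding bounded_iff by blast
  have B0: "B \<ge> 0" using B[of 0] q by (meson atLeastAtMost_iff norm_ge_zero order_refl order_trans)
  define M where "M n = 2 * (k * cmod w * B\<^sup>2) * ((2 * phase q * cmod w) ^ n / fact n)" for n
  have sumM: "summable M" unfolding M_def by (intro summable_mult summable_exp_terms)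
  have mixb: "cmod w ^ n * cmod (mix (En n) (Fn n) s) \<le> 2 * ((2 * phase q * cmod w) ^ n / fact n) * B"
    if s: "s \<in> {0..q}" for n s
  proof -
    have "w ^ n * mix (En n) (Fn n) s = (w ^ n * En n s) * \<psi> s + (w ^ n * Fn n s) * cnj (\<psi> s)"
      by (simp add: mix_def algebra_simps)
    also have "cmod \<dots> \<le> cmod (w ^ n * En n s) * cmod (\<psi> s) + cmod (w ^ n * Fn n s) * cmod (\<psi> s)"
      by (metis complex_mod_cnj norm_mult norm_triangle_ineq)
    also have "\<dots> \<le> (2 * phase q * cmod w) ^ n / fact n * B + (2 * phase q * cmod w) ^ n / fact n * B"
      using s B[OF s] phase_nonneg[OF q] by (intro add_mono mult_mono EFn_term_bound) auto
    also have "\<dots> = 2 * ((2 * phase q * cmod w) ^ n / fact n) * B" by simp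
    finally show ?thesis by (simp only: norm_mult norm_power)
  qed
  have bound: "cmod (?gE n s) \<le> M n" "cmod (?gF n s) \<le> M n" if s: "s \<in> {0..q}" for n s
  proof -
    have "(k * cmod w * cmod (\<psi> s)) * (cmod w ^ n * cmod (mix (En n) (Fn n) s))
        \<le> (k * cmod w * B) * (2 * ((2 * phase q * cmod w) ^ n / fact n) * B)"
      by (rule mult_mono[OF _ mixb[OF s]]) (use k_pos B0 B[OF s] in \<open>auto intro!: mult_left_mono\<close>)
    then show "cmod (?gE n s) \<le> M n" "cmod (?gF n s) \<le> M n"
      using k_pos by (simp_all add: M_def norm_mult norm_power power2_eq_square mult_ac)
  qed
  have sums: "(\<lambda>n. ?gE n s) sums (\<i> * w * of_real k * (cnj (\<psi> s) * mix ?E ?F s))"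
       "(\<lambda>n. ?gF n s) sums (- (\<i> * w * of_real k * (\<psi> s * mix ?E ?F s)))" if s: "s \<in> {0..q}" for s
  proof -
    have s0: "s \<ge> 0" using s by simp
    have m: "(\<lambda>n. (w ^ n * En n s) * \<psi> s + (w ^ n * Fn n s) * cnj (\<psi> s)) sums mix ?E ?F s"
      unfolding mix_def by (intro sums_add sums_mult2 EF_sums s0)
    show "(\<lambda>n. ?gE n s) sums (\<i> * w * of_real k * (cnj (\<psi> s) * mix ?E ?F s))"
      using sums_mult[OF m, of "\<i> * w * of_real k * cnj (\<psi> s)"] by (simp add: mix_def algebra_simps)
    show "(\<lambda>n. ?gF n s) sums (- (\<i> * w * of_real k * (\<psi> s * mix ?E ?F s)))"
      using sums_mult[OF m, of "- (\<i> * w * of_real k * \<psi> s)"] by (simp add: mix_def algebra_simps)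
  qed
  have c: "continuous_on {0..q} ?E" "continuous_on {0..q} ?F"
    unfolding E_def F_def
    by (rule uniform_limit_theorem[OF _ Weierstrass_m_test[OF _ summable_exp_terms[of "2 * phase q * cmod w"]]];
        use EFn_term_bound in \<open>auto intro!: always_eventually continuous_intros EFn_continuous\<close>)+
  have cg: "continuous_on {0..q} (\<lambda>s. \<i> * w * of_real k * (cnj (\<psi> s) * mix ?E ?F s))"
    "continuous_on {0..q} (\<lambda>s. - (\<i> * w * of_real k * (\<psi> s * mix ?E ?F s)))"
    unfolding mix_def by (intro continuous_intros psi_continuous_on c; auto)+
  have gn: "(?gE n has_integral w ^ Suc n * En (Suc n) x) {0..x}"
      "(?gF n has_integral w ^ Suc n * Fn (Suc n) x) {0..x}" for n x
    unfolding EFn_Suc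
    by (intro has_integral_mult_right integrable_integral integrable_continuous_interval EFn_integrand_continuous)+
  have cgn: "continuous_on {0..x} (?gE n)" "continuous_on {0..x} (?gF n)" for n x
    by (intro continuous_on_mult continuous_on_const EFn_integrand_continuous)+
  have ints: "((\<lambda>s. \<i> * w * of_real k * (cnj (\<psi> s) * mix ?E ?F s)) has_integral (?E x - ?E 0)) {0..x}"
     "((\<lambda>s. - (\<i> * w * of_real k * (\<psi> s * mix ?E ?F s))) has_integral (?F x - ?F 0)) {0..x}"
    if x: "x \<in> {0..q}" for x
  proof -
    have x0: "x \<ge> 0" using x by simp
    show "((\<lambda>s. \<i> * w * of_real k * (cnj (\<psi> s) * mix ?E ?F s)) has_integral (?E x - ?E 0)) {0..x}"
    proof (rule has_integral_series[OF cgn(1) _ sumM _ gn(1)])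
      show "(\<lambda>n. w ^ Suc n * En (Suc n) x) sums (?E x - ?E 0)"
        using EF_sums(1)[OF x0, of w] sums_Suc_iff[of "\<lambda>n. w ^ n * En n x"] by simp
    qed (use x bound sums in auto)
    show "((\<lambda>s. - (\<i> * w * of_real k * (\<psi> s * mix ?E ?F s))) has_integral (?F x - ?F 0)) {0..x}"
    proof (rule has_integral_series[OF cgn(2) _ sumM _ gn(2)])
      show "(\<lambda>n. w ^ Suc n * Fn (Suc n) x) sums (?F x - ?F 0)"
        using EF_sums(2)[OF x0, of w] sums_Suc_iff[of "\<lambda>n. w ^ n * Fn n x"] by simp
    qed (use x bound sums in auto)
  qed
  show ?thesis
    unfolding modes_def
    using has_vector_derivative_from_has_integral[OF cg(1) ints(1)]
      has_vector_derivative_from_has_integral[OF cg(2) ints(2)]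
    by blast
qed

lemma EF_modes: "modes w {0..} (\<lambda>x. E x w) (\<lambda>x. F x w)"
  unfolding modes_def
proof (intro ballI conjI)
  fix x :: real assume x: "x \<in> {0..}"
  then have "modes w {0..x+1} (\<lambda>x. E x w) (\<lambda>x. F x w)" "x \<in> {0..x+1}"
    by (auto intro: EF_modes_interval)
  then show "((\<lambda>x. E x w) has_vector_derivative \<i> * w * of_real k * (cnj (\<psi> x) * mix (\<lambda>x. E x w) (\<lambda>x. F x w) x)) (at x within {0..})"
    "((\<lambda>x. F x w) has_vector_derivative - (\<i> * w * of_real k * (\<psi> x * mix (\<lambda>x. E x w) (\<lambda>x. F x w) x))) (at x within {0..})"
    using x unfolding modes_def by (auto intro!: has_vector_derivative_within_ray)
qed

text \<open>The second column of the solution matrix, with initial value \<open>(0, 1)\<close>.\<close>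

lemma EF_conjugate_modes: "modes w {0..} (\<lambda>x. cnj (F x (cnj w))) (\<lambda>x. cnj (E x (cnj w)))"
  using modes_conjugate[OF EF_modes[of "cnj w"]] by simp

lemma EF_determinant:
  assumes "x \<ge> 0"
  shows "E x w * cnj (E x (cnj w)) - cnj (F x (cnj w)) * F x w = 1"
  using modes_determinant[OF modes_subset[OF EF_modes[of w]] modes_subset[OF EF_conjugate_modes[of w]], of 0 x x]
    assms by simp

lemma modes_energy_identity:
  assumes m: "modes w {p..q} al be" and "p \<le> q"
  shows "((\<lambda>s. - (2 * k * Im w * (cmod (mix al be s))\<^sup>2)) has_integral
     ((cmod (al q))\<^sup>2 - (cmod (be q))\<^sup>2) - ((cmod (al p))\<^sup>2 - (cmod (be p))\<^sup>2)) {p..q}"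
  by (rule fundamental_theorem_of_calculus[OF \<open>p \<le> q\<close> modes_indefinite_norm_derivative[OF m]])

lemma modes_energy_decreasing:
  assumes m: "modes w {p..q} al be" and "p \<le> q" and "Im w \<ge> 0"
  shows "(cmod (al q))\<^sup>2 - (cmod (be q))\<^sup>2 \<le> (cmod (al p))\<^sup>2 - (cmod (be p))\<^sup>2"
  using has_integral_le[OF modes_energy_identity[OF m \<open>p \<le> q\<close>] has_integral_0] k_pos \<open>Im w \<ge> 0\<close> by simp

lemma EF_lower_half_plane:
  assumes "x \<ge> 0" "Im w \<le> 0"
  shows "1 \<le> (cmod (E x w))\<^sup>2 - (cmod (F x w))\<^sup>2"
proof -
  have m: "modes w {0..x} (\<lambda>x. E x w) (\<lambda>x. F x w)" by (rule EF_modes_interval[OF assms(1)])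
  show ?thesis
    using has_integral_nonneg[OF modes_energy_identity[OF m assms(1)]] k_pos assms(2)
    by (simp add: mult_nonneg_nonpos mult_nonpos_nonneg)
qed

end


section \<open>Weyl discs and the Weyl function\<close>

lemma square_integrable_subset:
  assumes "square_integrable S f" "T \<subseteq> S" "T \<in> sets lebesgue"
  shows "square_integrable T f"
proof -
  have "set_borel_measurable lebesgue T f"
    using assms set_borel_measurable_subset[of lebesgue S f T] unfolding square_integrable_def by auto
  then show ?thesis
    using assms set_integrable_subset unfolding square_integrable_def by blast
qed

lemma square_integrable_near_infinity_cong:
  assumes "square_integrable_near_infinity f" "\<And>x. x \<ge> 0 \<Longrightarrow> g x = f x"
  shows "square_integrable_near_infinity g"
proof -
  obtain R where R: "R \<ge> 0" "square_integrable {R..} f"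
    using assms(1) unfolding square_integrable_near_infinity_def by blast
  have eq: "(\<lambda>x. indicator {R..} x *\<^sub>R g x) = (\<lambda>x. indicator {R..} x *\<^sub>R f x)"
    "(\<lambda>x. indicator {R..} x *\<^sub>R (cmod (g x))\<^sup>2) = (\<lambda>x. indicator {R..} x *\<^sub>R (cmod (f x))\<^sup>2)"
    using R(1) assms(2) by (auto simp: fun_eq_iff indicator_def)
  have "square_integrable {R..} g"
    using R(2) unfolding square_integrable_def set_borel_measurable_def set_integrable_def eq .
  with R(1) show ?thesis unfolding square_integrable_near_infinity_def by blast
qed

lemma square_integrable_near_infinity_combination:
  assumes "square_integrable_near_infinity f" "square_integrable_near_infinity g"
  shows "square_integrable_near_infinity (\<lambda>x. A * f x + B * g x)"
proof -
  obtain R1 R2 where R1: "R1 \<ge> 0" "square_integrable {R1..} f"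
    and R2: "R2 \<ge> 0" "square_integrable {R2..} g"
    using assms unfolding square_integrable_near_infinity_def by blast
  define S where "S = {max R1 R2..}"
  have "square_integrable S f" "square_integrable S g"
    by (rule square_integrable_subset[OF R1(2)] square_integrable_subset[OF R2(2)]; auto simp: S_def)+
  then have f: "set_borel_measurable lebesgue S f" "set_integrable lebesgue S (\<lambda>x. (cmod (f x))\<^sup>2)"
    and g: "set_borel_measurable lebesgue S g" "set_integrable lebesgue S (\<lambda>x. (cmod (g x))\<^sup>2)"
    unfolding square_integrable_def by auto
  let ?h = "\<lambda>x. A * f x + B * g x"
  have "(\<lambda>x. A * (indicator S x *\<^sub>R f x) + B * (indicator S x *\<^sub>R g x)) \<in> borel_measurable lebesgue"
    using f(1) g(1) unfolding set_borel_measurable_def by measurable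
  moreover have "(\<lambda>x. A * (indicator S x *\<^sub>R f x) + B * (indicator S x *\<^sub>R g x)) = (\<lambda>x. indicator S x *\<^sub>R ?h x)"
    by (simp add: fun_eq_iff indicator_def)
  ultimately have m: "set_borel_measurable lebesgue S ?h"
    unfolding set_borel_measurable_def by simp
  have "set_integrable lebesgue S (\<lambda>x. 2 * (cmod A)\<^sup>2 * (cmod (f x))\<^sup>2 + 2 * (cmod B)\<^sup>2 * (cmod (g x))\<^sup>2)"
    by (intro set_integral_add set_integrable_mult_right f g)
  then have "set_integrable lebesgue S (\<lambda>x. (cmod (?h x))\<^sup>2)"
  proof (rule set_integrable_bound)
    have "(\<lambda>x. (cmod (indicator S x *\<^sub>R ?h x))\<^sup>2) \<in> borel_measurable lebesgue"
      using m unfolding set_borel_measurable_def by measurable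
    moreover have "(\<lambda>x. (cmod (indicator S x *\<^sub>R ?h x))\<^sup>2) = (\<lambda>x. indicator S x *\<^sub>R (cmod (?h x))\<^sup>2)"
      by (simp add: fun_eq_iff indicator_def)
    ultimately show "set_borel_measurable lebesgue S (\<lambda>x. (cmod (?h x))\<^sup>2)"
      unfolding set_borel_measurable_def by simp
    have "(cmod (?h x))\<^sup>2 \<le> 2 * (cmod A)\<^sup>2 * (cmod (f x))\<^sup>2 + 2 * (cmod B)\<^sup>2 * (cmod (g x))\<^sup>2" for x
    proof -
      have "(cmod (?h x))\<^sup>2 \<le> (cmod (A * f x) + cmod (B * g x))\<^sup>2"
        by (intro power_mono norm_triangle_ineq) auto
      also have "\<dots> \<le> 2 * (cmod (A * f x))\<^sup>2 + 2 * (cmod (B * g x))\<^sup>2"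
        using sum_squares_bound[of "cmod (A * f x)" "cmod (B * g x)"] by (simp add: power2_sum)
      finally show ?thesis by (simp add: norm_mult power_mult_distrib)
    qed
    then show "AE x in lebesgue. x \<in> S \<longrightarrow> norm ((cmod (?h x))\<^sup>2)
        \<le> norm (2 * (cmod A)\<^sup>2 * (cmod (f x))\<^sup>2 + 2 * (cmod B)\<^sup>2 * (cmod (g x))\<^sup>2)"
      by (intro AE_I2 impI) (simp add: order_trans[OF _ abs_ge_self])
  qed
  with m have "square_integrable S ?h" unfolding square_integrable_def by simp
  then show ?thesis
    unfolding square_integrable_near_infinity_def S_def using R1(1) by (intro exI[of _ "max R1 R2"]) auto
qed

lemma continuous_imp_square_integrable:
  assumes "continuous_on {a..b} f" shows "square_integrable {a..b} f"
proof -
  have "(\<lambda>x. (cmod (f x))\<^sup>2) integrable_on {a..b}"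
    by (intro integrable_continuous_interval continuous_intros assms)
  then have "set_integrable lebesgue {a..b} (\<lambda>x. (cmod (f x))\<^sup>2)"
    by (intro nonnegative_absolutely_integrable_1) auto
  moreover have "set_borel_measurable lebesgue {a..b} f"
    unfolding set_borel_measurable_def
    by (rule measurable_completion) (use borel_measurable_continuous_on_indicator[OF _ assms] in simp)
  ultimately show ?thesis unfolding square_integrable_def by blast
qed

lemma square_integrable_ray_if_bounded:
  assumes cont: "continuous_on {0..} f"
    and bound: "\<And>x. x \<ge> 0 \<Longrightarrow> integral {0..x} (\<lambda>s. (cmod (f s))\<^sup>2) \<le> B"
  shows "square_integrable_near_infinity f"
proof -
  let ?h = "\<lambda>s. (cmod (f s))\<^sup>2"
  have int: "?h integrable_on {0..x}" for x
    by (intro integrable_continuous_interval continuous_intros continuous_on_subset[OF cont]) auto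
  define h where "h n s = (if s \<in> {0..real n} then ?h s else 0)" for n s
  have hint: "(h n has_integral integral {0..real n} ?h) {0..}" for n
  proof -
    have "(?h has_integral integral {0..real n} ?h) {0..real n}" using int by (rule integrable_integral)
    then show ?thesis unfolding h_def by (subst has_integral_restrict) auto
  qed
  have "?h integrable_on {0..} \<and> (\<lambda>n. integral {0..} (h n)) \<longlonglongrightarrow> integral {0..} ?h"
  proof (rule monotone_convergence_increasing)
    show "h n integrable_on {0..}" for n using hint by blast
    show "h n s \<le> h (Suc n) s" for n s by (auto simp: h_def)
    show "(\<lambda>n. h n s) \<longlonglongrightarrow> ?h s" if "s \<in> {0..}" for s
    proof (rule tendsto_eventually)
      show "\<forall>\<^sub>F n in sequentially. h n s = ?h s"
        using eventually_ge_at_top[of "nat \<lceil>s\<rceil>"]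
      proof eventually_elim
        case (elim n)
        then have "s \<le> real n" by linarith
        then show ?case using that by (simp add: h_def)
      qed
    qed
    have "0 \<le> integral {0..real n} ?h" for n
      using int by (intro Henstock_Kurzweil_Integration.integral_nonneg) auto
    then have "\<bar>integral {0..} (h n)\<bar> \<le> B" for n
      using integral_unique[OF hint] bound[of "real n"] by simp
    then show "bounded (range (\<lambda>n. integral {0..} (h n)))"
      by (auto simp: bounded_iff)
  qed
  then have "set_integrable lebesgue {0..} ?h"
    by (intro nonnegative_absolutely_integrable_1) auto
  moreover have "set_borel_measurable lebesgue {0..} f"
    unfolding set_borel_measurable_def
    by (rule measurable_completion) (use borel_measurable_continuous_on_indicator[OF _ cont] in simp)
  ultimately have "square_integrable {0..} f" unfolding square_integrable_def by blast
  then show ?thesis unfolding square_integrable_near_infinity_def by blast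
qed

lemma half_line_deriv_eq:
  assumes "(f has_vector_derivative f') (at 0 within {0..})"
  shows "half_line_deriv f 0 = f'"
proof -
  have "at (0::real) within {0..} \<noteq> bot" by (simp add: at_within_Ici_at_right)
  then show ?thesis unfolding half_line_deriv_def by (intro vector_derivative_within assms)
qed

lemma half_line_deriv_eq_interval:
  assumes "(f has_vector_derivative f') (at 0 within {0..q})" "q > 0"
  shows "half_line_deriv f 0 = f'"
proof -
  have "at (0::real) within {0..q} = at 0 within {0..}"
    by (rule at_within_nhd[of 0 "{..<q}"]) (use assms(2) in auto)
  then show ?thesis using assms(1) by (intro half_line_deriv_eq) simp
qed

context complex_frame
begin

text \<open>The solutions at energy \<open>\<xi> + w\<close> with the initial data of \<open>\<psi>\<close> and, below, of \<open>cnj \<psi>\<close>.\<close>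

definition uE :: "complex \<Rightarrow> real \<Rightarrow> complex" where
  "uE w = mix (\<lambda>x. E x w) (\<lambda>x. F x w)"

definition uF :: "complex \<Rightarrow> real \<Rightarrow> complex" where
  "uF w = mix (\<lambda>x. cnj (F x (cnj w))) (\<lambda>x. cnj (E x (cnj w)))"

text \<open>Cramer's rule: both coefficients are determinants of pairs of solutions of the system, so they do not
depend on the point and may be evaluated at \<open>p\<close>.\<close>

lemma mix_eq_basis_combination:
  assumes m: "modes w {p..q} al be" and p: "p \<ge> 0" and x: "x \<in> {p..q}"
  shows "mix al be x = (al p * cnj (E p (cnj w)) - cnj (F p (cnj w)) * be p) * uE w x
            + (E p w * be p - al p * F p w) * uF w x"
proof -
  have sub: "{p..q} \<subseteq> {0..}" and x0: "x \<ge> 0" using p x by auto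
  have A: "al x * cnj (E x (cnj w)) - cnj (F x (cnj w)) * be x = al p * cnj (E p (cnj w)) - cnj (F p (cnj w)) * be p"
    by (rule modes_determinant[OF m modes_subset[OF EF_conjugate_modes[of w] sub] x])
  have B: "E x w * be x - al x * F x w = E p w * be p - al p * F p w"
    by (rule modes_determinant[OF modes_subset[OF EF_modes[of w] sub] m x])
  note d = EF_determinant[OF x0, of w]
  have "mix al be x = mix al be x * (E x w * cnj (E x (cnj w)) - cnj (F x (cnj w)) * F x w)"
    unfolding d by simp
  also have "\<dots> = (al x * cnj (E x (cnj w)) - cnj (F x (cnj w)) * be x) * uE w x
      + (E x w * be x - al x * F x w) * uF w x"
    unfolding uE_def uF_def mix_def by (simp add: algebra_simps)
  finally show ?thesis unfolding A B .
qed

lemma general_modes: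
  "modes w {0..} (\<lambda>x. A * E x w + B * cnj (F x (cnj w))) (\<lambda>x. A * F x w + B * cnj (E x (cnj w)))"
  by (rule modes_linear[OF EF_modes EF_conjugate_modes])

lemma mix_general:
  "mix (\<lambda>x. A * E x w + B * cnj (F x (cnj w))) (\<lambda>x. A * F x w + B * cnj (E x (cnj w)))
     = (\<lambda>x. A * uE w x + B * uF w x)"
  by (simp add: mix_def uE_def uF_def fun_eq_iff algebra_simps)

lemma general_solution: "schroedinger_solution V (of_real \<xi> + w) (\<lambda>x. A * uE w x + B * uF w x)"
  using mix_schroedinger_expr[OF general_modes[of w A B]] unfolding mix_general schroedinger_solution_def by simp

text \<open>On every \<open>{0..q}\<close> the solution has coefficients with respect to the basis, and they are determined by
\<open>u(0)\<close> and \<open>u'(0)\<close>; hence they do not depend on \<open>q\<close>.\<close>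

lemma solution_representation:
  assumes "schroedinger_solution V (of_real \<xi> + w) u"
  obtains A B where "\<And>x. x \<ge> 0 \<Longrightarrow> u x = A * uE w x + B * uF w x"
    "u 0 = A * \<psi> 0 + B * cnj (\<psi> 0)"
    "half_line_deriv u 0 = A * d\<psi> 0 + B * cnj (d\<psi> 0)"
proof -
  \<comment> \<open>Cramer's rule for the initial data of \<open>u\<close>.\<close>
  define du where "du = half_line_deriv u 0"
  define A where "A = \<i> * of_real k * (u 0 * cnj (d\<psi> 0) - du * cnj (\<psi> 0))"
  define B where "B = - (\<i> * of_real k * (u 0 * d\<psi> 0 - du * \<psi> 0))"
  have on: "u x = A * uE w x + B * uF w x \<and> u 0 = A * \<psi> 0 + B * cnj (\<psi> 0) \<and> du = A * d\<psi> 0 + B * cnj (d\<psi> 0)"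
    if x: "x \<ge> 0" for x
  proof -
    have "schroedinger_expr V {0..x+1} u (\<lambda>x. (of_real \<xi> + w) * u x)"
      using assms unfolding schroedinger_solution_def by (rule schroedinger_expr_subset) auto
    then obtain al be where m: "modes w {0..x+1} al be" and u: "\<And>t. t \<in> {0..x+1} \<Longrightarrow> u t = mix al be t"
      by (rule solution_has_modes[OF order_refl]) blast
    have u0: "u 0 = al 0 * \<psi> 0 + be 0 * cnj (\<psi> 0)" using u[of 0] x by (simp add: mix_def)
    have "(mix al be has_vector_derivative al 0 * d\<psi> 0 + be 0 * cnj (d\<psi> 0)) (at 0 within {0..x+1})"
      by (rule mix_derivative[OF m]) (use x in auto)
    then have "(u has_vector_derivative al 0 * d\<psi> 0 + be 0 * cnj (d\<psi> 0)) (at 0 within {0..x+1})"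
      by (rule has_vector_derivative_transform[rotated 2]) (use u x in auto)
    then have du: "du = al 0 * d\<psi> 0 + be 0 * cnj (d\<psi> 0)"
      unfolding du_def by (rule half_line_deriv_eq_interval) (use x in simp)
    note W = wronskian_eq[of 0, simplified]
    have "A = - al 0 * (\<i> * of_real k * (cnj (\<psi> 0) * d\<psi> 0 - cnj (d\<psi> 0) * \<psi> 0))"
      unfolding A_def u0 du by (simp add: algebra_simps)
    then have A: "A = al 0" unfolding W k_kappa by simp
    have "B = - be 0 * (\<i> * of_real k * (cnj (\<psi> 0) * d\<psi> 0 - cnj (d\<psi> 0) * \<psi> 0))"
      unfolding B_def u0 du by (simp add: algebra_simps)
    then have B: "B = be 0" unfolding W k_kappa by simp
    have "u x = mix al be x" using u x by simp
    also have "\<dots> = A * uE w x + B * uF w x"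
      using mix_eq_basis_combination[OF m order_refl, of x] x by (simp add: A B)
    finally show ?thesis using u0 du A B by simp
  qed
  have "half_line_deriv u 0 = A * d\<psi> 0 + B * cnj (d\<psi> 0)" using on[of 0] by (simp add: du_def)
  with on on[of 0] show thesis by (intro that[of A B]) auto
qed

lemma limit_circle_if_independent_square_integrable:
  assumes 1: "square_integrable_near_infinity (\<lambda>x. A * uE w x + B * uF w x)"
    and 2: "square_integrable_near_infinity (\<lambda>x. C * uE w x + D * uF w x)"
    and det: "A * D - B * C \<noteq> 0"
  shows "limit_circle_at_infinity V"
  unfolding limit_circle_at_infinity_def
proof (intro exI allI impI)
  fix u assume "schroedinger_solution V (of_real \<xi> + w) u"
  then obtain P Q where PQ: "\<And>x. x \<ge> 0 \<Longrightarrow> u x = P * uE w x + Q * uF w x"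
    using solution_representation by metis
  define d where "d = A * D - B * C"
  have "square_integrable_near_infinity (\<lambda>x. ((P * D - Q * C) / d) * (A * uE w x + B * uF w x)
      + ((Q * A - P * B) / d) * (C * uE w x + D * uF w x))"
    by (rule square_integrable_near_infinity_combination[OF 1 2])
  then show "square_integrable_near_infinity u"
  proof (rule square_integrable_near_infinity_cong)
    fix x :: real assume x: "x \<ge> 0"
    have "d \<noteq> 0" using det d_def by simp
    have "d * u x = (P * D - Q * C) * (A * uE w x + B * uF w x) + (Q * A - P * B) * (C * uE w x + D * uF w x)"
      unfolding PQ[OF x] d_def by (simp add: algebra_simps)
    then have "u x = ((P * D - Q * C) * (A * uE w x + B * uF w x) + (Q * A - P * B) * (C * uE w x + D * uF w x)) / d"
      using \<open>d \<noteq> 0\<close> by (metis nonzero_mult_div_cancel_left)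
    then show "u x = ((P * D - Q * C) / d) * (A * uE w x + B * uF w x)
      + ((Q * A - P * B) / d) * (C * uE w x + D * uF w x)"
      by (simp only: add_divide_distrib times_divide_eq_left)
  qed
qed

text \<open>If \<open>phase\<close> were bounded, then \<open>\<psi>\<close> and \<open>cnj \<psi>\<close>, and with them all solutions at energy \<open>\<xi>\<close>, would be square-integrable.\<close>

lemma phase_at_top:
  assumes lp: "limit_point_at_infinity V"
  shows "filterlim phase at_top at_top"
proof -
  have unb: "\<exists>x\<ge>0. phase x > B" for B
  proof (rule ccontr)
    assume "\<not> (\<exists>x\<ge>0. phase x > B)"
    then have le: "phase x \<le> B" if "x \<ge> 0" for x using that by force
    have 1: "square_integrable_near_infinity \<psi>"
    proof (rule square_integrable_ray_if_bounded[OF psi_continuous])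
      show "integral {0..x} (\<lambda>s. (cmod (\<psi> s))\<^sup>2) \<le> B / k" if "x \<ge> 0" for x
        using le[OF that] k_pos by (simp add: phase_def field_simps)
    qed
    have 2: "square_integrable_near_infinity (\<lambda>x. cnj (\<psi> x))"
    proof (rule square_integrable_ray_if_bounded)
      show "integral {0..x} (\<lambda>s. (cmod (cnj (\<psi> s)))\<^sup>2) \<le> B / k" if "x \<ge> 0" for x
        using le[OF that] k_pos by (simp add: phase_def field_simps)
    qed (intro continuous_intros psi_continuous)
    have "uE 0 = \<psi>" "uF 0 = (\<lambda>x. cnj (\<psi> x))"
      by (simp_all add: uE_def uF_def mix_def fun_eq_iff)
    then have "limit_circle_at_infinity V"
      using limit_circle_if_independent_square_integrable[of 1 0 0 0 1] 1 2 by simp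
    then show False using lp unfolding limit_point_at_infinity_def by simp
  qed
  show ?thesis
    unfolding filterlim_at_top
  proof
    fix B
    obtain x where x: "x \<ge> 0" "phase x > B" using unb by blast
    show "\<forall>\<^sub>F y in at_top. B \<le> phase y"
      using eventually_ge_at_top[of x]
      by eventually_elim (use x phase_mono[of x] in \<open>auto intro: less_imp_le less_le_trans\<close>)
  qed
qed

text \<open>Weyl's nested discs in the coordinate \<open>s = be(0) / al(0)\<close>: \<open>s\<close> lies in the disc of the interval
\<open>{0..x}\<close> when the solution starting from \<open>(1, s)\<close> satisfies \<open>|be| \<le> |al|\<close> at \<open>x\<close>, that is, \<open>Im (cnj u * u') \<ge> 0\<close>
at \<open>x\<close>. Here \<open>s\<close> belongs to all of them.\<close>

definition weyl_disc :: "complex \<Rightarrow> complex \<Rightarrow> bool" where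
  "weyl_disc w s \<longleftrightarrow> (\<forall>x\<ge>0.
     cmod (F x w + s * cnj (E x (cnj w))) \<le> cmod (E x w + s * cnj (F x (cnj w))))"

text \<open>The energy identity bounds \<open>2 k (Im w) \<integral>|u|\<^sup>2\<close> over \<open>{0..x}\<close> by \<open>|al(0)|\<^sup>2 = 1\<close>.\<close>

lemma weyl_disc_square_integrable:
  assumes w: "Im w > 0" and s: "weyl_disc w s"
  shows "square_integrable_near_infinity (\<lambda>x. 1 * uE w x + s * uF w x)"
proof (rule square_integrable_ray_if_bounded)
  let ?al = "\<lambda>x. 1 * E x w + s * cnj (F x (cnj w))" and ?be = "\<lambda>x. 1 * F x w + s * cnj (E x (cnj w))"
  let ?u = "\<lambda>x. 1 * uE w x + s * uF w x"
  have m: "modes w {0..} ?al ?be" by (rule general_modes)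
  show "continuous_on {0..} ?u"
    unfolding mix_general[symmetric] mix_def[abs_def]
    by (intro continuous_intros modes_continuous_on[OF m] psi_continuous)
  show "integral {0..x} (\<lambda>t. (cmod (?u t))\<^sup>2) \<le> 1 / (2 * k * Im w)" if x: "x \<ge> 0" for x
  proof -
    have "((\<lambda>t. - (2 * k * Im w * (cmod (?u t))\<^sup>2)) has_integral
       ((cmod (?al x))\<^sup>2 - (cmod (?be x))\<^sup>2) - ((cmod (?al 0))\<^sup>2 - (cmod (?be 0))\<^sup>2)) {0..x}"
      using modes_energy_identity[OF modes_subset[OF m] x] unfolding mix_general by auto
    then have "((\<lambda>t. - (1 / (2 * k * Im w)) * - (2 * k * Im w * (cmod (?u t))\<^sup>2)) has_integral
       - (1 / (2 * k * Im w)) * (((cmod (?al x))\<^sup>2 - (cmod (?be x))\<^sup>2) - ((cmod (?al 0))\<^sup>2 - (cmod (?be 0))\<^sup>2))) {0..x}"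
      by (rule has_integral_mult_right)
    then have "integral {0..x} (\<lambda>t. (cmod (?u t))\<^sup>2)
       = - (1 / (2 * k * Im w)) * (((cmod (?al x))\<^sup>2 - (cmod (?be x))\<^sup>2) - ((cmod (?al 0))\<^sup>2 - (cmod (?be 0))\<^sup>2))"
      using k_pos w by (intro integral_unique) simp
    also have "\<dots> = (((cmod (?al 0))\<^sup>2 - (cmod (?be 0))\<^sup>2) - ((cmod (?al x))\<^sup>2 - (cmod (?be x))\<^sup>2)) / (2 * k * Im w)"
      by (simp add: divide_simps)
    also have "\<dots> \<le> 1 / (2 * k * Im w)"
    proof (rule divide_right_mono)
      have "(cmod (?be x))\<^sup>2 \<le> (cmod (?al x))\<^sup>2"
        using s x unfolding weyl_disc_def by (intro power_mono) auto
      moreover have "(cmod (?al 0))\<^sup>2 - (cmod (?be 0))\<^sup>2 \<le> 1" by simp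
      ultimately show "((cmod (?al 0))\<^sup>2 - (cmod (?be 0))\<^sup>2) - ((cmod (?al x))\<^sup>2 - (cmod (?be x))\<^sup>2) \<le> 1"
        by linarith
    qed (use k_pos w in simp)
    finally show ?thesis .
  qed
qed

text \<open>In the limit point case the square-integrable solutions form a line, so the Weyl solution is the one
that starts from \<open>(1, s)\<close>.\<close>

lemma weyl_m_eq:
  assumes lp: "limit_point_at_infinity V" and w: "Im w > 0" and s: "weyl_disc w s"
  shows "weyl_m V (of_real \<xi> + w) = (d\<psi> 0 + s * cnj (d\<psi> 0)) / (\<psi> 0 + s * cnj (\<psi> 0))"
  unfolding weyl_m_def
proof (rule the_equality)
  let ?u = "\<lambda>x. 1 * uE w x + s * uF w x"
  have sol: "schroedinger_solution V (of_real \<xi> + w) ?u" by (rule general_solution)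
  have L2: "square_integrable_near_infinity ?u" by (rule weyl_disc_square_integrable[OF w s])
  have m: "modes w {0..} (\<lambda>x. 1 * E x w + s * cnj (F x (cnj w))) (\<lambda>x. 1 * F x w + s * cnj (E x (cnj w)))"
    by (rule general_modes)
  have "(?u has_vector_derivative (1 * d\<psi> 0 + s * cnj (d\<psi> 0))) (at 0 within {0..1})"
    using mix_derivative[OF modes_subset[OF m, of "{0..1}"], of 0] unfolding mix_general by auto
  then have d: "half_line_deriv ?u 0 = d\<psi> 0 + s * cnj (d\<psi> 0)"
    by (intro half_line_deriv_eq_interval[of _ _ 1]) auto
  have u0: "?u 0 = \<psi> 0 + s * cnj (\<psi> 0)" by (simp add: uE_def uF_def mix_def)
  have nt: "nontrivial_on {0..} ?u"
  proof (rule ccontr)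
    assume "\<not> nontrivial_on {0..} ?u"
    then have z: "?u x = 0" if "x \<ge> 0" for x using that unfolding nontrivial_on_def by auto
    have "(?u has_vector_derivative 0) (at 0 within {0..1})"
      by (rule has_vector_derivative_transform[of _ _ _ "\<lambda>_. 0"]) (use z in auto)
    then have "half_line_deriv ?u 0 = 0" by (intro half_line_deriv_eq_interval[of _ _ 1]) auto
    then have e: "d\<psi> 0 + s * cnj (d\<psi> 0) = 0" "\<psi> 0 + s * cnj (\<psi> 0) = 0"
      using d u0 z[of 0] by auto
    have "cnj (\<psi> 0) * d\<psi> 0 - cnj (d\<psi> 0) * \<psi> 0
       = cnj (\<psi> 0) * (d\<psi> 0 + s * cnj (d\<psi> 0)) - cnj (d\<psi> 0) * (\<psi> 0 + s * cnj (\<psi> 0))"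
      by (simp add: algebra_simps)
    then show False using e wronskian_eq[of 0] kappa_pos by simp
  qed
  show "\<exists>u. schroedinger_solution V (of_real \<xi> + w) u \<and> nontrivial_on {0..} u \<and>
      square_integrable_near_infinity u \<and>
      (d\<psi> 0 + s * cnj (d\<psi> 0)) / (\<psi> 0 + s * cnj (\<psi> 0)) = half_line_deriv u 0 / u 0"
    using sol nt L2 d u0 by (intro exI[of _ ?u]) simp
  fix m assume "\<exists>u. schroedinger_solution V (of_real \<xi> + w) u \<and> nontrivial_on {0..} u \<and>
      square_integrable_near_infinity u \<and> m = half_line_deriv u 0 / u 0"
  then obtain u where u: "schroedinger_solution V (of_real \<xi> + w) u" "nontrivial_on {0..} u"
      "square_integrable_near_infinity u" "m = half_line_deriv u 0 / u 0" by blast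
  obtain A B where AB: "\<And>x. x \<ge> 0 \<Longrightarrow> u x = A * uE w x + B * uF w x"
    "u 0 = A * \<psi> 0 + B * cnj (\<psi> 0)" "half_line_deriv u 0 = A * d\<psi> 0 + B * cnj (d\<psi> 0)"
    using solution_representation[OF u(1)] by blast
  have "square_integrable_near_infinity (\<lambda>x. A * uE w x + B * uF w x)"
    by (rule square_integrable_near_infinity_cong[OF u(3)]) (simp add: AB(1))
  then have "1 * B - s * A = 0"
    using limit_circle_if_independent_square_integrable[OF L2] lp
    unfolding limit_point_at_infinity_def by blast
  then have B: "B = A * s" by (simp add: algebra_simps)
  have "A \<noteq> 0" using u(2) AB(1) B unfolding nontrivial_on_def by auto
  have "u 0 = A * (\<psi> 0 + s * cnj (\<psi> 0))" "half_line_deriv u 0 = A * (d\<psi> 0 + s * cnj (d\<psi> 0))"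
    using AB(2,3) B by (simp_all add: algebra_simps)
  then show "m = (d\<psi> 0 + s * cnj (d\<psi> 0)) / (\<psi> 0 + s * cnj (\<psi> 0))"
    using u(4) \<open>A \<noteq> 0\<close> by simp
qed

lemma EF_conjugate_holomorphic:
  assumes "x \<ge> 0" "open S"
  shows "(\<lambda>w. cnj (E x (cnj w))) holomorphic_on S" "(\<lambda>w. cnj (F x (cnj w))) holomorphic_on S"
  using holomorphic_on_compose_cnj_cnj[OF EF_holomorphic(1)[OF assms(1)] assms(2)]
    holomorphic_on_compose_cnj_cnj[OF EF_holomorphic(2)[OF assms(1)] assms(2)]
  by (simp_all add: o_def)

text \<open>Take the solution with \<open>be = 0\<close> at \<open>x = n\<close>. Its coordinate \<open>s\<^sub>n\<close> is holomorphic in \<open>w\<close>, bounded by \<open>1\<close>, and lies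
in the discs of all \<open>{0..x}\<close> with \<open>x \<le> n\<close>, because \<open>|al|\<^sup>2 - |be|\<^sup>2\<close> decreases. By Montel's theorem a
subsequence converges, and the limit is in all discs.\<close>

lemma weyl_disc_section:
  obtains S where "S holomorphic_on {w. Im w > 0}"
    "\<And>w. Im w > 0 \<Longrightarrow> cmod (S w) \<le> 1" "\<And>w. Im w > 0 \<Longrightarrow> weyl_disc w (S w)"
proof -
  define H where "H = {w::complex. Im w > 0}"
  have H: "open H" unfolding H_def by (rule open_halfspace_Im_gt)
  \<comment> \<open>The initial value \<open>(1, s n w)\<close> of the solution with \<open>be = 0\<close> at \<open>n\<close>.\<close>
  define s where "s n w = - F (real n) w / cnj (E (real n) (cnj w))" for n w
  have nz: "E (real n) (cnj w) \<noteq> 0" if "w \<in> H" for n w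
  proof
    assume "E (real n) (cnj w) = 0"
    then have "1 \<le> - (cmod (F (real n) (cnj w)))\<^sup>2"
      using EF_lower_half_plane[of "real n" "cnj w"] that by (simp add: H_def)
    then show False using zero_le_power2[of "cmod (F (real n) (cnj w))"] by linarith
  qed
  have en: "(cmod (E x w + s n w * cnj (F x (cnj w))))\<^sup>2 - (cmod (F x w + s n w * cnj (E x (cnj w))))\<^sup>2 \<ge> 0"
    if w: "w \<in> H" and x: "0 \<le> x" "x \<le> real n" for n w x
  proof -
    have m: "modes w {0..} (\<lambda>x. 1 * E x w + s n w * cnj (F x (cnj w))) (\<lambda>x. 1 * F x w + s n w * cnj (E x (cnj w)))"
      by (rule general_modes)
    have "F (real n) w + s n w * cnj (E (real n) (cnj w)) = 0"
      using nz[OF w] by (simp add: s_def)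
    moreover have "{x..real n} \<subseteq> {0..}" "0 \<le> Im w" using x(1) w by (auto simp: H_def)
    note modes_energy_decreasing[OF modes_subset[OF m this(1)] x(2) this(2)]
    ultimately show ?thesis
      using zero_le_power2[of "cmod (E (real n) w + s n w * cnj (F (real n) (cnj w)))"]
      by (simp only: mult_1 norm_zero zero_power2)
  qed
  have s1: "cmod (s n w) \<le> 1" if "w \<in> H" for n w
    using en[OF that, of 0 n] by (simp add: power2_le_iff_abs_le abs_square_le_1)
  have hol: "s n holomorphic_on H" for n
    unfolding s_def[abs_def] using nz
    by (intro holomorphic_intros EF_holomorphic EF_conjugate_holomorphic H) auto
  obtain S r where S: "S holomorphic_on H" "strict_mono (r :: nat \<Rightarrow> nat)"
      "\<And>w. w \<in> H \<Longrightarrow> (\<lambda>n. s (r n) w) \<longlonglongrightarrow> S w"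
  proof (rule Montel[OF H, of "range s" s])
    show "h holomorphic_on H" if "h \<in> range s" for h using that hol by auto
    show "\<exists>B. \<forall>h\<in>range s. \<forall>z\<in>K. cmod (h z) \<le> B" if "compact K" "K \<subseteq> H" for K
      using s1 that by (intro exI[of _ 1]) auto
  qed auto
  show thesis
  proof (rule that[of S])
    show "S holomorphic_on {w. Im w > 0}" using S(1) H_def by simp
    fix w :: complex assume "Im w > 0"
    then have w: "w \<in> H" by (simp add: H_def)
    show "cmod (S w) \<le> 1"
      by (rule LIMSEQ_le_const2[OF tendsto_norm[OF S(3)[OF w]]]) (use s1[OF w] in auto)
    show "weyl_disc w (S w)"
      unfolding weyl_disc_def
    proof (intro allI impI)
      fix x :: real assume x: "x \<ge> 0"
      show "cmod (F x w + S w * cnj (E x (cnj w))) \<le> cmod (E x w + S w * cnj (F x (cnj w)))"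
      proof (rule LIMSEQ_le)
        show "(\<lambda>n. cmod (F x w + s (r n) w * cnj (E x (cnj w)))) \<longlonglongrightarrow> cmod (F x w + S w * cnj (E x (cnj w)))"
          "(\<lambda>n. cmod (E x w + s (r n) w * cnj (F x (cnj w)))) \<longlonglongrightarrow> cmod (E x w + S w * cnj (F x (cnj w)))"
          by (intro tendsto_intros S(3) w)+
        show "\<exists>N. \<forall>n\<ge>N. cmod (F x w + s (r n) w * cnj (E x (cnj w))) \<le> cmod (E x w + s (r n) w * cnj (F x (cnj w)))"
        proof (intro exI[of _ "nat \<lceil>x\<rceil>"] allI impI)
          fix n assume "n \<ge> nat \<lceil>x\<rceil>"
          then have "x \<le> real (r n)" using seq_suble[OF S(2), of n] by linarith
          from en[OF w x this] show "cmod (F x w + s (r n) w * cnj (E x (cnj w))) \<le> cmod (E x w + s (r n) w * cnj (F x (cnj w)))"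
            by (simp add: power_mono_iff)
        qed
      qed
    qed
  qed
qed

text \<open>Solving the formula for the Weyl function \<open>m\<close> in terms of \<open>s\<close> gives \<open>|s| = |m - \<eta>| / |m - cnj \<eta>|\<close>.\<close>

lemma weyl_section_tendsto_0:
  assumes lp: "limit_point_at_infinity V"
    and lim: "((\<lambda>y::real. weyl_m V (Complex \<xi> y)) \<longlongrightarrow> \<eta>) (at_right 0)"
    and eta: "Im \<eta> > 0" and d0: "d\<psi> 0 = \<eta> * \<psi> 0"
    and S: "\<And>w. Im w > 0 \<Longrightarrow> weyl_disc w (S w)"
  shows "((\<lambda>y::real. S (\<i> * of_real y)) \<longlongrightarrow> 0) (at_right 0)"
proof -
  let ?m = "\<lambda>y::real. weyl_m V (Complex \<xi> y)"
  have nz: "\<eta> - cnj \<eta> \<noteq> 0" "\<eta> \<noteq> 0" using eta by (auto simp: complex_eq_iff)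
  \<comment> \<open>Eventually \<open>?m y \<noteq> 0\<close>, as \<open>\<eta> \<noteq> 0\<close>; so the quotient defining \<open>?m y\<close> is not a division by zero.\<close>
  have ev: "\<forall>\<^sub>F y in at_right 0. S (\<i> * of_real y) = - (\<psi> 0 / cnj (\<psi> 0)) * ((?m y - \<eta>) / (?m y - cnj \<eta>))"
  proof -
    have "\<forall>\<^sub>F y in at_right 0. ?m y - cnj \<eta> \<noteq> 0"
      by (rule tendsto_imp_eventually_ne[OF tendsto_diff[OF lim tendsto_const] nz(1)])
    moreover have "\<forall>\<^sub>F y in at_right 0. ?m y \<noteq> 0"
      by (rule tendsto_imp_eventually_ne[OF lim nz(2)])
    moreover have "\<forall>\<^sub>F y::real in at_right 0. y > 0" by (simp add: eventually_at_right_less)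
    ultimately show ?thesis
    proof eventually_elim
      case (elim y)
      define s where "s = S (\<i> * of_real y)"
      have "of_real \<xi> + \<i> * of_real y = Complex \<xi> y" by (simp add: complex_eq_iff)
      then have m: "?m y = (d\<psi> 0 + s * cnj (d\<psi> 0)) / (\<psi> 0 + s * cnj (\<psi> 0))"
        using weyl_m_eq[OF lp _ S, of "\<i> * of_real y"] elim(3) by (simp add: s_def)
      then have "\<psi> 0 + s * cnj (\<psi> 0) \<noteq> 0" using elim(2) by auto
      then have "?m y * (\<psi> 0 + s * cnj (\<psi> 0)) = \<eta> * \<psi> 0 + s * cnj (\<eta> * \<psi> 0)"
        unfolding m d0 by simp
      then have "s * cnj (\<psi> 0) * (?m y - cnj \<eta>) = - \<psi> 0 * (?m y - \<eta>)"
        by (simp add: algebra_simps)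
      then show ?case
        using elim(1) psi_nonzero[of 0] unfolding s_def[symmetric] by (simp add: field_simps)
    qed
  qed
  have "((\<lambda>y. - (\<psi> 0 / cnj (\<psi> 0)) * ((?m y - \<eta>) / (?m y - cnj \<eta>))) \<longlongrightarrow>
      - (\<psi> 0 / cnj (\<psi> 0)) * ((\<eta> - \<eta>) / (\<eta> - cnj \<eta>))) (at_right 0)"
    by (intro tendsto_mult tendsto_const tendsto_divide tendsto_diff lim nz(1))
  then show ?thesis using ev by (subst tendsto_cong[OF ev]) simp
qed

end


section \<open>Rotation in the scaling limit\<close>

lemma Montel_subsequence:
  fixes f :: "nat \<Rightarrow> complex \<Rightarrow> complex"
  assumes "open S" and hol: "\<And>n. f n holomorphic_on S"
    and B: "continuous_on S B" "\<And>n z. z \<in> S \<Longrightarrow> cmod (f n z) \<le> B z"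
  obtains g r where "g holomorphic_on S" "strict_mono (r :: nat \<Rightarrow> nat)"
    "\<And>z. z \<in> S \<Longrightarrow> (\<lambda>n. f (r n) z) \<longlonglongrightarrow> g z"
    "\<And>K. compact K \<Longrightarrow> K \<subseteq> S \<Longrightarrow> uniform_limit K (f \<circ> r) g sequentially"
proof (rule Montel[OF \<open>open S\<close>, of "range f" f])
  show "h holomorphic_on S" if "h \<in> range f" for h using that hol by auto
  show "\<exists>C. \<forall>h\<in>range f. \<forall>z\<in>K. cmod (h z) \<le> C" if K: "compact K" "K \<subseteq> S" for K
  proof -
    have "bounded (B ` K)"
      using K B(1) by (intro compact_imp_bounded compact_continuous_image) (auto intro: continuous_on_subset)
    then obtain C where C: "\<And>z. z \<in> K \<Longrightarrow> \<bar>B z\<bar> \<le> C" unfolding bounded_iff by auto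
    have "cmod (f n z) \<le> C" if "z \<in> K" for n z
      using B(2)[of z n] C[OF that] K(2) that by force
    then show ?thesis by blast
  qed
  fix g r assume "g holomorphic_on S" "strict_mono (r :: nat \<Rightarrow> nat)"
    "\<And>z. z \<in> S \<Longrightarrow> (\<lambda>n. f (r n) z) \<longlonglongrightarrow> g z"
    "\<And>K. compact K \<Longrightarrow> K \<subseteq> S \<Longrightarrow> uniform_limit K (f \<circ> r) g sequentially"
  then show thesis by (rule that)
qed auto

text \<open>This is where a limit along the normal becomes a statement about the whole half-plane.\<close>

lemma holomorphic_zero_on_imaginary_axis:
  assumes g: "g holomorphic_on {z. Im z > 0}"
    and z: "\<And>y. y > 0 \<Longrightarrow> g (\<i> * of_real y) = 0" and w: "Im w > 0"
  shows "g w = 0"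
proof (rule analytic_continuation[OF g, of "(\<lambda>y. \<i> * of_real y) ` {0<..}" \<i>])
  let ?U = "(\<lambda>y. \<i> * of_real y) ` {0::real<..}"
  show "open {z. Im z > 0}" by (rule open_halfspace_Im_gt)
  show "connected {z. Im z > 0}" by (intro convex_connected convex_halfspace_Im_gt)
  have 1: "\<i> \<in> ?U" by (auto intro: image_eqI[of _ _ 1])
  have 2: "\<i> * of_real 2 \<in> ?U" by (rule imageI) simp
  have "\<i> * of_real 2 \<noteq> \<i>" by (simp add: complex_eq_iff)
  with 1 2 have "\<nexists>x. ?U = {x}" by (metis singletonD)
  moreover have "connected ?U" by (intro connected_continuous_image continuous_intros) auto
  ultimately show "\<i> islimpt ?U" using 1 connected_imp_perfect by blast
qed (use z w in auto)

context complex_frame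
begin

lemma scaled_solution_bound:
  assumes x: "0 \<le> x" "x \<le> b" and b: "phase b > 0"
  shows "cmod (E x (\<zeta> / of_real (phase b))) \<le> exp (2 * cmod \<zeta>)"
    "cmod (F x (\<zeta> / of_real (phase b))) \<le> exp (2 * cmod \<zeta>)"
proof -
  have "2 * phase x * cmod (\<zeta> / of_real (phase b)) = 2 * (phase x / phase b) * cmod \<zeta>"
    using b by (simp add: norm_divide)
  also have "\<dots> \<le> 2 * 1 * cmod \<zeta>"
    using phase_mono[OF x] b by (intro mult_right_mono mult_left_mono) auto
  finally have le: "exp (2 * phase x * cmod (\<zeta> / of_real (phase b))) \<le> exp (2 * cmod \<zeta>)" by simp
  show "cmod (E x (\<zeta> / of_real (phase b))) \<le> exp (2 * cmod \<zeta>)"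
    "cmod (F x (\<zeta> / of_real (phase b))) \<le> exp (2 * cmod \<zeta>)"
    using EF_bound[OF x(1), of "\<zeta> / of_real (phase b)"] le by (blast intro: order_trans)+
qed

text \<open>The rigidity argument: in the scaling limit the solution matrix becomes diagonal. If the claim failed,
Montel's theorem would produce entire limits of \<open>E\<close> and \<open>F\<close> along a subsequence of counterexamples, with
\<open>|F| \<le> |E|\<close> on the whole plane; Liouville's theorem then makes the limit of \<open>F\<close> vanish.\<close>

lemma F_uniformly_small:
  assumes top: "filterlim phase at_top at_top"
    and S: "S holomorphic_on {w. Im w > 0}" "\<And>w. Im w > 0 \<Longrightarrow> cmod (S w) \<le> 1"
      "\<And>w. Im w > 0 \<Longrightarrow> weyl_disc w (S w)"
    and S0: "((\<lambda>y::real. S (\<i> * of_real y)) \<longlongrightarrow> 0) (at_right 0)"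
    and e: "e > 0"
  shows "\<forall>\<^sub>F b in at_top. \<forall>x\<in>{0..b}. \<forall>\<zeta>\<in>cball 0 R. cmod (F x (\<zeta> / of_real (phase b))) < e"
proof (rule ccontr)
  assume neg: "\<not> ?thesis"
  define H where "H = {w::complex. Im w > 0}"
  have H: "open H" unfolding H_def by (rule open_halfspace_Im_gt)
  have "\<exists>b. b \<ge> real n \<and> phase b \<ge> 1 \<and> (\<exists>x\<in>{0..b}. \<exists>\<zeta>\<in>cball 0 R. \<not> cmod (F x (\<zeta> / of_real (phase b))) < e)" for n
  proof (rule ccontr)
    assume none: "\<nexists>b. b \<ge> real n \<and> phase b \<ge> 1 \<and> (\<exists>x\<in>{0..b}. \<exists>\<zeta>\<in>cball 0 R. \<not> cmod (F x (\<zeta> / of_real (phase b))) < e)"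
    have "\<forall>\<^sub>F b in at_top. phase b \<ge> 1" using top by (simp add: filterlim_at_top)
    then have "\<forall>\<^sub>F b in at_top. \<forall>x\<in>{0..b}. \<forall>\<zeta>\<in>cball 0 R. cmod (F x (\<zeta> / of_real (phase b))) < e"
      using eventually_ge_at_top[of "real n"] by eventually_elim (use none in blast)
    with neg show False by contradiction
  qed
  \<comment> \<open>Counterexamples \<open>F (x n) (\<zeta> n / phase (b n))\<close> with \<open>b n \<rightarrow> \<infinity>\<close>; both \<open>x n\<close> and \<open>\<zeta> n\<close> may vary.\<close>
  then obtain b x \<zeta> where b: "\<And>n. b n \<ge> real n" "\<And>n. phase (b n) \<ge> 1"
    and x: "\<And>n. x n \<in> {0..b n}" and \<zeta>: "\<And>n. \<zeta> n \<in> cball 0 R"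
    and large: "\<And>n. \<not> cmod (F (x n) (\<zeta> n / of_real (phase (b n)))) < e"
    by metis
  define \<rho> where "\<rho> n = phase (b n)" for n
  have \<rho>: "\<rho> n > 0" for n using b(2)[of n] by (simp add: \<rho>_def)
  have btop: "filterlim b at_top sequentially"
    by (rule filterlim_at_top_mono[OF filterlim_real_sequentially]) (use b(1) in auto)
  have \<rho>top: "filterlim \<rho> at_top sequentially"
    unfolding \<rho>_def[abs_def] using filterlim_compose[OF top btop] .
  \<comment> \<open>The scaled functions: \<open>f\<close>, \<open>g\<close> and \<open>s\<close> stand for \<open>F\<close>, \<open>E\<close> and \<open>S\<close>.\<close>
  define f where "f n z = F (x n) (z / of_real (\<rho> n))" for n z
  define g where "g n z = E (x n) (z / of_real (\<rho> n))" for n z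
  define s where "s n z = S (z / of_real (\<rho> n))" for n z
  have x0: "x n \<ge> 0" for n using x[of n] by simp
  have scale: "(\<lambda>z. z / of_real (\<rho> n)) holomorphic_on T" for n T
    using \<rho>[of n] by (intro holomorphic_intros) auto
  have hol: "f n holomorphic_on UNIV" "g n holomorphic_on UNIV" for n
    unfolding f_def[abs_def] g_def[abs_def]
    using holomorphic_on_compose[OF scale EF_holomorphic(1)[OF x0]]
      holomorphic_on_compose[OF scale EF_holomorphic(2)[OF x0]] by (simp_all add: o_def)
  have hols: "s n holomorphic_on H" for n
  proof -
    have "(\<lambda>z. z / of_real (\<rho> n)) ` H \<subseteq> {w. Im w > 0}" using \<rho>[of n] by (auto simp: H_def)
    from holomorphic_on_compose_gen[OF scale S(1) this] show ?thesis
      by (simp add: s_def[abs_def] o_def)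
  qed
  have bnd: "cmod (g n z) \<le> exp (2 * cmod z)" "cmod (f n z) \<le> exp (2 * cmod z)" for n z
    using scaled_solution_bound[OF _ _ \<rho>[of n, unfolded \<rho>_def], of "x n" z] x[of n]
    by (auto simp: f_def g_def \<rho>_def)
  have cont: "continuous_on UNIV (\<lambda>z::complex. exp (2 * cmod z))" by (intro continuous_intros)
  obtain g' r1 where g': "g' holomorphic_on UNIV" "strict_mono r1" "\<And>z. (\<lambda>n. g (r1 n) z) \<longlonglongrightarrow> g' z"
    by (rule Montel_subsequence[of UNIV g, OF _ hol(2) cont bnd(1)]) auto
  obtain f' r2 where f': "f' holomorphic_on UNIV" "strict_mono r2" "\<And>z. (\<lambda>n. f (r1 (r2 n)) z) \<longlonglongrightarrow> f' z"
     "\<And>K. compact K \<Longrightarrow> uniform_limit K (\<lambda>n. f (r1 (r2 n))) f' sequentially"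
    by (rule Montel_subsequence[of UNIV "\<lambda>n. f (r1 n)", OF _ hol(1) cont bnd(2)]) (auto simp: o_def)
  have bnds: "cmod (s n z) \<le> 1" if "z \<in> H" for n z
    using S(2)[of "z / of_real (\<rho> n)"] that \<rho>[of n] by (simp add: s_def H_def)
  obtain s' r3 where s': "s' holomorphic_on H" "strict_mono r3" "\<And>z. z \<in> H \<Longrightarrow> (\<lambda>n. s (r1 (r2 (r3 n))) z) \<longlonglongrightarrow> s' z"
    by (rule Montel_subsequence[of H "\<lambda>n. s (r1 (r2 n))", OF H hols continuous_on_const bnds]) auto
  define r where "r n = r1 (r2 (r3 n))" for n
  have r: "strict_mono r" unfolding r_def[abs_def]
    using g'(2) f'(2) s'(2) by (simp add: strict_mono_def)
  have flim: "(\<lambda>n. f (r n) z) \<longlonglongrightarrow> f' z" and glim: "(\<lambda>n. g (r n) z) \<longlonglongrightarrow> g' z" for z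
    using LIMSEQ_subseq_LIMSEQ[OF f'(3) s'(2)] LIMSEQ_subseq_LIMSEQ[OF LIMSEQ_subseq_LIMSEQ[OF g'(3) f'(2)] s'(2)]
    by (simp_all add: r_def o_def)
  have slim: "(\<lambda>n. s (r n) z) \<longlonglongrightarrow> s' z" if "z \<in> H" for z
    using s'(3)[OF that] by (simp add: r_def)
  \<comment> \<open>On the imaginary axis the scaled arguments approach \<open>0\<close> along the normal.\<close>
  have s'0: "s' z = 0" if "z \<in> H" for z
  proof (rule holomorphic_zero_on_imaginary_axis[where g = s' and w = z])
    show "s' holomorphic_on {z. Im z > 0}" "Im z > 0" using s'(1) that by (auto simp: H_def)
    fix y :: real assume y: "y > 0"
    have "filterlim (\<lambda>n. y / \<rho> (r n)) (at_right 0) sequentially"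
    proof (rule tendsto_imp_filterlim_at_right)
      have "filterlim (\<lambda>n. \<rho> (r n)) at_top sequentially"
        using filterlim_compose[OF \<rho>top filterlim_subseq[OF r]] .
      then show "(\<lambda>n. y / \<rho> (r n)) \<longlonglongrightarrow> 0"
        by (intro tendsto_divide_0[OF tendsto_const] filterlim_at_top_imp_at_infinity)
    qed (use y \<rho> in auto)
    from filterlim_compose[OF S0 this]
    have "(\<lambda>n. s (r n) (\<i> * of_real y)) \<longlonglongrightarrow> 0" by (simp add: s_def)
    with slim[of "\<i> * of_real y"] y show "s' (\<i> * of_real y) = 0"
      by (auto simp: H_def intro: LIMSEQ_unique)
  qed
  \<comment> \<open>Upper half-plane: Weyl discs; closed lower half-plane: monotonicity of \<open>|E|\<^sup>2 - |F|\<^sup>2\<close>.\<close>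
  have le: "cmod (f' z) \<le> cmod (g' z)" for z
  proof (cases "Im z > 0")
    case True
    then have z: "z \<in> H" by (simp add: H_def)
    have sl: "(\<lambda>n. s (r n) z) \<longlonglongrightarrow> 0" using slim[OF z] s'0[OF z] by simp
    show ?thesis
    proof (rule LIMSEQ_le)
      have "(\<lambda>n. cmod (f (r n) z + s (r n) z * cnj (g (r n) (cnj z)))) \<longlonglongrightarrow> cmod (f' z + 0 * cnj (g' (cnj z)))"
        by (intro tendsto_intros flim glim sl)
      then show "(\<lambda>n. cmod (f (r n) z + s (r n) z * cnj (g (r n) (cnj z)))) \<longlonglongrightarrow> cmod (f' z)" by simp
      have "(\<lambda>n. cmod (g (r n) z + s (r n) z * cnj (f (r n) (cnj z)))) \<longlonglongrightarrow> cmod (g' z + 0 * cnj (f' (cnj z)))"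
        by (intro tendsto_intros flim glim sl)
      then show "(\<lambda>n. cmod (g (r n) z + s (r n) z * cnj (f (r n) (cnj z)))) \<longlonglongrightarrow> cmod (g' z)" by simp
      show "\<exists>N. \<forall>n\<ge>N. cmod (f (r n) z + s (r n) z * cnj (g (r n) (cnj z)))
             \<le> cmod (g (r n) z + s (r n) z * cnj (f (r n) (cnj z)))"
      proof (intro exI allI impI)
        fix n
        have "Im (z / of_real (\<rho> (r n))) > 0" using True \<rho> by simp
        from S(3)[OF this] x0[of "r n"]
        show "cmod (f (r n) z + s (r n) z * cnj (g (r n) (cnj z)))
             \<le> cmod (g (r n) z + s (r n) z * cnj (f (r n) (cnj z)))"
          by (simp add: weyl_disc_def f_def g_def s_def)
      qed
    qed
  next
    case False
    show ?thesis
    proof (rule LIMSEQ_le[OF tendsto_norm[OF flim] tendsto_norm[OF glim]], intro exI allI impI)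
      fix n
      have "Im (z / of_real (\<rho> (r n))) \<le> 0"
        using False \<rho>[of "r n"] by (simp add: divide_nonpos_pos)
      from EF_lower_half_plane[OF x0 this, of "r n"]
      have "(cmod (f (r n) z))\<^sup>2 \<le> (cmod (g (r n) z))\<^sup>2" unfolding f_def g_def by linarith
      then show "cmod (f (r n) z) \<le> cmod (g (r n) z)" by (simp add: power_mono_iff)
    qed
  qed
  have det: "g' z * cnj (g' (cnj z)) - cnj (f' (cnj z)) * f' z = 1" for z
  proof (rule LIMSEQ_unique)
    show "(\<lambda>n. g (r n) z * cnj (g (r n) (cnj z)) - cnj (f (r n) (cnj z)) * f (r n) z)
        \<longlonglongrightarrow> g' z * cnj (g' (cnj z)) - cnj (f' (cnj z)) * f' z"
      by (intro tendsto_intros flim glim)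
    show "(\<lambda>n. g (r n) z * cnj (g (r n) (cnj z)) - cnj (f (r n) (cnj z)) * f (r n) z) \<longlonglongrightarrow> 1"
    proof (rule tendsto_eventually, rule always_eventually, rule allI)
      fix n
      show "g (r n) z * cnj (g (r n) (cnj z)) - cnj (f (r n) (cnj z)) * f (r n) z = 1"
        using EF_determinant[OF x0[of "r n"], of "z / of_real (\<rho> (r n))"]
        by (simp add: f_def g_def)
    qed
  qed
  have nz: "g' z \<noteq> 0" for z
  proof
    assume "g' z = 0"
    moreover from this have "f' z = 0" using le[of z] by simp
    ultimately show False using det[of z] by simp
  qed
  have "(\<lambda>z. f' z / g' z) constant_on UNIV"
  proof (rule Liouville_theorem)
    show "(\<lambda>z. f' z / g' z) holomorphic_on UNIV" using f'(1) g'(1) nz by (intro holomorphic_intros) auto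
    have "cmod (f' z / g' z) \<le> 1" for z using le[of z] nz[of z] by (simp add: norm_divide)
    then show "bounded (range (\<lambda>z. f' z / g' z))" by (auto simp: bounded_iff)
  qed
  then have const: "f' z / g' z = f' 0 / g' 0" for z unfolding constant_on_def by auto
  have "(\<lambda>n. f (r n) 0) \<longlonglongrightarrow> 0" by (simp add: f_def)
  then have "f' 0 = 0" using flim[of 0] LIMSEQ_unique by blast
  then have f'0: "f' z = 0" for z using const[of z] nz[of z] by simp
  have "\<forall>\<^sub>F n in sequentially. \<forall>z\<in>cball 0 R. dist (f (r1 (r2 n)) z) (f' z) < e"
    using uniform_limitD[OF f'(4)[of "cball 0 R"] e] by simp
  then obtain n where "\<forall>z\<in>cball 0 R. dist (f (r1 (r2 n)) z) (f' z) < e"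
    using eventually_happens'[OF sequentially_bot] by blast
  then have "cmod (f (r1 (r2 n)) (\<zeta> (r1 (r2 n)))) < e" using \<zeta> by (simp add: f'0)
  then show False using large[of "r1 (r2 n)"] by (simp add: f_def \<rho>_def)
qed

text \<open>The deviation of \<open>uE w x\<close> from \<open>\<psi> x * exp (\<i> w phase(x))\<close>, see \<open>uE_eq_ratio\<close>.\<close>

definition ratio :: "real \<Rightarrow> complex \<Rightarrow> complex" where
  "ratio x w = (E x w + F x w * (cnj (\<psi> x) / \<psi> x)) * exp (- (\<i> * w * of_real (phase x)))"

lemma uE_eq_ratio:
  assumes "x \<ge> 0"
  shows "uE w x = \<psi> x * exp (\<i> * w * of_real (phase x)) * ratio x w"
proof -
  have "\<psi> x * exp (\<i> * w * of_real (phase x)) * ratio x w =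
    (E x w * \<psi> x + F x w * cnj (\<psi> x)) * (exp (\<i> * w * of_real (phase x)) * exp (- (\<i> * w * of_real (phase x))))"
    using psi_nonzero[OF assms] by (simp add: ratio_def field_simps)
  then show ?thesis by (simp add: uE_def mix_def exp_minus)
qed

lemma ratio_holomorphic: "x \<ge> 0 \<Longrightarrow> (\<lambda>w. ratio x w) holomorphic_on T"
  unfolding ratio_def by (intro holomorphic_intros EF_holomorphic)

text \<open>Once \<open>F\<close> is small, the equation for \<open>E\<close> is \<open>E' = \<i> w phase' E\<close> up to a small error. Multiplication by
\<open>exp (- \<i> w phase)\<close> and integration give the estimate, since \<open>|w| phase x \<le> |\<zeta>|\<close> for \<open>x \<le> b\<close>.\<close>

lemma ratio_close_to_1:
  assumes x: "0 \<le> x" "x \<le> b" and b: "phase b > 0" and \<zeta>: "cmod \<zeta> \<le> R"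
    and small: "\<And>t. t \<in> {0..b} \<Longrightarrow> cmod (F t (\<zeta> / of_real (phase b))) \<le> e" and "e \<ge> 0"
  shows "cmod (ratio x (\<zeta> / of_real (phase b)) - 1) \<le> (R + 1) * exp R * e"
proof -
  define w where "w = \<zeta> / of_real (phase b)"
  have R: "R \<ge> 0" using \<zeta> norm_ge_zero order_trans by blast
  have wp: "cmod w * phase t \<le> R" if t: "t \<in> {0..x}" for t
  proof -
    have "cmod w * phase t \<le> cmod w * phase b" using t x by (intro mult_left_mono phase_mono) auto
    also have "\<dots> = cmod \<zeta>" using b by (simp add: w_def norm_divide)
    finally show ?thesis using \<zeta> by simp
  qed
  have ex: "cmod (exp (- (\<i> * w * of_real (phase t)))) \<le> exp R" if t: "t \<in> {0..x}" for t
  proof -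
    have "cmod (exp (- (\<i> * w * of_real (phase t)))) \<le> exp (cmod (- (\<i> * w * of_real (phase t))))"
      by (rule norm_exp)
    also have "\<dots> \<le> exp R" using wp[OF t] phase_nonneg[of t] t by (simp add: norm_mult)
    finally show ?thesis .
  qed
  define G where "G t = E t w * exp (- (\<i> * w * of_real (phase t)))" for t
  define G' where "G' t = \<i> * w * of_real k * ((cnj (\<psi> t))\<^sup>2 * F t w) * exp (- (\<i> * w * of_real (phase t)))" for t
  have m: "modes w {0..x} (\<lambda>x. E x w) (\<lambda>x. F x w)" by (rule EF_modes_interval[OF x(1)])
  have "(G has_vector_derivative G' t) (at t within {0..x})" if t: "t \<in> {0..x}" for t
  proof -
    have p: "(phase has_vector_derivative k * (cmod (\<psi> t))\<^sup>2) (at t within {0..x})"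
      using phase_deriv[OF t] by (simp add: has_real_derivative_iff_has_vector_derivative)
    have "((\<lambda>t. - (\<i> * w * of_real (phase t))) has_vector_derivative
         - (\<i> * w * of_real (k * (cmod (\<psi> t))\<^sup>2))) (at t within {0..x})"
      by (intro has_vector_derivative_minus has_vector_derivative_mult_right
          bounded_linear.has_vector_derivative[OF bounded_linear_of_real p])
    then have ed: "((\<lambda>t. exp (- (\<i> * w * of_real (phase t)))) has_vector_derivative
         - (\<i> * w * of_real (k * (cmod (\<psi> t))\<^sup>2)) * exp (- (\<i> * w * of_real (phase t)))) (at t within {0..x})"
      using field_vector_diff_chain_within[OF _ DERIV_exp[THEN has_field_derivative_at_within]]
      unfolding o_def by blast
    have Ed: "((\<lambda>x. E x w) has_vector_derivative \<i> * w * of_real k * (cnj (\<psi> t) * mix (\<lambda>x. E x w) (\<lambda>x. F x w) t)) (at t within {0..x})"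
      using m t unfolding modes_def by auto
    have n: "complex_of_real ((cmod (\<psi> t))\<^sup>2) = \<psi> t * cnj (\<psi> t)" by (rule complex_norm_square)
    show ?thesis
      unfolding G_def[abs_def]
      by (rule has_vector_derivative_eq_rhs[OF has_vector_derivative_mult[OF Ed ed]])
        (simp only: of_real_mult n G'_def mix_def, simp add: algebra_simps power2_eq_square)
  qed
  from fundamental_theorem_of_calculus[OF x(1) this]
  have Gint: "(G' has_integral (G x - 1)) {0..x}" by (simp add: G_def)
  have pint: "((\<lambda>t. cmod w * e * exp R * (k * (cmod (\<psi> t))\<^sup>2)) has_integral cmod w * e * exp R * phase x) {0..x}"
    unfolding phase_def
    by (intro has_integral_mult_right integrable_integral psi_square_integrable_on) auto
  have "cmod (G x - 1) \<le> cmod w * e * exp R * phase x"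
  proof -
    have "cmod (integral {0..x} G') \<le> integral {0..x} (\<lambda>t. cmod w * e * exp R * (k * (cmod (\<psi> t))\<^sup>2))"
    proof (rule integral_norm_bound_integral)
      fix t assume t: "t \<in> {0..x}"
      have "cmod (G' t) = cmod w * (k * (cmod (\<psi> t))\<^sup>2) * (cmod (F t w) * cmod (exp (- (\<i> * w * of_real (phase t)))))"
        using k_pos by (simp add: G'_def norm_mult norm_power mult_ac)
      also have "\<dots> \<le> cmod w * (k * (cmod (\<psi> t))\<^sup>2) * (e * exp R)"
        using small[of t] ex[OF t] t x \<open>e \<ge> 0\<close> k_pos by (intro mult_left_mono mult_mono) (auto simp: w_def)
      finally show "cmod (G' t) \<le> cmod w * e * exp R * (k * (cmod (\<psi> t))\<^sup>2)" by (simp add: mult_ac)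
    qed (use Gint pint in blast)+
    then show ?thesis by (simp only: integral_unique[OF Gint] integral_unique[OF pint])
  qed
  also have "\<dots> = (cmod w * phase x) * (e * exp R)" by simp
  also have "\<dots> \<le> R * (e * exp R)"
    using wp[of x] x \<open>e \<ge> 0\<close> by (intro mult_right_mono) auto
  finally have 1: "cmod (G x - 1) \<le> R * (e * exp R)" .
  have "cmod (F x w * (cnj (\<psi> x) / \<psi> x) * exp (- (\<i> * w * of_real (phase x)))) = cmod (F x w) * cmod (exp (- (\<i> * w * of_real (phase x))))"
    using psi_nonzero[OF x(1)] by (simp add: norm_mult norm_divide)
  also have "\<dots> \<le> e * exp R"
    using small[of x] ex[of x] x \<open>e \<ge> 0\<close> by (intro mult_mono) (auto simp: w_def)
  finally have 2: "cmod (F x w * (cnj (\<psi> x) / \<psi> x) * exp (- (\<i> * w * of_real (phase x)))) \<le> e * exp R" .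
  have "ratio x w - 1 = (G x - 1) + F x w * (cnj (\<psi> x) / \<psi> x) * exp (- (\<i> * w * of_real (phase x)))"
    by (simp add: ratio_def G_def ring_distribs)
  also have "cmod \<dots> \<le> R * (e * exp R) + e * exp R"
    using 1 2 by (intro order_trans[OF norm_triangle_ineq] add_mono)
  also have "\<dots> = (R + 1) * exp R * e" by (simp add: algebra_simps)
  finally show ?thesis by (simp add: w_def)
qed

theorem ratio_uniform_limit:
  assumes top: "filterlim phase at_top at_top"
    and S: "S holomorphic_on {w. Im w > 0}" "\<And>w. Im w > 0 \<Longrightarrow> cmod (S w) \<le> 1"
      "\<And>w. Im w > 0 \<Longrightarrow> weyl_disc w (S w)"
    and S0: "((\<lambda>y::real. S (\<i> * of_real y)) \<longlongrightarrow> 0) (at_right 0)"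
    and e: "e > 0" and R: "R \<ge> 0"
  shows "\<forall>\<^sub>F b in at_top. \<forall>x\<in>{0..b}. \<forall>\<zeta>\<in>cball 0 R. cmod (ratio x (\<zeta> / of_real (phase b)) - 1) \<le> e"
proof -
  define e' where "e' = e / ((R + 1) * exp R)"
  have e': "e' > 0" "(R + 1) * exp R * e' = e" using e R by (auto simp: e'_def)
  have "\<forall>\<^sub>F b in at_top. phase b \<ge> 1" using top by (simp add: filterlim_at_top)
  moreover have "\<forall>\<^sub>F b in at_top. \<forall>x\<in>{0..b}. \<forall>\<zeta>\<in>cball 0 R. cmod (F x (\<zeta> / of_real (phase b))) < e'"
    by (rule F_uniformly_small[where S = S]) (use top S S0 e' in auto)
  ultimately show ?thesis
  proof eventually_elim
    case (elim b)
    show ?case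
    proof (intro ballI)
      fix x \<zeta> assume "x \<in> {0..b}" "\<zeta> \<in> cball (0::complex) R"
      then show "cmod (ratio x (\<zeta> / of_real (phase b)) - 1) \<le> e"
        using ratio_close_to_1[of x b \<zeta> R e'] elim e' by (force intro: less_imp_le)
    qed
  qed
qed

end


section \<open>Counting eigenvalues by a phase\<close>

text \<open>Cauchy's estimate on discs of radius \<open>1\<close>.\<close>

lemma holomorphic_lipschitz_of_bound:
  fixes f :: "complex \<Rightarrow> complex"
  assumes hol: "f holomorphic_on ball 0 (R + 2)"
    and bound: "\<And>z. z \<in> ball 0 (R + 2) \<Longrightarrow> cmod (f z) \<le> c"
    and z: "z1 \<in> cball 0 R" "z2 \<in> cball 0 R"
  shows "cmod (f z1 - f z2) \<le> c * cmod (z1 - z2)"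
proof (rule field_differentiable_bound[where S = "cball 0 R" and f' = "deriv f"])
  have sub: "cball z 1 \<subseteq> ball 0 (R + 2)" if "z \<in> cball 0 R" for z :: complex
  proof
    fix y assume "y \<in> cball z 1"
    then have "cmod y \<le> cmod z + 1"
      using norm_triangle_ineq[of z "y - z"] by (simp add: dist_norm norm_minus_commute)
    then show "y \<in> ball 0 (R + 2)" using that by simp
  qed
  fix z :: complex assume z: "z \<in> cball 0 R"
  have "z \<in> ball 0 (R + 2)" using z by simp
  then have "(f has_field_derivative deriv f z) (at z)"
    using hol holomorphic_derivI open_ball by blast
  then show "(f has_field_derivative deriv f z) (at z within cball 0 R)"
    by (rule has_field_derivative_at_within)
  have "norm ((deriv ^^ 1) f z) \<le> fact 1 * c / 1 ^ 1"
  proof (rule Cauchy_inequality)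
    show "f holomorphic_on ball z 1"
      using holomorphic_on_subset[OF hol] sub[OF z] ball_subset_cball by blast
    show "continuous_on (cball z 1) f"
      by (rule continuous_on_subset[OF holomorphic_on_imp_continuous_on[OF hol] sub[OF z]])
    fix x assume "norm (z - x) = 1"
    then have "x \<in> cball z 1" by (simp add: dist_norm)
    then show "norm (f x) \<le> c" using sub[OF z] bound by blast
  qed simp
  then show "norm (deriv f z) \<le> c" by simp
qed (use z in auto)

lemma labelled_eigenvalue_unique:
  assumes 1: "is_labelled_eigenvalue V \<xi> a b j \<mu>" and 2: "is_labelled_eigenvalue V \<xi> a b j \<mu>'"
  shows "\<mu> = \<mu>'"
proof -
  have False if l1: "is_labelled_eigenvalue V \<xi> a b j \<mu>" and l2: "is_labelled_eigenvalue V \<xi> a b j \<mu>'"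
    and less: "\<mu> < \<mu>'" for \<mu> \<mu>'
  proof (cases "j \<ge> 1")
    case True
    let ?A = "\<lambda>\<mu>. eigenvalues V a b \<inter> {\<xi>..<\<mu>}"
    have "\<mu> \<in> ?A \<mu>'" "finite (?A \<mu>')" "card (?A \<mu>) = card (?A \<mu>')" "?A \<mu> \<subseteq> ?A \<mu>'" "\<mu> \<notin> ?A \<mu>"
      using True l1 l2 less unfolding is_labelled_eigenvalue_def by auto
    then show False by (metis card_subset_eq)
  next
    case False
    let ?A = "\<lambda>\<mu>. eigenvalues V a b \<inter> {\<mu><..<\<xi>}"
    have "\<mu>' \<in> ?A \<mu>" "finite (?A \<mu>)" "card (?A \<mu>') = card (?A \<mu>)" "?A \<mu>' \<subseteq> ?A \<mu>" "\<mu>' \<notin> ?A \<mu>'"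
      using False l1 l2 less unfolding is_labelled_eigenvalue_def by auto
    then show False by (metis card_subset_eq)
  qed
  from this[OF 1 2] this[OF 2 1] show ?thesis by (meson linorder_less_linear)
qed

lemma labelled_eigenvalue_eq:
  "is_labelled_eigenvalue V \<xi> a b j \<mu> \<Longrightarrow> labelled_eigenvalue V \<xi> a b j = \<mu>"
  unfolding labelled_eigenvalue_def using labelled_eigenvalue_unique by blast

text \<open>If the eigenvalues are the points at which an increasing phase \<open>\<Theta>\<close> takes values in \<open>\<pi> \<int>\<close>, then \<open>\<Theta> / \<pi>\<close> maps the
eigenvalues between \<open>\<xi>\<close> and a given one bijectively to an interval of integers, and counting
them is subtraction. The eigenvalue labelled \<open>1\<close> belongs to the first integer at or above \<open>\<Theta> 0 / \<pi>\<close>.\<close>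

lemma labelled_eigenvalue_from_phase:
  fixes \<Theta> :: "real \<Rightarrow> real" and R \<rho> :: real
  assumes \<rho>: "\<rho> > 0" and cont: "continuous_on {-R..R} \<Theta>"
    and mono: "strict_mono_on {-R..R} \<Theta>"
    and ev: "\<And>t. t \<in> {-R..R} \<Longrightarrow> \<xi> + t / \<rho> \<in> eigenvalues V a b \<longleftrightarrow> (\<exists>n::int. \<Theta> t = of_int n * pi)"
    and t: "t \<in> {-R..R}" "\<Theta> t = of_int (\<lceil>\<Theta> 0 / pi\<rceil> + j - 1) * pi"
  shows "is_labelled_eigenvalue V \<xi> a b j (\<xi> + t / \<rho>)"
proof -
  define m where "m = \<lceil>\<Theta> 0 / pi\<rceil> + j - 1"
  have tm: "\<Theta> t = of_int m * pi" using t(2) by (simp add: m_def)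
  have z: "0 \<in> {-R..R}" using t(1) by auto
  have less_iff: "\<Theta> x < \<Theta> y \<longleftrightarrow> x < y" and le_iff: "\<Theta> x \<le> \<Theta> y \<longleftrightarrow> x \<le> y"
    if "x \<in> {-R..R}" "y \<in> {-R..R}" for x y
    using strict_mono_on_less[OF mono that] strict_mono_on_less_eq[OF mono that] by auto
  have k0: "\<Theta> 0 \<le> of_int n * pi \<longleftrightarrow> \<lceil>\<Theta> 0 / pi\<rceil> \<le> n" for n
    by (simp add: ceiling_le_iff divide_le_eq)
  define e where "e x = \<xi> + x / \<rho>" for x
  define g where "g \<mu> = \<lfloor>\<Theta> (\<rho> * (\<mu> - \<xi>)) / pi\<rfloor>" for \<mu>
  have e_inv: "\<rho> * (e x - \<xi>) = x" "e (\<rho> * (\<mu> - \<xi>)) = \<mu>" for x \<mu> using \<rho> by (auto simp: e_def)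
  have e_mono: "e x < e y \<longleftrightarrow> x < y" "e x \<le> e y \<longleftrightarrow> x \<le> y" for x y
    using \<rho> by (auto simp: e_def divide_less_cancel divide_le_cancel)
  have e0: "e 0 = \<xi>" by (simp add: e_def)
  have count: "bij_betw g (eigenvalues V a b \<inter> e ` I) {n. \<exists>x\<in>I. \<Theta> x = of_int n * pi}"
    if I: "I \<subseteq> {-R..R}" for I
    unfolding bij_betw_def
  proof
    have ge: "of_int (g (e x)) * pi = \<Theta> x" if "x \<in> I" "e x \<in> eigenvalues V a b" for x
    proof -
      have "\<exists>n::int. \<Theta> x = of_int n * pi" using ev[of x] that I by (auto simp: e_def)
      then obtain n :: int where "\<Theta> x = of_int n * pi" by blast
      then show ?thesis by (simp add: g_def e_inv)
    qed
    show "inj_on g (eigenvalues V a b \<inter> e ` I)"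
    proof (rule inj_onI)
      fix \<mu> \<mu>' assume A: "\<mu> \<in> eigenvalues V a b \<inter> e ` I" "\<mu>' \<in> eigenvalues V a b \<inter> e ` I" "g \<mu> = g \<mu>'"
      then obtain x x' where x: "x \<in> I" "x' \<in> I" "\<mu> = e x" "\<mu>' = e x'" by blast
      then have "\<Theta> x = \<Theta> x'" using ge[of x] ge[of x'] A by simp
      moreover have "x \<in> {-R..R}" "x' \<in> {-R..R}" using x I by auto
      ultimately have "x = x'" using less_iff[of x x'] less_iff[of x' x] by simp
      with x show "\<mu> = \<mu>'" by simp
    qed
    show "g ` (eigenvalues V a b \<inter> e ` I) = {n. \<exists>x\<in>I. \<Theta> x = of_int n * pi}" (is "?L = ?R")
    proof
      show "?L \<subseteq> ?R" using ge by fastforce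
      show "?R \<subseteq> ?L"
      proof
        fix n assume "n \<in> ?R"
        then obtain x where x: "x \<in> I" "\<Theta> x = of_int n * pi" by blast
        then have ex: "e x \<in> eigenvalues V a b" using ev[of x] I by (auto simp: e_def)
        have "g (e x) = n" using x(2) by (simp add: g_def e_inv)
        with ex x(1) show "n \<in> ?L" by force
      qed
    qed
  qed
  have et: "e t \<in> eigenvalues V a b" using ev[OF t(1)] tm by (auto simp: e_def)
  show ?thesis
  proof (cases "j \<ge> 1")
    case True
    then have "\<Theta> 0 \<le> \<Theta> t" using k0[of m] tm by (simp add: m_def)
    then have t0: "0 \<le> t" using le_iff[OF z t(1)] by simp
    have I: "{0..<t} \<subseteq> {-R..R}" using t(1) by auto
    have "e ` {0..<t} = {\<xi>..<e t}"
    proof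
      show "e ` {0..<t} \<subseteq> {\<xi>..<e t}" using e_mono[of 0] e_mono[of _ t] e0 by auto
      show "{\<xi>..<e t} \<subseteq> e ` {0..<t}"
      proof
        fix y assume "y \<in> {\<xi>..<e t}"
        then have "0 \<le> \<rho> * (y - \<xi>)" "\<rho> * (y - \<xi>) < t"
          using e_mono(1)[of "\<rho> * (y - \<xi>)" t] \<rho> by (auto simp: e_inv)
        then show "y \<in> e ` {0..<t}" using e_inv(2)[of y] by (metis atLeastLessThan_iff imageI)
      qed
    qed
    moreover have "{n. \<exists>x\<in>{0..<t}. \<Theta> x = of_int n * pi} = {\<lceil>\<Theta> 0 / pi\<rceil>..<m}" (is "?L = ?R")
    proof
      show "?L \<subseteq> ?R"
      proof
        fix n assume "n \<in> ?L"
        then obtain x where x: "x \<in> {0..<t}" "\<Theta> x = of_int n * pi" by blast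
        then have "\<Theta> 0 \<le> of_int n * pi" "of_int n * pi < of_int m * pi"
          using le_iff[OF z, of x] less_iff[OF _ t(1), of x] I tm by auto
        then show "n \<in> ?R" using k0[of n] by simp
      qed
      show "?R \<subseteq> ?L"
      proof
        fix n assume n: "n \<in> ?R"
        then have "\<Theta> 0 \<le> of_int n * pi" "of_int n * pi \<le> \<Theta> t" using k0[of n] tm by auto
        then obtain x where x: "0 \<le> x" "x \<le> t" "\<Theta> x = of_int n * pi"
          using IVT'[of \<Theta> 0 "of_int n * pi" t] t0 continuous_on_subset[OF cont, of "{0..t}"] t(1) by auto
        moreover have "x \<noteq> t" using x(3) tm n by auto
        ultimately show "n \<in> ?L" by force
      qed
    qed
    ultimately have b: "bij_betw g (eigenvalues V a b \<inter> {\<xi>..<e t}) {\<lceil>\<Theta> 0 / pi\<rceil>..<m}"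
      using count[OF I] by simp
    have "finite (eigenvalues V a b \<inter> {\<xi>..<e t})" using bij_betw_finite[OF b] by simp
    moreover have "int (card (eigenvalues V a b \<inter> {\<xi>..<e t})) = j - 1"
      using bij_betw_same_card[OF b] True by (simp add: m_def)
    moreover have "\<xi> \<le> e t" using e_mono(2)[of 0 t] e0 t0 by simp
    ultimately show ?thesis using True et unfolding is_labelled_eigenvalue_def e_def by simp
  next
    case False
    then have "\<not> \<Theta> 0 \<le> \<Theta> t" using k0[of m] tm by (simp add: m_def)
    then have t0: "t < 0" using le_iff[OF z t(1)] by simp
    have I: "{t<..<0} \<subseteq> {-R..R}" using t(1) by auto
    have "e ` {t<..<0} = {e t<..<\<xi>}"
    proof
      show "e ` {t<..<0} \<subseteq> {e t<..<\<xi>}" using e_mono[of t] e_mono[of _ 0] e0 by auto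
      show "{e t<..<\<xi>} \<subseteq> e ` {t<..<0}"
      proof
        fix y assume "y \<in> {e t<..<\<xi>}"
        then have "\<rho> * (y - \<xi>) < 0" "t < \<rho> * (y - \<xi>)"
          using e_mono(1)[of t "\<rho> * (y - \<xi>)"] \<rho> by (auto simp: e_inv mult_pos_neg)
        then show "y \<in> e ` {t<..<0}" using e_inv(2)[of y] by (metis greaterThanLessThan_iff imageI)
      qed
    qed
    moreover have "{n. \<exists>x\<in>{t<..<0}. \<Theta> x = of_int n * pi} = {m<..<\<lceil>\<Theta> 0 / pi\<rceil>}" (is "?L = ?R")
    proof
      show "?L \<subseteq> ?R"
      proof
        fix n assume "n \<in> ?L"
        then obtain x where x: "x \<in> {t<..<0}" "\<Theta> x = of_int n * pi" by blast
        then have "\<not> \<Theta> 0 \<le> of_int n * pi" "of_int m * pi < of_int n * pi"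
          using le_iff[OF z, of x] less_iff[OF t(1), of x] I tm by auto
        then show "n \<in> ?R" using k0[of n] by simp
      qed
      show "?R \<subseteq> ?L"
      proof
        fix n assume n: "n \<in> ?R"
        then have n': "of_int n * pi < \<Theta> 0" "\<Theta> t \<le> of_int n * pi" using k0[of n] tm by auto
        then obtain x where x: "t \<le> x" "x \<le> 0" "\<Theta> x = of_int n * pi"
          using IVT'[of \<Theta> t "of_int n * pi" 0] t0 continuous_on_subset[OF cont, of "{t..0}"] t(1) by auto
        moreover have "x \<noteq> t" using x(3) tm n by auto
        moreover have "x \<noteq> 0" using x(3) n' by auto
        ultimately show "n \<in> ?L" by force
      qed
    qed
    ultimately have b: "bij_betw g (eigenvalues V a b \<inter> {e t<..<\<xi>}) {m<..<\<lceil>\<Theta> 0 / pi\<rceil>}"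
      using count[OF I] by simp
    have "finite (eigenvalues V a b \<inter> {e t<..<\<xi>})" using bij_betw_finite[OF b] by simp
    moreover have "int (card (eigenvalues V a b \<inter> {e t<..<\<xi>})) = - j"
      using bij_betw_same_card[OF b] False by (simp add: m_def)
    moreover have "e t < \<xi>" using e_mono(1)[of t 0] e0 t0 by simp
    ultimately show ?thesis using False et unfolding is_labelled_eigenvalue_def e_def by simp
  qed
qed

context complex_frame
begin

text \<open>A solution that vanishes identically also has derivative \<open>0\<close>, and \<open>\<psi>\<close>, \<open>cnj \<psi>\<close> are independent.\<close>

lemma mix_zero_imp_zero:
  assumes m: "modes w {p..q} al be" and pq: "0 \<le> p" "p < q"
    and z: "\<And>x. x \<in> {p..q} \<Longrightarrow> mix al be x = 0"
  shows "al p = 0 \<and> be p = 0"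
proof -
  have "(mix al be has_vector_derivative al p * d\<psi> p + be p * cnj (d\<psi> p)) (at p within {p..q})"
    by (rule mix_derivative[OF m]) (use pq in auto)
  moreover have "(mix al be has_vector_derivative 0) (at p within {p..q})"
    by (rule has_vector_derivative_transform[of _ _ _ "\<lambda>_. 0"]) (use z pq in auto)
  ultimately have d: "al p * d\<psi> p + be p * cnj (d\<psi> p) = 0"
    using vector_derivative_unique_within_closed_interval[of p q p "mix al be"] pq by auto
  have v: "al p * \<psi> p + be p * cnj (\<psi> p) = 0" using z[of p] pq by (simp add: mix_def)
  have W: "cnj (\<psi> p) * d\<psi> p - cnj (d\<psi> p) * \<psi> p \<noteq> 0"
    using wronskian_eq[OF pq(1)] kappa_pos by simp
  have "al p * (cnj (\<psi> p) * d\<psi> p - cnj (d\<psi> p) * \<psi> p)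
     = cnj (\<psi> p) * (al p * d\<psi> p + be p * cnj (d\<psi> p)) - cnj (d\<psi> p) * (al p * \<psi> p + be p * cnj (\<psi> p))"
    by (simp add: algebra_simps)
  then have "al p = 0" using d v W by simp
  moreover from this v have "be p = 0" using psi_nonzero[OF pq(1)] by simp
  ultimately show ?thesis by simp
qed

lemma uF_real: "uF (of_real t) x = cnj (uE (of_real t) x)"
  by (simp add: uE_def uF_def mix_def algebra_simps)

text \<open>For real energies \<open>|E|\<^sup>2 - |F|\<^sup>2 \<ge> 1\<close>, whereas a zero of \<open>E \<psi> + F (cnj \<psi>)\<close> forces \<open>|E| = |F|\<close>.\<close>

lemma uE_real_nonzero:
  assumes "x \<ge> 0"
  shows "uE (of_real t) x \<noteq> 0"
proof
  assume "uE (of_real t) x = 0"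
  then have "E x (of_real t) * \<psi> x = - (F x (of_real t) * cnj (\<psi> x))"
    by (simp add: uE_def mix_def eq_neg_iff_add_eq_0)
  then have "cmod (E x (of_real t) * \<psi> x) = cmod (F x (of_real t) * cnj (\<psi> x))" by simp
  then have "cmod (E x (of_real t)) = cmod (F x (of_real t))"
    using psi_nonzero[OF assms] by (simp add: norm_mult)
  then show False using EF_lower_half_plane[OF assms, of "of_real t"] by simp
qed

text \<open>For real \<open>t\<close> the solutions \<open>uE\<close> and \<open>cnj uE\<close> form a basis. A nontrivial combination vanishes at both
endpoints iff the two vectors \<open>(uE, cnj uE)\<close> at \<open>a\<close> and at \<open>b\<close> are dependent, and their determinant is
\<open>2 \<i> Im (cnj (uE a) * uE b)\<close> up to sign.\<close>

lemma eigenvalue_iff_real_quotient: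
  assumes ab: "0 \<le> a" "a < b"
  shows "\<xi> + t \<in> eigenvalues V a b \<longleftrightarrow> Im (cnj (uE (of_real t) a) * uE (of_real t) b) = 0"
proof
  let ?u = "uE (of_real t)"
  assume "\<xi> + t \<in> eigenvalues V a b"
  then obtain \<phi> where nt: "nontrivial_on {a..b} \<phi>"
    and eq: "schroedinger_expr V {a..b} \<phi> (\<lambda>x. of_real (\<xi> + t) * \<phi> x)" and bc: "\<phi> a = 0" "\<phi> b = 0"
    unfolding eigenvalues_def H_interval_def by auto
  have "schroedinger_expr V {a..b} \<phi> (\<lambda>x. (of_real \<xi> + of_real t) * \<phi> x)" using eq by simp
  then obtain al be where m: "modes (of_real t) {a..b} al be" and \<phi>: "\<And>x. x \<in> {a..b} \<Longrightarrow> \<phi> x = mix al be x"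
    by (rule solution_has_modes[OF ab(1)]) blast
  obtain A B where AB: "\<And>x. x \<in> {a..b} \<Longrightarrow> mix al be x = A * ?u x + B * uF (of_real t) x"
    using mix_eq_basis_combination[OF m ab(1)] by blast
  have eqs: "A * ?u a + B * cnj (?u a) = 0" "A * ?u b + B * cnj (?u b) = 0"
    using AB[of a] AB[of b] \<phi>[of a] \<phi>[of b] bc ab by (auto simp: uF_real)
  have "A \<noteq> 0 \<or> B \<noteq> 0"
    using nt \<phi> AB unfolding nontrivial_on_def by force
  define D where "D = cnj (?u a) * ?u b - ?u a * cnj (?u b)"
  have "A * D = cnj (?u a) * (A * ?u b + B * cnj (?u b)) - cnj (?u b) * (A * ?u a + B * cnj (?u a))"
    "B * D = ?u b * (A * ?u a + B * cnj (?u a)) - ?u a * (A * ?u b + B * cnj (?u b))"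
    by (simp_all add: D_def algebra_simps)
  then have "A * D = 0" "B * D = 0" unfolding eqs by auto
  with \<open>A \<noteq> 0 \<or> B \<noteq> 0\<close> have "D = 0" by auto
  moreover have "D = 2 * \<i> * of_real (Im (cnj (?u a) * ?u b))"
    by (simp add: D_def complex_eq_iff)
  ultimately have "2 * \<i> * complex_of_real (Im (cnj (?u a) * ?u b)) = 0" by metis
  then show "Im (cnj (?u a) * ?u b) = 0" by (simp only: mult_eq_0_iff of_real_eq_0_iff) simp
next
  let ?u = "uE (of_real t)"
  assume Im0: "Im (cnj (?u a) * ?u b) = 0"
  \<comment> \<open>The solution that vanishes at \<open>a\<close>.\<close>
  define A B where "A = cnj (?u a)" and "B = - ?u a"
  let ?al = "\<lambda>x. A * E x (of_real t) + B * cnj (F x (cnj (of_real t)))"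
  let ?be = "\<lambda>x. A * F x (of_real t) + B * cnj (E x (cnj (of_real t)))"
  let ?\<phi> = "\<lambda>x. A * ?u x + B * uF (of_real t) x"
  have m: "modes (of_real t) {a..b} ?al ?be"
    by (rule modes_subset[OF general_modes]) (use ab in auto)
  have bca: "?\<phi> a = 0" by (simp add: uF_real A_def B_def)
  have "?\<phi> b = 2 * \<i> * of_real (Im (cnj (?u a) * ?u b))"
    by (simp add: uF_real A_def B_def complex_eq_iff)
  then have bcb: "?\<phi> b = 0" unfolding Im0 by simp
  have expr: "schroedinger_expr V {a..b} ?\<phi> (\<lambda>x. of_real (\<xi> + t) * ?\<phi> x)"
    using mix_schroedinger_expr[OF m] ab unfolding mix_general by auto
  have cont: "continuous_on {a..b} ?\<phi>"
    unfolding mix_general[symmetric] mix_def[abs_def]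
    by (intro continuous_intros modes_continuous_on[OF m] psi_continuous_on) (use ab in auto)
  have nt: "nontrivial_on {a..b} ?\<phi>"
  proof (rule ccontr)
    assume "\<not> nontrivial_on {a..b} ?\<phi>"
    then have "?\<phi> x = 0" if "x \<in> {a..b}" for x using that unfolding nontrivial_on_def by blast
    then have z: "?al a = 0 \<and> ?be a = 0"
      by (intro mix_zero_imp_zero[OF m ab]) (simp only: mix_general)
    have "A * (E a (of_real t) * cnj (E a (cnj (of_real t))) - cnj (F a (cnj (of_real t))) * F a (of_real t))
       = cnj (E a (cnj (of_real t))) * ?al a - cnj (F a (cnj (of_real t))) * ?be a"
      by (simp add: algebra_simps)
    then have "A = 0" using z EF_determinant[OF ab(1), of "of_real t"] by simp
    then show False using uE_real_nonzero[OF ab(1)] by (simp add: A_def)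
  qed
  have "square_integrable {a..b} ?\<phi>" "square_integrable {a..b} (\<lambda>x. of_real (\<xi> + t) * ?\<phi> x)"
    by (intro continuous_imp_square_integrable continuous_intros cont)+
  then have "(?\<phi>, \<lambda>x. of_real (\<xi> + t) * ?\<phi> x) \<in> H_interval V a b"
    using expr bca bcb unfolding H_interval_def by simp
  with nt show "\<xi> + t \<in> eigenvalues V a b"
    unfolding eigenvalues_def by blast
qed

text \<open>A continuous argument of \<open>cnj (uE a) * uE b\<close>: the constant argument of \<open>cnj (\<psi> a) * \<psi> b\<close>, the linear term
\<open>\<sigma> t\<close>, and the imaginary parts of the logarithms of the two ratios, which are holomorphic and
small on a larger disc and therefore have small derivative.\<close>

lemma phase_function:
  assumes ab: "0 \<le> a" "a < b" and \<rho>: "phase b > 0" and R: "R \<ge> 0" and e: "0 \<le> e" "e < 1/2"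
    and close: "\<And>x \<zeta>. x \<in> {0..b} \<Longrightarrow> \<zeta> \<in> cball 0 (R + 2) \<Longrightarrow> cmod (ratio x (\<zeta> / of_real (phase b)) - 1) \<le> e"
  defines "\<sigma> \<equiv> (phase b - phase a) / phase b"
  obtains \<Theta> :: "real \<Rightarrow> real" where
    "\<And>t. t \<in> {-R..R} \<Longrightarrow> \<xi> + t / phase b \<in> eigenvalues V a b \<longleftrightarrow> (\<exists>n::int. \<Theta> t = of_int n * pi)"
    "continuous_on {-R..R} \<Theta>"
    "\<And>t t'. t \<in> {-R..R} \<Longrightarrow> t' \<in> {-R..R} \<Longrightarrow> \<bar>\<Theta> t - \<Theta> t' - \<sigma> * (t - t')\<bar> \<le> min (4 * e * \<bar>t - t'\<bar>) (8 * e)"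
proof -
  define r where "r = phase b"
  have r: "r > 0" using \<rho> by (simp add: r_def)
  define q where "q x \<zeta> = Ln (ratio x (\<zeta> / of_real r))" for x \<zeta>
  have cl: "cmod (ratio x (\<zeta> / of_real r) - 1) \<le> e" if "x \<in> {0..b}" "cmod \<zeta> < R + 2" for x \<zeta>
    using close[OF that(1), of \<zeta>] that(2) by (simp add: r_def)
  have rz: "Re (ratio x (\<zeta> / of_real r)) > 0" if "x \<in> {0..b}" "cmod \<zeta> < R + 2" for x \<zeta>
    using cl[OF that] abs_Re_le_cmod[of "ratio x (\<zeta> / of_real r) - 1"] e(2) by simp
  have qb: "cmod (q x \<zeta>) \<le> 2 * e" if "x \<in> {0..b}" "cmod \<zeta> < R + 2" for x \<zeta>
  proof -
    have "cmod (Ln (1 + (ratio x (\<zeta> / of_real r) - 1))) \<le> 2 * cmod (ratio x (\<zeta> / of_real r) - 1)"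
      using cl[OF that] e(2) by (intro norm_Ln_le) simp
    then show ?thesis using cl[OF that] by (simp add: q_def)
  qed
  have qh: "q x holomorphic_on ball 0 (R + 2)" if x: "x \<in> {0..b}" for x
  proof -
    have "(\<lambda>\<zeta>. ratio x (\<zeta> / of_real r)) holomorphic_on ball 0 (R + 2)"
    proof -
      have "(\<lambda>\<zeta>. \<zeta> / complex_of_real r) holomorphic_on ball 0 (R + 2)"
        using r by (intro holomorphic_intros) auto
      moreover have "0 \<le> x" using x by simp
      ultimately show ?thesis
        using holomorphic_on_compose[OF _ ratio_holomorphic[of x]] unfolding o_def by blast
    qed
    moreover have "ratio x (z / complex_of_real r) \<notin> \<real>\<^sub>\<le>\<^sub>0" if "z \<in> ball 0 (R + 2)" for z
      using rz[OF x, of z] that by (simp add: complex_nonpos_Reals_iff)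
    ultimately show ?thesis unfolding q_def[abs_def]
      by (intro holomorphic_on_Ln')
  qed
  have ex: "exp (q x \<zeta>) = ratio x (\<zeta> / of_real r)" if "x \<in> {0..b}" "cmod \<zeta> < R + 2" for x \<zeta>
    unfolding q_def by (rule exp_Ln) (use rz[OF that] in auto)
  define \<Theta> where "\<Theta> t = Arg (cnj (\<psi> a) * \<psi> b) + \<sigma> * t + Im (q b (of_real t)) - Im (q a (of_real t))" for t :: real
  have xab: "a \<in> {0..b}" "b \<in> {0..b}" using ab by auto
  show thesis
  proof (rule that[of \<Theta>])
    have "continuous_on {-R..R} (\<lambda>t. q x (of_real t))" if "x \<in> {0..b}" for x
      by (rule continuous_on_compose2[OF holomorphic_on_imp_continuous_on[OF qh[OF that]]])
        (auto intro!: continuous_intros)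
    from this[OF xab(1)] this[OF xab(2)] show "continuous_on {-R..R} \<Theta>"
      unfolding \<Theta>_def[abs_def] by (intro continuous_intros)
  next
    fix t t' assume t: "t \<in> {-R..R}" "t' \<in> {-R..R}"
    have d: "cmod (q x (of_real t) - q x (of_real t')) \<le> 2 * e * \<bar>t - t'\<bar>" 
       "cmod (q x (of_real t) - q x (of_real t')) \<le> 4 * e" if x: "x \<in> {0..b}" for x
    proof -
      have "cmod (q x (of_real t) - q x (of_real t')) \<le> 2 * e * cmod (of_real t - of_real t')"
        by (rule holomorphic_lipschitz_of_bound[OF qh[OF x]]) (use qb[OF x] t in auto)
      then show "cmod (q x (of_real t) - q x (of_real t')) \<le> 2 * e * \<bar>t - t'\<bar>"
        by (simp flip: of_real_diff)
      have "cmod (q x (of_real t) - q x (of_real t')) \<le> cmod (q x (of_real t)) + cmod (q x (of_real t'))"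
        by (rule norm_triangle_ineq4)
      also have "\<dots> \<le> 2 * e + 2 * e" using qb[OF x] t by (intro add_mono) auto
      finally show "cmod (q x (of_real t) - q x (of_real t')) \<le> 4 * e" by simp
    qed
    have eq: "\<Theta> t - \<Theta> t' - \<sigma> * (t - t') = Im (q b (of_real t) - q b (of_real t')) - Im (q a (of_real t) - q a (of_real t'))"
      by (simp add: \<Theta>_def algebra_simps)
    have "\<bar>\<Theta> t - \<Theta> t' - \<sigma> * (t - t')\<bar> \<le> cmod (q b (of_real t) - q b (of_real t')) + cmod (q a (of_real t) - q a (of_real t'))"
      unfolding eq
      using abs_Im_le_cmod[of "q b (of_real t) - q b (of_real t')"] abs_Im_le_cmod[of "q a (of_real t) - q a (of_real t')"]
      by linarith
    then show "\<bar>\<Theta> t - \<Theta> t' - \<sigma> * (t - t')\<bar> \<le> min (4 * e * \<bar>t - t'\<bar>) (8 * e)"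
      using d[OF xab(1)] d[OF xab(2)] by simp
  next
    fix t assume t: "t \<in> {-R..R}"
    define w where "w = t / r"
    have u: "uE (of_real w) x = \<psi> x * exp (\<i> * of_real (w * phase x) + q x (of_real t))" if x: "x \<in> {0..b}" for x
    proof -
      have "\<bar>t\<bar> < R + 2" using t by auto
      then have "ratio x (of_real w) = exp (q x (of_real t))"
        using ex[OF x, of "of_real t"] by (simp add: w_def)
      then show ?thesis using uE_eq_ratio[of x "of_real w"] x by (simp add: exp_add mult.assoc)
    qed
    define s where "s = \<i> * of_real (Arg (cnj (\<psi> a) * \<psi> b)) + cnj (\<i> * of_real (w * phase a) + q a (of_real t))
        + (\<i> * of_real (w * phase b) + q b (of_real t))"
    have nz: "cnj (\<psi> a) * \<psi> b \<noteq> 0" using psi_nonzero ab by simp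
    have "cnj (uE (of_real w) a) * uE (of_real w) b
       = (cnj (\<psi> a) * \<psi> b) * (exp (cnj (\<i> * of_real (w * phase a) + q a (of_real t))) * exp (\<i> * of_real (w * phase b) + q b (of_real t)))"
      unfolding u[OF xab(1)] u[OF xab(2)] exp_cnj[symmetric] by simp
    also have "cnj (\<psi> a) * \<psi> b = of_real (cmod (cnj (\<psi> a) * \<psi> b)) * exp (\<i> * of_real (Arg (cnj (\<psi> a) * \<psi> b)))"
      by (rule Arg_eq[OF nz])
    also have "of_real (cmod (cnj (\<psi> a) * \<psi> b)) * exp (\<i> * of_real (Arg (cnj (\<psi> a) * \<psi> b))) *
       (exp (cnj (\<i> * of_real (w * phase a) + q a (of_real t))) * exp (\<i> * of_real (w * phase b) + q b (of_real t)))
       = of_real (cmod (cnj (\<psi> a) * \<psi> b)) * exp s"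
      by (simp add: s_def exp_add mult_ac)
    finally have "Im (cnj (uE (of_real w) a) * uE (of_real w) b) = cmod (cnj (\<psi> a) * \<psi> b) * (exp (Re s) * sin (Im s))"
      by (simp add: Im_exp)
    moreover have "Im s = \<Theta> t"
      using r by (simp add: s_def \<Theta>_def \<sigma>_def w_def r_def field_simps)
    ultimately have "Im (cnj (uE (of_real w) a) * uE (of_real w) b) = 0 \<longleftrightarrow> sin (\<Theta> t) = 0"
      using nz by simp
    then show "\<xi> + t / phase b \<in> eigenvalues V a b \<longleftrightarrow> (\<exists>n::int. \<Theta> t = of_int n * pi)"
      using eigenvalue_iff_real_quotient[OF ab, of w] by (simp add: w_def r_def sin_zero_iff_int2)
  qed
qed

text \<open>The slope of the phase is at least \<open>\<sigma>0 - 4 e > 0\<close>, and \<open>R\<close> is so large that on \<open>{-R..R}\<close> the phase passes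
the multiples of \<open>\<pi>\<close> that carry the labels \<open>j\<close> and \<open>j + 1\<close>.\<close>

lemma labelled_eigenvalues_spacing:
  fixes j :: int
  assumes ab: "0 \<le> a" "a < b" and \<rho>: "phase b > 0" and e: "0 \<le> e" "8 * e \<le> 1" "4 * e < \<sigma>0"
    and R: "R = ((\<bar>of_int j\<bar> + 2) * pi + 1) / \<sigma>0"
    and \<sigma>: "\<sigma>0 \<le> (phase b - phase a) / phase b"
    and close: "\<And>x \<zeta>. x \<in> {0..b} \<Longrightarrow> \<zeta> \<in> cball 0 (R + 2) \<Longrightarrow> cmod (ratio x (\<zeta> / of_real (phase b)) - 1) \<le> e"
  obtains \<mu> \<mu>' where "is_labelled_eigenvalue V \<xi> a b j \<mu>" "is_labelled_eigenvalue V \<xi> a b (j + 1) \<mu>'"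
    "\<bar>(phase b - phase a) * (\<mu>' - \<mu>) - pi\<bar> \<le> 8 * e"
proof -
  define \<sigma> where "\<sigma> = (phase b - phase a) / phase b"
  have \<sigma>0: "\<sigma>0 > 0" using e by linarith
  have R0: "R \<ge> 0" using \<sigma>0 unfolding R by simp
  have \<sigma>R: "\<sigma> * R \<ge> (\<bar>of_int j\<bar> + 2) * pi + 1"
  proof -
    have "(\<bar>of_int j\<bar> + 2) * pi + 1 = \<sigma>0 * R" using \<sigma>0 unfolding R by simp
    also have "\<dots> \<le> \<sigma> * R" using \<sigma> R0 unfolding \<sigma>_def by (intro mult_right_mono)
    finally show ?thesis .
  qed
  have e2: "e < 1/2" using e by simp
  obtain \<Theta> :: "real \<Rightarrow> real" where
    ev: "\<And>t. t \<in> {-R..R} \<Longrightarrow> \<xi> + t / phase b \<in> eigenvalues V a b \<longleftrightarrow> (\<exists>n::int. \<Theta> t = of_int n * pi)"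
    and cont: "continuous_on {-R..R} \<Theta>"
    and lin: "\<And>t t'. t \<in> {-R..R} \<Longrightarrow> t' \<in> {-R..R} \<Longrightarrow> \<bar>\<Theta> t - \<Theta> t' - \<sigma> * (t - t')\<bar> \<le> min (4 * e * \<bar>t - t'\<bar>) (8 * e)"
    using phase_function[OF ab \<rho> R0 e(1) e2 close] unfolding \<sigma>_def by blast
  have mono: "strict_mono_on {-R..R} \<Theta>"
  proof (rule strict_mono_onI)
    fix t t' assume t: "t \<in> {-R..R}" "t' \<in> {-R..R}" "t < t'"
    have "4 * e * (t' - t) < \<sigma> * (t' - t)"
      using e(3) \<sigma> t(3) unfolding \<sigma>_def by (intro mult_strict_right_mono) auto
    moreover have "\<bar>\<Theta> t' - \<Theta> t - \<sigma> * (t' - t)\<bar> \<le> 4 * e * (t' - t)"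
      using lin[OF t(2,1)] t(3) by simp
    ultimately show "\<Theta> t < \<Theta> t'" by linarith
  qed
  have z: "0 \<in> {-R..R}" "R \<in> {-R..R}" "-R \<in> {-R..R}" using R0 by auto
  have hi: "\<Theta> R \<ge> \<Theta> 0 + (\<bar>of_int j\<bar> + 2) * pi" and lo: "\<Theta> (-R) \<le> \<Theta> 0 - (\<bar>of_int j\<bar> + 2) * pi"
    using lin[OF z(2,1)] lin[OF z(3,1)] \<sigma>R e(2) by auto
  define m where "m = \<lceil>\<Theta> 0 / pi\<rceil>"
  have m: "\<Theta> 0 \<le> of_int m * pi" "(of_int m - 1) * pi < \<Theta> 0"
    using le_of_int_ceiling[of "\<Theta> 0 / pi"] ceiling_correct[of "\<Theta> 0 / pi"]
      pos_divide_le_eq[OF pi_gt_zero, of "\<Theta> 0" "of_int m"]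
      pos_less_divide_eq[OF pi_gt_zero, of "of_int m - 1" "\<Theta> 0"]
    unfolding m_def by blast+
  have ex: "\<exists>t\<in>{-R..R}. \<Theta> t = of_int (m + i - 1) * pi" if i: "\<bar>i\<bar> \<le> \<bar>j\<bar> + 1" for i :: int
  proof -
    have i1: "real_of_int i \<le> \<bar>of_int j\<bar> + 1" "- (\<bar>of_int j\<bar> + 1) \<le> real_of_int i" using i by linarith+
    have "of_int i * pi \<le> (\<bar>of_int j\<bar> + 2) * pi" using i1 by (intro mult_right_mono) auto
    then have "of_int (m + i - 1) * pi \<le> \<Theta> R" using hi m by (simp add: algebra_simps)
    moreover have "- (\<bar>of_int j\<bar> + 2) * pi \<le> (of_int i - 1) * pi" using i1 by (intro mult_right_mono) auto
    then have "\<Theta> (-R) \<le> of_int (m + i - 1) * pi" using lo m by (simp add: algebra_simps)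
    ultimately show ?thesis using IVT'[of \<Theta> "-R" _ R, OF _ _ _ cont] R0 by force
  qed
  obtain t where t: "t \<in> {-R..R}" "\<Theta> t = of_int (m + j - 1) * pi" using ex[of j] by auto
  obtain t' where t': "t' \<in> {-R..R}" "\<Theta> t' = of_int (m + (j + 1) - 1) * pi" using ex[of "j + 1"] by fastforce
  show thesis
  proof (rule that)
    show "is_labelled_eigenvalue V \<xi> a b j (\<xi> + t / phase b)"
      by (rule labelled_eigenvalue_from_phase[OF \<rho> cont mono ev t[unfolded m_def]])
    show "is_labelled_eigenvalue V \<xi> a b (j + 1) (\<xi> + t' / phase b)"
      by (rule labelled_eigenvalue_from_phase[OF \<rho> cont mono ev t'[unfolded m_def]])
    have "\<Theta> t' - \<Theta> t = pi" using t t' by (simp add: algebra_simps)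
    moreover have "(phase b - phase a) * (\<xi> + t' / phase b - (\<xi> + t / phase b)) = \<sigma> * (t' - t)"
      using \<rho> by (simp add: \<sigma>_def field_simps)
    ultimately show "\<bar>(phase b - phase a) * (\<xi> + t' / phase b - (\<xi> + t / phase b)) - pi\<bar> \<le> 8 * e"
      using lin[OF t'(1) t(1)] by (simp add: abs_minus_commute)
  qed
qed

lemma c_weight_eq_phase:
  assumes "0 \<le> a" "a \<le> b"
  shows "c_weight \<psi> a b = (phase b - phase a) / pi"
proof -
  have "half_line_deriv \<psi> 0 = d\<psi> 0" "half_line_deriv (\<lambda>x. cnj (\<psi> x)) 0 = cnj (d\<psi> 0)"
    by (intro half_line_deriv_eq psi_deriv has_vector_derivative_cnj; simp)+
  then have "wronskian (\<lambda>x. cnj (\<psi> x)) \<psi> 0 = 2 * \<i> * of_real \<kappa>"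
    using wronskian_eq[of 0] by (simp add: wronskian_def)
  then have "\<i> / (of_real pi * wronskian (\<lambda>x. cnj (\<psi> x)) \<psi> 0) = of_real (k / pi)"
    using kappa_pos by (simp add: k_def field_simps)
  then have "c_weight \<psi> a b = k / pi * integral {a..b} (\<lambda>x. (cmod (\<psi> x))\<^sup>2)"
    unfolding c_weight_def by (simp flip: of_real_mult)
  then show ?thesis using phase_diff[OF assms] by simp
qed

end

section \<open>Clock spacing of the eigenvalues\<close>

theorem theorem6p1:
  fixes V :: "real \<Rightarrow> real" and \<xi> :: real and \<eta> :: complex
    and \<psi> :: "real \<Rightarrow> complex" and a b :: "nat \<Rightarrow> real"
  assumes V_loc: "\<And>R. R \<ge> 0 \<Longrightarrow> V absolutely_integrable_on {0..R}"
    and limit_point: "limit_point_at_infinity V"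
    and normal_limit: "((\<lambda>y::real. weyl_m V (Complex \<xi> y)) \<longlongrightarrow> \<eta>) (at_right 0)"
    and eta_upper: "Im \<eta> > 0"
    and psi_solution: "schroedinger_solution V (of_real \<xi>) \<psi>"
    and psi_nontrivial: "nontrivial_on {0..} \<psi>"
    and psi_initial: "half_line_deriv \<psi> 0 / \<psi> 0 = \<eta>"
    and ab: "\<And>l. 0 \<le> a l \<and> a l < b l"
    and b_infinity: "filterlim b at_top sequentially"
    and c_ratio: "limsup (\<lambda>l. ereal (c_weight \<psi> 0 (a l) / c_weight \<psi> 0 (b l))) < 1"
  shows "\<forall>j::int.
      (\<forall>\<^sub>F l in sequentially.
         (\<exists>\<mu>. is_labelled_eigenvalue V \<xi> (a l) (b l) j \<mu>) \<and>
         (\<exists>\<mu>. is_labelled_eigenvalue V \<xi> (a l) (b l) (j + 1) \<mu>)) \<and>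
      (\<lambda>l. c_weight \<psi> (a l) (b l) *
             (labelled_eigenvalue V \<xi> (a l) (b l) (j + 1) - labelled_eigenvalue V \<xi> (a l) (b l) j))
        \<longlonglongrightarrow> 1"
proof
  fix j :: int
  obtain d\<psi> dd\<psi> where d: "\<forall>x\<in>{0..}. (\<psi> has_vector_derivative d\<psi> x) (at x within {0..})"
    "abs_cont_loc {0..} \<psi>" "abs_cont_loc {0..} d\<psi>"
    "AE x in lebesgue. x \<in> {0..} \<longrightarrow> (d\<psi> has_vector_derivative dd\<psi> x) (at x within {0..}) \<and>
           of_real \<xi> * \<psi> x = - dd\<psi> x + of_real (V x) * \<psi> x"
    using psi_solution unfolding schroedinger_solution_def schroedinger_expr_def by blast
  have d0: "half_line_deriv \<psi> 0 = d\<psi> 0" using d(1) by (intro half_line_deriv_eq) auto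
  have psi0: "\<psi> 0 \<noteq> 0" using psi_initial eta_upper by auto
  have dpsi0: "d\<psi> 0 = \<eta> * \<psi> 0" using psi_initial psi0 by (auto simp: d0)
  have "cnj (\<psi> 0) * d\<psi> 0 = of_real ((cmod (\<psi> 0))\<^sup>2) * \<eta>"
    unfolding dpsi0 complex_norm_square by simp
  then have pos: "Im (cnj (\<psi> 0) * d\<psi> 0) > 0" using psi0 eta_upper by simp
  interpret complex_frame V \<xi> \<psi> d\<psi> dd\<psi>
    by unfold_locales (use d pos in auto)
  have top: "filterlim phase at_top at_top" by (rule phase_at_top[OF limit_point])
  obtain S where S: "S holomorphic_on {w. Im w > 0}"
    "\<And>w. Im w > 0 \<Longrightarrow> cmod (S w) \<le> 1" "\<And>w. Im w > 0 \<Longrightarrow> weyl_disc w (S w)"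
    by (rule weyl_disc_section) blast
  have S0: "((\<lambda>y::real. S (\<i> * of_real y)) \<longlongrightarrow> 0) (at_right 0)"
    by (rule weyl_section_tendsto_0[OF limit_point normal_limit eta_upper dpsi0 S(3)])
  have a0: "0 \<le> a l" "a l < b l" for l using ab[of l] by auto
  obtain c where c: "limsup (\<lambda>l. ereal (c_weight \<psi> 0 (a l) / c_weight \<psi> 0 (b l))) < ereal c" "c < 1"
    using ereal_dense2[OF c_ratio] by auto
  have ev_ratio: "\<forall>\<^sub>F l in sequentially. phase (a l) / phase (b l) < c"
    using Limsup_lessD[OF c(1)]
  proof eventually_elim
    case (elim l)
    then show ?case using a0[of l] by (simp add: c_weight_eq_phase)
  qed
  have ev_pos: "\<forall>\<^sub>F l in sequentially. phase (b l) > 0"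
    using filterlim_compose[OF top b_infinity] by (simp add: filterlim_at_top_dense)
  have key: "\<forall>\<^sub>F l in sequentially. \<exists>\<mu> \<mu>'. is_labelled_eigenvalue V \<xi> (a l) (b l) j \<mu> \<and>
      is_labelled_eigenvalue V \<xi> (a l) (b l) (j + 1) \<mu>' \<and> \<bar>c_weight \<psi> (a l) (b l) * (\<mu>' - \<mu>) - 1\<bar> < \<epsilon>"
    if \<epsilon>: "\<epsilon> > 0" for \<epsilon>
  proof -
    \<comment> \<open>The eventual lower bound \<open>1 - c\<close> of the slope serves as \<open>\<sigma>0\<close> in \<open>labelled_eigenvalues_spacing\<close>.\<close>
    define e where "e = min (\<epsilon> / 8) (min (1 / 8) ((1 - c) / 8))"
    have e: "e > 0" "8 * e \<le> 1" "4 * e < 1 - c" "8 * e \<le> \<epsilon>"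
      using \<epsilon> c(2) by (auto simp: e_def min_def field_simps)
    define R where "R = ((\<bar>of_int j\<bar> + 2) * pi + 1) / (1 - c)"
    have "R + 2 \<ge> 0" using c(2) by (simp add: R_def)
    then have "\<forall>\<^sub>F b in at_top. \<forall>x\<in>{0..b}. \<forall>\<zeta>\<in>cball 0 (R + 2). cmod (ratio x (\<zeta> / of_real (phase b)) - 1) \<le> e"
      by (intro ratio_uniform_limit[where S = S] top S S0 e)
    from eventually_compose_filterlim[OF this b_infinity] ev_ratio ev_pos show ?thesis
    proof eventually_elim
      case (elim l)
      have \<sigma>: "1 - c \<le> (phase (b l) - phase (a l)) / phase (b l)"
        using elim(2,3) by (simp add: diff_divide_distrib)
      obtain \<mu> \<mu>' where \<mu>: "is_labelled_eigenvalue V \<xi> (a l) (b l) j \<mu>"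
          "is_labelled_eigenvalue V \<xi> (a l) (b l) (j + 1) \<mu>'"
          "\<bar>(phase (b l) - phase (a l)) * (\<mu>' - \<mu>) - pi\<bar> \<le> 8 * e"
        by (rule labelled_eigenvalues_spacing[OF a0 elim(3) less_imp_le[OF e(1)] e(2,3) R_def \<sigma>])
          (use elim(1) in auto)
      have "x / pi * y - 1 = (x * y - pi) / pi" for x y :: real by (simp add: field_simps)
      then have "c_weight \<psi> (a l) (b l) * (\<mu>' - \<mu>) - 1 = ((phase (b l) - phase (a l)) * (\<mu>' - \<mu>) - pi) / pi"
        using c_weight_eq_phase[OF a0(1) less_imp_le[OF a0(2)], of l] by metis
      then have "\<bar>c_weight \<psi> (a l) (b l) * (\<mu>' - \<mu>) - 1\<bar> \<le> 8 * e / pi"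
        using \<mu>(3) by (simp add: abs_divide divide_right_mono)
      also have "\<dots> < \<epsilon>"
      proof -
        have "\<epsilon> * 1 < \<epsilon> * pi" using \<epsilon> pi_gt3 by (intro mult_strict_left_mono) auto
        then show ?thesis using e(4) by (simp add: divide_less_eq)
      qed
      finally show ?case using \<mu>(1,2) by blast
    qed
  qed
  show "(\<forall>\<^sub>F l in sequentially.
         (\<exists>\<mu>. is_labelled_eigenvalue V \<xi> (a l) (b l) j \<mu>) \<and>
         (\<exists>\<mu>. is_labelled_eigenvalue V \<xi> (a l) (b l) (j + 1) \<mu>)) \<and>
      (\<lambda>l. c_weight \<psi> (a l) (b l) *
             (labelled_eigenvalue V \<xi> (a l) (b l) (j + 1) - labelled_eigenvalue V \<xi> (a l) (b l) j))
        \<longlonglongrightarrow> 1"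
  proof
    show "\<forall>\<^sub>F l in sequentially.
         (\<exists>\<mu>. is_labelled_eigenvalue V \<xi> (a l) (b l) j \<mu>) \<and>
         (\<exists>\<mu>. is_labelled_eigenvalue V \<xi> (a l) (b l) (j + 1) \<mu>)"
      using key[of 1] by (auto elim: eventually_mono)
    show "(\<lambda>l. c_weight \<psi> (a l) (b l) *
             (labelled_eigenvalue V \<xi> (a l) (b l) (j + 1) - labelled_eigenvalue V \<xi> (a l) (b l) j))
        \<longlonglongrightarrow> 1"
    proof (rule tendstoI)
      fix \<epsilon> :: real assume "\<epsilon> > 0"
      from key[OF this] show "\<forall>\<^sub>F l in sequentially. dist (c_weight \<psi> (a l) (b l) *
             (labelled_eigenvalue V \<xi> (a l) (b l) (j + 1) - labelled_eigenvalue V \<xi> (a l) (b l) j)) 1 < \<epsilon>"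
        by eventually_elim (auto simp: labelled_eigenvalue_eq dist_real_def)
    qed
  qed
qed

end
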